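(* There exists a universal constant $C_0>0$ such that the following holds. Let $\lambda\ge1$, let $\mathcal C\subseteq\mathbb R^d$ be a $\lambda$-secant-generating balanced cone, let $S_{\mathcal C}=\mathcal C\cap\mathbb S^{d-1}$, let $0<\varepsilon<1$ and $0<\eta<1/2$, and set $$a_{\mathcal C}=C_0\lambda^2w(S_{\mathcal C})^2+\log\left(\frac{16}{\eta}\right).$$ Let $A,B\in O(d)$ and $I\subseteq\{1,\dots,d\}$ with $|I|=m$. Assume that $m\ge2025\,\varepsilon^{-2}a_{\mathcal C}$ and $$36\,\kappa_I(A)\,\Theta_B(\operatorname{Sec}(S_{\mathcal C}))\,m\,(a_{\mathcal C}+\log d)(a_{\mathcal C}+\log m)\le d.$$ Then, with probability at least $1-\eta$, the random linear map $\Phi=\sqrt{\frac dm}\,P_IAD_\xi P_\pi BD_{\xi'}$ satisfies $$\bigl|\|\Phi x\|_2^2-\|x\|_2^2\bigr|\le\varepsilon\|x\|_2^2\qquad\text{for every }x\in\mathcal C.$$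
   Context: $O(d)$ is the group of real orthogonal $d\times d$ matrices, $\mathbb S^{d-1}$ the Euclidean unit sphere of $\mathbb R^d$, $[d]=\{1,\dots,d\}$. $P_I\in\mathbb R^{m\times d}$ is restriction to the coordinates in $I$. $\xi,\xi'$ are uniform on $\{-1,1\}^d$, $\pi$ is a uniform permutation in $S_d$, and $\xi,\xi',\pi$ are independent; $D_\xi=\operatorname{diag}(\xi_1,\dots,\xi_d)$, and $P_\pi$ is the permutation matrix with $(P_\pi x)_k=x_{\pi(k)}$. $\kappa_I(A)=\frac dm\max_{k\in[d]}\sum_{j\in I}A_{jk}^2$, and for $X\subseteq\mathbb S^{d-1}$, $\Theta_B(X)=d\sup_{x\in X,\,k\in[d]}\sum_{j=1}^dB_{kj}^2x_j^2$. A balanced cone is a nonzero set $\mathcal C\subseteq\mathbb R^d$ (i.e. containing a nonzero vector) with $tx\in\mathcal C$ whenever $x\in\mathcal C$, $t\in\mathbb R$. Its normalized secant set is $\operatorname{Sec}(S_{\mathcal C})=\left\{\frac{x-y}{\|x-y\|_2}:x,y\in S_{\mathcal C},\ x\ne y\right\}$. $\mathcal C$ is $\lambda$-secant-generating if for every $x,y\in S_{\mathcal C}$ there exist $s\in\mathbb N$ and $h_1,\dots,h_s\in\mathcal C$ with $x-y=\sum_{j=1}^sh_j$ and $\sum_{j=1}^s\|h_j\|_2\le\lambda\|x-y\|_2$. The Gaussian width of $X\subseteq\mathbb S^{d-1}$ is $w(X)=\mathbb E\sup_{x\in X}\langle g,x\rangle$ with $g\sim N(0,I_d)$. *)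

theory Defs
  imports "HOL-Probability.Probability" "Jordan_Normal_Form.Matrix"
begin

text \<open>
  The dimension has to be quantified inside the theorem, because the constant is chosen before it.
  So vectors of length d and matrices are those of \<^theory>\<open>Jordan_Normal_Form.Matrix\<close>,
  with coordinates indexed by 0, ..., d - 1, and the homonymous notions of the fixed-type
  library are hidden.
\<close>

hide_type (open) Finite_Cartesian_Product.vec
hide_const (open) Finite_Cartesian_Product.vec Determinants.det
  Finite_Cartesian_Product.mat Finite_Cartesian_Product.row
no_notation Finite_Cartesian_Product.vec_nth (infixl \<open>$\<close> 90)
no_notation inner (infix \<open>\<bullet>\<close> 70)

definition norm2 :: "real vec \<Rightarrow> real" where
  "norm2 x = sqrt (x \<bullet> x)"

definition unit_sphere :: "nat \<Rightarrow> real vec set" where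
  "unit_sphere d = {x \<in> carrier_vec d. norm2 x = 1}"

definition orthogonal_group :: "nat \<Rightarrow> real mat set" where
  "orthogonal_group d = {A \<in> carrier_mat d d. transpose_mat A * A = 1\<^sub>m d}"

definition balanced_cone :: "nat \<Rightarrow> real vec set \<Rightarrow> bool" where
  "balanced_cone d C \<longleftrightarrow>
     C \<subseteq> carrier_vec d \<and> (\<exists>x\<in>C. x \<noteq> 0\<^sub>v d) \<and> (\<forall>x\<in>C. \<forall>t. t \<cdot>\<^sub>v x \<in> C)"

definition cone_sphere :: "nat \<Rightarrow> real vec set \<Rightarrow> real vec set" where
  "cone_sphere d C = C \<inter> unit_sphere d"

definition secant_set :: "real vec set \<Rightarrow> real vec set" where
  "secant_set S = {(1 / norm2 (x - y)) \<cdot>\<^sub>v (x - y) | x y. x \<in> S \<and> y \<in> S \<and> x \<noteq> y}"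

definition secant_generating :: "nat \<Rightarrow> real \<Rightarrow> real vec set \<Rightarrow> bool" where
  "secant_generating d lam C \<longleftrightarrow>
     (\<forall>x\<in>cone_sphere d C. \<forall>y\<in>cone_sphere d C.
        \<exists>(s::nat) h. (\<forall>j<s. h j \<in> C) \<and>
          x - y = finsum_vec TYPE(real) d h {..<s} \<and>
          (\<Sum>j<s. norm2 (h j)) \<le> lam * norm2 (x - y))"

definition std_gaussian :: "nat \<Rightarrow> (nat \<Rightarrow> real) measure" where
  "std_gaussian d = PiM {..<d} (\<lambda>_. density lborel std_normal_density)"

text \<open>
  For a nonempty subset X of the unit sphere the supremum is finite, is at most the norm of g in
  absolute value and is lower semicontinuous in g, so the integral is a genuine expectation.
\<close>

definition gaussian_width :: "nat \<Rightarrow> real vec set \<Rightarrow> real" where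
  "gaussian_width d X = (\<integral>g. (SUP x\<in>X. vec d g \<bullet> x) \<partial>std_gaussian d)"

definition kappa :: "nat \<Rightarrow> nat set \<Rightarrow> real mat \<Rightarrow> real" where
  "kappa d I A = real d / real (card I) * Max ((\<lambda>k. \<Sum>j\<in>I. (A $$ (j, k))\<^sup>2) ` {..<d})"

definition Theta :: "nat \<Rightarrow> real mat \<Rightarrow> real vec set \<Rightarrow> real" where
  "Theta d B X = real d * (SUP (x, k)\<in>X \<times> {..<d}. \<Sum>j<d. (B $$ (k, j))\<^sup>2 * (x $ j)\<^sup>2)"

text \<open>Row i of the restriction matrix selects the i-th smallest element of I.\<close>

definition restriction_mat :: "nat \<Rightarrow> nat set \<Rightarrow> real mat" where
  "restriction_mat d I =
     mat (card I) d (\<lambda>(i, j). if j = sorted_list_of_set I ! i then 1 else 0)"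

text \<open>Coordinate k of the image of x under this matrix is coordinate p k of x.\<close>

definition permutation_mat :: "nat \<Rightarrow> (nat \<Rightarrow> nat) \<Rightarrow> real mat" where
  "permutation_mat d p = mat d d (\<lambda>(k, j). if j = p k then 1 else 0)"

definition random_map ::
  "nat \<Rightarrow> nat set \<Rightarrow> real mat \<Rightarrow> real mat \<Rightarrow> (nat \<Rightarrow> real) \<Rightarrow> (nat \<Rightarrow> nat) \<Rightarrow> (nat \<Rightarrow> real) \<Rightarrow> real mat"
where
  "random_map d I A B \<xi> p \<xi>' =
     sqrt (real d / real (card I)) \<cdot>\<^sub>m
       (restriction_mat d I * A * mat_diag d \<xi> * permutation_mat d p * B * mat_diag d \<xi>')"

definition uniform_signs :: "nat \<Rightarrow> (nat \<Rightarrow> real) pmf" where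
  "uniform_signs d = pmf_of_set ({..<d} \<rightarrow>\<^sub>E {-1, 1})"

definition uniform_permutation :: "nat \<Rightarrow> (nat \<Rightarrow> nat) pmf" where
  "uniform_permutation d = pmf_of_set {p. p permutes {..<d}}"

text \<open>The joint law of the three independent random objects.\<close>

definition randomness :: "nat \<Rightarrow> ((nat \<Rightarrow> real) \<times> (nat \<Rightarrow> nat) \<times> (nat \<Rightarrow> real)) pmf" where
  "randomness d =
     pair_pmf (uniform_signs d) (pair_pmf (uniform_permutation d) (uniform_signs d))"

definition cone_complexity :: "real \<Rightarrow> real \<Rightarrow> nat \<Rightarrow> real vec set \<Rightarrow> real \<Rightarrow> real" where
  "cone_complexity C0 lam d C \<eta> =
     C0 * lam\<^sup>2 * (gaussian_width d (cone_sphere d C))\<^sup>2 + ln (16 / \<eta>)"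

end

theory Submission
  imports Defs "Jordan_Normal_Form.Determinant"
begin

text \<open>
  Write Q for the symmetric bilinear form with Q(x, x) = |\<Phi> x|^2 - |x|^2 and M for the supremum of
  its absolute value on the sphere of the cone. By Sudakov minoration that sphere has a net of mesh
  1 / (20 \<lambda>) whose log-cardinality is of order (\<lambda> w)^2. Since the difference between a point and its
  neighbour in the net is a sum of cone elements of total length at most 1/20, replacing both arguments
  of Q by their neighbours costs at most M / 10; hence M is at most 10/9 of its value on the net, which
  by polarization is controlled by the values of Q at finitely many normalized secants. So no chaining
  is needed, only a tail bound for a single flat vector.

  For that vector, conditionally on the permutation, the squared norm of the image is its diagonal
  plus a Rademacher chaos. The diagonal is controlled by the negative association of the values of a
  random permutation. The chaos is controlled by decoupling, given a bound on the operator norm of its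
  matrix; that bound is a matrix Chernoff estimate for a randomly permuted Parseval frame, proved by
  comparing traces of powers under rank one updates.
\<close>

text \<open>The two logarithms in the hypothesis have separate origins. The signs \<xi>' flatten the
  rotated secant, and a union bound over its d coordinates produces a + log d; the matrix Chernoff
  bound carries the trace m of the identity as a prefactor, which a + log m absorbs. The obstacle in
  that bound is that a permutation samples without replacement, so the frame vectors are dependent.
  What survives is a one-step comparison: adding x x^T with |x|^2 \<le> \<beta> changes the trace of
  a power by at most a share of the change caused by the shift T + \<beta>, the operator form of
  bounding a convex function by its chord. Averaged over a Parseval frame that share is again a
  trace, so the recursion closes with scalar shifts only. It is run on powers because these need no
  spectral theorem; the exponential is recovered by summing the power bounds. The net is built at
  dyadic scales since the translation argument has the right order only in balls of radius
  comparable to the mesh. All random signs and permutations are uniform on finite sets, so their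
  expectations are plain averages and conditioning is a change in the order of averaging.\<close>

definition avg :: "'a set \<Rightarrow> ('a \<Rightarrow> real) \<Rightarrow> real" where
  "avg X f = (\<Sum>x\<in>X. f x) / real (card X)"

lemma avg_mono: "(\<And>x. x \<in> X \<Longrightarrow> f x \<le> g x) \<Longrightarrow> avg X f \<le> avg X g"
  unfolding avg_def by (intro divide_right_mono sum_mono) auto

lemma avg_cong: "(\<And>x. x \<in> X \<Longrightarrow> f x = g x) \<Longrightarrow> avg X f = avg X g"
  unfolding avg_def by (auto intro: sum.cong)

lemma avg_nonneg: "(\<And>x. x \<in> X \<Longrightarrow> 0 \<le> f x) \<Longrightarrow> 0 \<le> avg X f"
  unfolding avg_def by (intro divide_nonneg_nonneg sum_nonneg) auto

lemma avg_add: "avg X (\<lambda>x. f x + g x) = avg X f + avg X g"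
  by (simp add: avg_def sum.distrib add_divide_distrib)

lemma avg_diff: "avg X (\<lambda>x. f x - g x) = avg X f - avg X g"
  by (simp add: avg_def sum_subtractf diff_divide_distrib)

lemma avg_cmult: "avg X (\<lambda>x. c * f x) = c * avg X f"
  by (simp add: avg_def sum_distrib_left[symmetric])

lemma avg_const: "finite X \<Longrightarrow> X \<noteq> {} \<Longrightarrow> avg X (\<lambda>x. c) = c"
  by (simp add: avg_def)

lemma avg_sum: "avg X (\<lambda>x. \<Sum>k\<in>K. f k x) = (\<Sum>k\<in>K. avg X (f k))"
  by (simp add: avg_def sum_divide_distrib[symmetric] sum.swap[of _ _ X])

lemma avg_swap: "avg X (\<lambda>x. avg Y (f x)) = avg Y (\<lambda>y. avg X (\<lambda>x. f x y))"
  by (simp add: avg_def sum_divide_distrib[symmetric] sum.swap[of _ Y X] mult.commute)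

lemma avg_reindex: "bij_betw h X X \<Longrightarrow> avg X (\<lambda>x. f (h x)) = avg X f"
  unfolding avg_def by (simp add: sum.reindex_bij_betw)

lemma avg_markov:
  assumes "finite X" "\<And>x. x \<in> X \<Longrightarrow> 0 \<le> f x" "\<And>x. x \<in> X \<Longrightarrow> P x \<Longrightarrow> c \<le> f x"
  shows "avg X (\<lambda>x. of_bool (P x)) * c \<le> avg X f"
proof -
  have "avg X (\<lambda>x. of_bool (P x)) * c = avg X (\<lambda>x. c * of_bool (P x))"
    by (simp add: avg_cmult)
  also have "\<dots> \<le> avg X f"
    using assms by (intro avg_mono) (auto simp: of_bool_def)
  finally show ?thesis .
qed

lemma avg_markov_exp:
  assumes "finite X" "avg X (\<lambda>x. exp (s * f x)) \<le> B" "0 \<le> s"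
  shows "avg X (\<lambda>x. of_bool (t \<le> f x)) \<le> B * exp (- s * t)"
proof -
  have "avg X (\<lambda>x. of_bool (t \<le> f x)) * exp (s * t) \<le> avg X (\<lambda>x. exp (s * f x))"
    by (rule avg_markov) (use assms in \<open>auto simp: mult_left_mono\<close>)
  then have "avg X (\<lambda>x. of_bool (t \<le> f x)) * exp (s * t) * exp (- s * t) \<le> B * exp (- s * t)"
    using assms(2) by (intro mult_right_mono) auto
  then show ?thesis by (simp add: mult.assoc exp_minus_inverse flip: exp_add)
qed

lemma avg_abs_tail:
  assumes "finite X" "0 \<le> s"
    and "avg X (\<lambda>x. exp (s * f x)) \<le> B" "avg X (\<lambda>x. exp (- s * f x)) \<le> B"
  shows "avg X (\<lambda>x. of_bool (t \<le> \<bar>f x\<bar>)) \<le> 2 * B * exp (- s * t)"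
proof -
  have "avg X (\<lambda>x. of_bool (t \<le> \<bar>f x\<bar>)) \<le> avg X (\<lambda>x. of_bool (t \<le> f x) + of_bool (t \<le> - f x))"
    by (rule avg_mono) (auto simp: of_bool_def)
  also have "\<dots> = avg X (\<lambda>x. of_bool (t \<le> f x)) + avg X (\<lambda>x. of_bool (t \<le> - f x))"
    by (rule avg_add)
  also have "\<dots> \<le> B * exp (- s * t) + B * exp (- s * t)"
    using assms by (intro add_mono avg_markov_exp) auto
  finally show ?thesis by simp
qed

lemma avg_union_bound:
  assumes "finite F"
  shows "avg X (\<lambda>x. of_bool (\<exists>z\<in>F. P z x)) \<le> (\<Sum>z\<in>F. avg X (\<lambda>x. of_bool (P z x)))"
proof -
  have "of_bool (\<exists>z\<in>F. P z x) \<le> (\<Sum>z\<in>F. of_bool (P z x) :: real)" for x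
  proof (cases "\<exists>z\<in>F. P z x")
    case True
    then obtain z where z: "z \<in> F" "P z x" by auto
    have "(of_bool (P z x)::real) \<le> (\<Sum>z\<in>F. of_bool (P z x))"
      using z assms by (intro member_le_sum) auto
    then show ?thesis using z True by simp
  qed (auto intro: sum_nonneg)
  then have "avg X (\<lambda>x. of_bool (\<exists>z\<in>F. P z x)) \<le> avg X (\<lambda>x. \<Sum>z\<in>F. of_bool (P z x))"
    by (intro avg_mono) auto
  then show ?thesis by (simp add: avg_sum)
qed

section \<open>Random permutations\<close>

text \<open>Chebyshev's association inequality: the double sum of
  \<open>(f i - f j) * (g i - g j)\<close> is twice the left side minus twice the right
  side.\<close>

lemma chebyshev_opposite_sum:
  fixes f g :: "'a \<Rightarrow> real"
  assumes "finite S" "\<And>i j. i \<in> S \<Longrightarrow> j \<in> S \<Longrightarrow> (f i - f j) * (g i - g j) \<le> 0"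
  shows "real (card S) * (\<Sum>i\<in>S. f i * g i) \<le> (\<Sum>i\<in>S. f i) * (\<Sum>i\<in>S. g i)"
proof -
  have "(\<Sum>i\<in>S. \<Sum>j\<in>S. (f i - f j) * (g i - g j)) =
      2 * (real (card S) * (\<Sum>i\<in>S. f i * g i) - (\<Sum>i\<in>S. f i) * (\<Sum>i\<in>S. g i))"
    by (simp add: algebra_simps sum.distrib sum_subtractf sum_distrib_left[symmetric]
        sum_distrib_right[symmetric])
      (simp add: sum_distrib_left mult_ac)
  moreover have "(\<Sum>i\<in>S. \<Sum>j\<in>S. (f i - f j) * (g i - g j)) \<le> 0"
    using assms by (intro sum_nonpos) auto
  ultimately have "2 * (real (card S) * (\<Sum>i\<in>S. f i * g i) - (\<Sum>i\<in>S. f i) * (\<Sum>i\<in>S. g i)) \<le> 0"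
    by (simp only:)
  then show ?thesis by simp
qed

text \<open>
  Negative association of permutation distributions: given the value at one position,
  the swap of two values is a monotone coupling of the conditional laws.
\<close>

lemma avg_permutation_prod_le:
  fixes M :: "'a \<Rightarrow> 'a \<Rightarrow> real" and r :: "'a \<Rightarrow> real"
  assumes S: "finite S" "S \<noteq> {}" and K: "K \<subseteq> S"
    and nonneg: "\<And>k i. k \<in> S \<Longrightarrow> i \<in> S \<Longrightarrow> 0 \<le> M k i"
    and mono: "\<And>k i j. k \<in> S \<Longrightarrow> i \<in> S \<Longrightarrow> j \<in> S \<Longrightarrow> r i \<le> r j \<Longrightarrow> M k i \<le> M k j"
  shows "avg {\<pi>. \<pi> permutes S} (\<lambda>\<pi>. \<Prod>k\<in>K. M k (\<pi> k)) \<le> (\<Prod>k\<in>K. avg S (M k))"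
proof -
  define P where "P = {\<pi>. \<pi> permutes S}"
  have finP: "finite P" unfolding P_def using S(1) by (rule finite_permutations)
  have neP: "P \<noteq> {}" unfolding P_def using permutes_id by blast
  have "finite K" using K S(1) finite_subset by blast
  from this K have "avg P (\<lambda>\<pi>. \<Prod>k\<in>K. M k (\<pi> k)) \<le> (\<Prod>k\<in>K. avg S (M k))"
  proof (induction K rule: finite_induct)
    case empty
    then show ?case using finP neP by (simp add: avg_const)
  next
    case (insert n K)
    then have n: "n \<in> S" "n \<notin> K" "K \<subseteq> S" by auto
    define G where "G \<pi> = (\<Prod>k\<in>K. M k (\<pi> k))" for \<pi>
    \<comment> \<open>Up to normalization, \<open>g i\<close> is the conditional mean of the
      remaining product given the value i at position n. It moves opposite to \<open>M n\<close>,
      which is what the association inequality needs.\<close>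
    define g where "g i = (\<Sum>\<pi>\<in>{\<pi>\<in>P. \<pi> n = i}. G \<pi>)" for i
    have inS: "\<pi> k \<in> S" if "\<pi> \<in> P" "k \<in> S" for \<pi> k
      using that by (auto simp: P_def permutes_in_image)
    have split: "(\<Sum>\<pi>\<in>P. h (\<pi> n) * G \<pi>) = (\<Sum>i\<in>S. h i * g i)" for h
    proof -
      have "(\<Sum>\<pi>\<in>P. h (\<pi> n) * G \<pi>) = (\<Sum>i\<in>S. \<Sum>\<pi>\<in>{\<pi>\<in>P. \<pi> n = i}. h (\<pi> n) * G \<pi>)"
        using finP S(1) inS n(1) by (intro sum.group[symmetric]) auto
      then show ?thesis by (simp add: g_def sum_distrib_left)
    qed
    have g_antimono: "g j \<le> g i" if ij: "i \<in> S" "j \<in> S" "r i \<le> r j" for i j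
    proof -
      let ?t = "Transposition.transpose i j"
      have t: "?t permutes S" using ij by (simp add: permutes_swap_id)
      have "g j = (\<Sum>\<pi>\<in>{\<pi>\<in>P. \<pi> n = i}. G (?t \<circ> \<pi>))"
        unfolding g_def
        by (rule sum.reindex_bij_witness[where i="\<lambda>\<pi>. ?t \<circ> \<pi>" and j="\<lambda>\<pi>. ?t \<circ> \<pi>"])
          (auto simp: P_def o_assoc[symmetric] permutes_compose[OF _ t] simp flip: o_assoc, auto simp: o_assoc)
      also have "\<dots> \<le> g i"
        unfolding g_def
      proof (intro sum_mono)
        fix \<pi> assume "\<pi> \<in> {\<pi>\<in>P. \<pi> n = i}"
        then have pi: "\<pi> \<in> P" "\<pi> n = i" by auto
        have inj: "inj \<pi>" using pi(1) by (auto simp: P_def permutes_inj)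
        show "G (?t \<circ> \<pi>) \<le> G \<pi>"
          unfolding G_def
        proof (intro prod_mono conjI)
          fix k assume k: "k \<in> K"
          have kS: "k \<in> S" using k n(3) by auto
          \<comment> \<open>The value i is already taken at n, so on K the transposition can only
            replace j by i, which lowers the factor.\<close>
          have "\<pi> k \<noteq> i" using inj pi(2) k n(2) by (metis injD)
          then show "M k ((?t \<circ> \<pi>) k) \<le> M k (\<pi> k)"
            using mono[OF kS ij] by (auto simp: Transposition.transpose_def)
          show "0 \<le> M k ((?t \<circ> \<pi>) k)"
            using nonneg[OF kS] inS[OF pi(1) kS] t by (simp add: permutes_in_image)
        qed
      qed
      finally show ?thesis .
    qed
    have "real (card S) * (\<Sum>i\<in>S. M n i * g i) \<le> (\<Sum>i\<in>S. M n i) * (\<Sum>i\<in>S. g i)"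
    proof (rule chebyshev_opposite_sum[OF S(1)])
      fix i j assume ij: "i \<in> S" "j \<in> S"
      show "(M n i - M n j) * (g i - g j) \<le> 0"
        using mono[OF n(1) ij] mono[OF n(1) ij(2,1)] g_antimono[OF ij] g_antimono[OF ij(2,1)]
        by (cases "r i \<le> r j") (auto simp: mult_le_0_iff)
    qed
    then have "(\<Sum>i\<in>S. M n i * g i) \<le> avg S (M n) * (\<Sum>i\<in>S. g i)"
      using S by (simp add: avg_def field_simps card_gt_0_iff)
    then have "(\<Sum>\<pi>\<in>P. M n (\<pi> n) * G \<pi>) \<le> avg S (M n) * (\<Sum>\<pi>\<in>P. G \<pi>)"
      using split[of "M n"] split[of "\<lambda>_. 1"] by simp
    then have "avg P (\<lambda>\<pi>. M n (\<pi> n) * G \<pi>) \<le> avg S (M n) * avg P G"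
      unfolding avg_def[of P] by (simp add: divide_right_mono)
    also have "\<dots> \<le> avg S (M n) * (\<Prod>k\<in>K. avg S (M k))"
      using insert.IH n nonneg unfolding G_def
      by (intro mult_left_mono avg_nonneg) auto
    finally show ?case using insert.hyps by (simp add: G_def)
  qed
  then show ?thesis by (simp add: P_def)
qed

lemma exp_le_quadratic: "\<bar>x::real\<bar> \<le> 1 \<Longrightarrow> exp x \<le> 1 + x + x\<^sup>2"
proof (cases "0 \<le> x")
  case True
  assume "\<bar>x\<bar> \<le> 1"
  then show ?thesis using exp_bound[of x] True by auto
next
  case False
  assume x: "\<bar>x\<bar> \<le> 1"
  define y where "y = - x"
  have y: "0 \<le> y" "y \<le> 1" using False x by (auto simp: y_def)
  \<comment> \<open>The product is 1 + y^3. It turns the lower bound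
    \<open>1 + y \<le> exp y\<close> into an upper bound for \<open>exp (- y)\<close>.\<close>
  have "1 \<le> (1 + y) * (1 - y + y\<^sup>2)" using y by (simp add: algebra_simps power2_eq_square power3_eq_cube)
  also have "\<dots> \<le> exp y * (1 - y + y\<^sup>2)"
    using y exp_ge_add_one_self[of y] by (intro mult_right_mono) auto
  finally have "exp (- y) * 1 \<le> exp (- y) * (exp y * (1 - y + y\<^sup>2))"
    by (intro mult_left_mono) auto
  also have "\<dots> = 1 - y + y\<^sup>2" by (simp add: mult.assoc[symmetric] flip: exp_add)
  finally show ?thesis by (simp add: y_def)
qed

text \<open>A Bernstein bound for a linear statistic of mean 1 of a random permutation. The variance
  proxy is \<omega> because the square of each term is at most \<omega> times the term, and the
  remaining sums are fixed by the normalizations of c and x.\<close>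

lemma avg_exp_permutation_le:
  fixes c x :: "'a \<Rightarrow> real"
  assumes S: "finite S" "S \<noteq> {}"
    and c: "\<And>k. k \<in> S \<Longrightarrow> 0 \<le> c k" "(\<Sum>k\<in>S. c k) = real (card S)"
    and x: "\<And>i. i \<in> S \<Longrightarrow> 0 \<le> x i" "(\<Sum>i\<in>S. x i) = 1"
    and cx: "\<And>k i. k \<in> S \<Longrightarrow> i \<in> S \<Longrightarrow> c k * x i \<le> \<omega>"
    and s: "\<bar>s\<bar> * \<omega> \<le> 1"
  shows "avg {\<pi>. \<pi> permutes S} (\<lambda>\<pi>. exp (s * ((\<Sum>k\<in>S. c k * x (\<pi> k)) - 1))) \<le> exp (s\<^sup>2 * \<omega>)"
proof -
  let ?P = "{\<pi>. \<pi> permutes S}"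
  let ?n = "real (card S)"
  have n: "?n > 0" using S by (simp add: card_gt_0_iff)
  have "avg ?P (\<lambda>\<pi>. exp (s * (\<Sum>k\<in>S. c k * x (\<pi> k)))) =
      avg ?P (\<lambda>\<pi>. \<Prod>k\<in>S. exp (s * (c k * x (\<pi> k))))"
    by (simp add: sum_distrib_left exp_sum S(1))
  also have "\<dots> \<le> (\<Prod>k\<in>S. avg S (\<lambda>i. exp (s * (c k * x i))))"
  \<comment> \<open>Values are ordered by \<open>s * x i\<close> rather than \<open>x i\<close>, so
    that negative s is covered as well.\<close>
  proof (rule avg_permutation_prod_le[OF S order_refl, where r="\<lambda>i. s * x i"])
    fix k i j assume "k \<in> S" "i \<in> S" "j \<in> S" "s * x i \<le> s * x j"
    then have "c k * (s * x i) \<le> c k * (s * x j)" using c(1) by (rule_tac mult_left_mono) auto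
    then show "exp (s * (c k * x i)) \<le> exp (s * (c k * x j))" by (simp only: exp_le_cancel_iff mult.left_commute[of s])
  qed auto
  also have "\<dots> \<le> (\<Prod>k\<in>S. exp (c k * ((s + s\<^sup>2 * \<omega>) / ?n)))"
  proof (intro prod_mono conjI avg_nonneg)
    fix k assume k: "k \<in> S"
    have "avg S (\<lambda>i. exp (s * (c k * x i))) \<le> avg S (\<lambda>i. 1 + (s * c k + s\<^sup>2 * c k * \<omega>) * x i)"
    proof (rule avg_mono)
      fix i assume i: "i \<in> S"
      have ck: "0 \<le> c k * x i" "c k * x i \<le> \<omega>" using c x cx k i by auto
      have "\<bar>s * (c k * x i)\<bar> = \<bar>s\<bar> * (c k * x i)" using abs_of_nonneg[OF ck(1)] by (simp only: abs_mult[of s])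
      also have "\<dots> \<le> \<bar>s\<bar> * \<omega>" using ck by (intro mult_left_mono) auto
      finally have "exp (s * (c k * x i)) \<le> 1 + s * (c k * x i) + (s * (c k * x i))\<^sup>2"
        using s by (intro exp_le_quadratic) auto
      moreover have "(s * (c k * x i))\<^sup>2 \<le> s\<^sup>2 * ((c k * x i) * \<omega>)"
        using mult_left_mono[OF mult_left_mono[OF ck(2) ck(1)] zero_le_power2[of s]]
        by (simp add: power2_eq_square mult_ac)
      ultimately show "exp (s * (c k * x i)) \<le> 1 + (s * c k + s\<^sup>2 * c k * \<omega>) * x i"
        by (simp add: algebra_simps)
    qed
    also have "\<dots> = 1 + c k * ((s + s\<^sup>2 * \<omega>) / ?n)"
      using x(2) n S by (simp add: avg_add avg_const avg_cmult) (simp add: avg_def algebra_simps add_divide_distrib)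
    also have "\<dots> \<le> exp (c k * ((s + s\<^sup>2 * \<omega>) / ?n))" by (rule exp_ge_add_one_self)
    finally show "avg S (\<lambda>i. exp (s * (c k * x i))) \<le> exp (c k * ((s + s\<^sup>2 * \<omega>) / ?n))" .
  qed auto
  also have "\<dots> = exp (s + s\<^sup>2 * \<omega>)"
    unfolding exp_sum[OF S(1), symmetric] sum_distrib_right[symmetric] c(2) using n by simp
  finally have *: "avg ?P (\<lambda>\<pi>. exp (s * (\<Sum>k\<in>S. c k * x (\<pi> k)))) \<le> exp (s + s\<^sup>2 * \<omega>)" .
  have "avg ?P (\<lambda>\<pi>. exp (s * ((\<Sum>k\<in>S. c k * x (\<pi> k)) - 1))) =
      exp (- s) * avg ?P (\<lambda>\<pi>. exp (s * (\<Sum>k\<in>S. c k * x (\<pi> k))))"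
    by (simp add: avg_cmult[symmetric] exp_add[symmetric] algebra_simps)
  also have "\<dots> \<le> exp (- s) * exp (s + s\<^sup>2 * \<omega>)" using * by (intro mult_left_mono) auto
  finally show ?thesis by (simp flip: exp_add)
qed

section \<open>Random signs\<close>

text \<open>The difference of the logarithms has derivative u - tanh u, which is nonnegative for u
  \<ge> 0.\<close>

lemma cosh_le_exp_half_square: "cosh (x::real) \<le> exp (x\<^sup>2 / 2)"
proof -
  have main: "cosh y \<le> exp (y\<^sup>2 / 2)" if y: "0 \<le> y" for y :: real
  proof -
    have tanh: "tanh t \<le> t" if t: "0 \<le> t" for t :: real
    proof -
      have "0 * cosh 0 - sinh 0 \<le> t * cosh t - sinh t"
      proof (rule DERIV_nonneg_imp_nondecreasing[OF t])
        fix u :: real assume u: "0 \<le> u"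
        have "((\<lambda>u. u * cosh u - sinh u) has_real_derivative u * sinh u) (at u)"
          by (auto intro!: derivative_eq_intros)
        then show "\<exists>z. ((\<lambda>u. u * cosh u - sinh u) has_real_derivative z) (at u) \<and> 0 \<le> z"
          using u by auto
      qed
      then show ?thesis by (simp add: tanh_def field_simps cosh_real_pos)
    qed
    have "0\<^sup>2 / 2 - ln (cosh 0) \<le> y\<^sup>2 / 2 - ln (cosh y)"
    proof (rule DERIV_nonneg_imp_nondecreasing[OF y])
      fix u :: real assume u: "0 \<le> u"
      have "((\<lambda>u. u\<^sup>2 / 2 - ln (cosh u)) has_real_derivative u - tanh u) (at u)"
        by (rule derivative_eq_intros refl | simp add: tanh_def)+
      then show "\<exists>z. ((\<lambda>u. u\<^sup>2 / 2 - ln (cosh u)) has_real_derivative z) (at u) \<and> 0 \<le> z"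
        using tanh[OF u] by auto
    qed
    then have "exp (ln (cosh y)) \<le> exp (y\<^sup>2 / 2)" by (subst exp_le_cancel_iff) simp
    then show ?thesis by (simp add: cosh_real_pos)
  qed
  show ?thesis using main[of "\<bar>x\<bar>"] by (cases "0 \<le> x") auto
qed

definition sign_vectors :: "'a set \<Rightarrow> ('a \<Rightarrow> real) set" where
  "sign_vectors S = S \<rightarrow>\<^sub>E {-1, 1}"

lemma finite_sign_vectors: "finite S \<Longrightarrow> finite (sign_vectors S)"
  by (auto simp: sign_vectors_def intro: finite_PiE)

lemma sign_vectors_nonempty: "sign_vectors S \<noteq> {}"
  by (auto simp: sign_vectors_def PiE_eq_empty_iff)

lemma sign_vectors_square: "\<xi> \<in> sign_vectors S \<Longrightarrow> k \<in> S \<Longrightarrow> \<xi> k * \<xi> k = 1"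
  by (auto simp: sign_vectors_def PiE_def Pi_def)

definition flip :: "'a \<Rightarrow> ('a \<Rightarrow> real) \<Rightarrow> ('a \<Rightarrow> real)" where
  "flip l \<xi> = \<xi>(l := - \<xi> l)"

lemma bij_betw_flip: "l \<in> S \<Longrightarrow> bij_betw (flip l) (sign_vectors S) (sign_vectors S)"
  by (rule bij_betwI[where g="flip l"])
    (auto simp: flip_def sign_vectors_def PiE_def Pi_def extensional_def)

text \<open>Conditional Hoeffding: the signs in L are integrated out one at a time by pairing each
  sign vector with its flip, which turns \<open>exp\<close> into \<open>cosh\<close>. The
  coefficients may depend on signs outside L, as they do after decoupling, and F collects the
  factors already produced.\<close>

lemma avg_sign_vectors_exp_le:
  assumes S: "finite S" "L \<subseteq> S"
    and F: "\<And>\<xi>. 0 \<le> F \<xi>" "\<And>l \<xi>. l \<in> L \<Longrightarrow> F (flip l \<xi>) = F \<xi>"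
    and c: "\<And>l l' \<xi>. l \<in> L \<Longrightarrow> l' \<in> L \<Longrightarrow> c l' (flip l \<xi>) = c l' \<xi>"
  shows "avg (sign_vectors S) (\<lambda>\<xi>. F \<xi> * exp (\<Sum>l\<in>L. \<xi> l * c l \<xi>)) \<le>
    avg (sign_vectors S) (\<lambda>\<xi>. F \<xi> * exp ((\<Sum>l\<in>L. (c l \<xi>)\<^sup>2) / 2))"
proof -
  have "finite L" using S finite_subset by blast
  from this S(2) F c show ?thesis
  proof (induction L arbitrary: F rule: finite_induct)
    case empty
    then show ?case by simp
  next
    case (insert l L)
    define G where "G \<xi> = F \<xi> * exp (\<Sum>l\<in>L. \<xi> l * c l \<xi>)" for \<xi>
    have G0: "0 \<le> G \<xi>" for \<xi> using insert.prems(2) by (simp add: G_def)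
    have Gf: "G (flip l \<xi>) = G \<xi>" for \<xi>
    proof -
      have "(\<Sum>k\<in>L. flip l \<xi> k * c k (flip l \<xi>)) = (\<Sum>k\<in>L. \<xi> k * c k \<xi>)"
      proof (intro sum.cong refl)
        fix k assume k: "k \<in> L"
        then have "k \<noteq> l" "c k (flip l \<xi>) = c k \<xi>" using insert.hyps(2) insert.prems(4) by auto
        then show "flip l \<xi> k * c k (flip l \<xi>) = \<xi> k * c k \<xi>" by (simp add: flip_def)
      qed
      then show ?thesis using insert.prems(3) by (simp add: G_def)
    qed
    have cf: "c l (flip l \<xi>) = c l \<xi>" for \<xi> using insert.prems(4) by auto
    let ?A = "avg (sign_vectors S)"
    have "?A (\<lambda>\<xi>. F \<xi> * exp (\<Sum>l\<in>insert l L. \<xi> l * c l \<xi>)) = ?A (\<lambda>\<xi>. G \<xi> * exp (\<xi> l * c l \<xi>))"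
      using insert.hyps by (simp add: G_def exp_add mult_ac)
    also have "\<dots> = ?A (\<lambda>\<xi>. G (flip l \<xi>) * exp (flip l \<xi> l * c l (flip l \<xi>)))"
      using insert.prems(1) by (intro avg_reindex[symmetric] bij_betw_flip) auto
    also have "\<dots> = ?A (\<lambda>\<xi>. G \<xi> * exp (- \<xi> l * c l \<xi>))"
      by (simp add: Gf cf) (simp add: flip_def)
    finally have "?A (\<lambda>\<xi>. F \<xi> * exp (\<Sum>l\<in>insert l L. \<xi> l * c l \<xi>)) =
        (?A (\<lambda>\<xi>. G \<xi> * exp (\<xi> l * c l \<xi>)) + ?A (\<lambda>\<xi>. G \<xi> * exp (- \<xi> l * c l \<xi>))) / 2"
      using insert.hyps by (simp add: G_def exp_add mult_ac)
    also have "\<dots> = ?A (\<lambda>\<xi>. (1 / 2) * (G \<xi> * exp (\<xi> l * c l \<xi>) + G \<xi> * exp (- \<xi> l * c l \<xi>)))"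
      by (simp only: avg_cmult avg_add)
    also have "\<dots> \<le> ?A (\<lambda>\<xi>. G \<xi> * exp ((c l \<xi>)\<^sup>2 / 2))"
    proof (rule avg_mono)
      fix \<xi> assume xi: "\<xi> \<in> sign_vectors S"
      have "(\<xi> l * c l \<xi>)\<^sup>2 = (c l \<xi>)\<^sup>2"
        using sign_vectors_square[OF xi, of l] insert.prems(1) by (simp add: power_mult_distrib power2_eq_square)
      then have "cosh (\<xi> l * c l \<xi>) \<le> exp ((c l \<xi>)\<^sup>2 / 2)"
        using cosh_le_exp_half_square[of "\<xi> l * c l \<xi>"] by simp
      then have "G \<xi> * cosh (\<xi> l * c l \<xi>) \<le> G \<xi> * exp ((c l \<xi>)\<^sup>2 / 2)"
        using G0 by (intro mult_left_mono) auto
      then show "(1 / 2) * (G \<xi> * exp (\<xi> l * c l \<xi>) + G \<xi> * exp (- \<xi> l * c l \<xi>)) \<le> G \<xi> * exp ((c l \<xi>)\<^sup>2 / 2)"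
        by (simp add: cosh_def algebra_simps)
    qed
    also have "\<dots> = ?A (\<lambda>\<xi>. (F \<xi> * exp ((c l \<xi>)\<^sup>2 / 2)) * exp (\<Sum>l\<in>L. \<xi> l * c l \<xi>))"
      by (simp add: G_def mult_ac)
    also have "\<dots> \<le> ?A (\<lambda>\<xi>. (F \<xi> * exp ((c l \<xi>)\<^sup>2 / 2)) * exp ((\<Sum>l\<in>L. (c l \<xi>)\<^sup>2) / 2))"
      using insert.prems by (intro insert.IH) auto
    also have "\<dots> = ?A (\<lambda>\<xi>. F \<xi> * exp ((\<Sum>l\<in>insert l L. (c l \<xi>)\<^sup>2) / 2))"
      using insert.hyps by (simp add: add_divide_distrib exp_add mult_ac)
    finally show ?case .
  qed
qed

lemma avg_sign_vectors_tail:
  assumes "finite S" "0 \<le> t" "(\<Sum>l\<in>S. (c l)\<^sup>2) \<le> V" "0 < V"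
  shows "avg (sign_vectors S) (\<lambda>\<xi>. of_bool (t \<le> \<bar>\<Sum>l\<in>S. \<xi> l * c l\<bar>)) \<le> 2 * exp (- t\<^sup>2 / (2 * V))"
proof -
  \<comment> \<open>The minimizer of s^2 V / 2 - s t.\<close>
  define s where "s = t / V"
  have *: "avg (sign_vectors S) (\<lambda>\<xi>. exp (s' * (\<Sum>l\<in>S. \<xi> l * c l))) \<le> exp (s\<^sup>2 * V / 2)"
    if "s' = s \<or> s' = - s" for s'
  proof -
    have "avg (sign_vectors S) (\<lambda>\<xi>. exp (s' * (\<Sum>l\<in>S. \<xi> l * c l))) =
        avg (sign_vectors S) (\<lambda>\<xi>. 1 * exp (\<Sum>l\<in>S. \<xi> l * (s' * c l)))"
      by (simp add: sum_distrib_left mult_ac)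
    also have "\<dots> \<le> avg (sign_vectors S) (\<lambda>\<xi>. 1 * exp ((\<Sum>l\<in>S. (s' * c l)\<^sup>2) / 2))"
      using assms(1) by (intro avg_sign_vectors_exp_le) auto
    also have "\<dots> = exp (s\<^sup>2 * (\<Sum>l\<in>S. (c l)\<^sup>2) / 2)"
      using that by (auto simp: avg_const finite_sign_vectors[OF assms(1)] sign_vectors_nonempty
          power_mult_distrib sum_distrib_left)
    also have "\<dots> \<le> exp (s\<^sup>2 * V / 2)"
      using assms(3) by (simp add: mult_left_mono)
    finally show ?thesis .
  qed
  have "avg (sign_vectors S) (\<lambda>\<xi>. of_bool (t \<le> \<bar>\<Sum>l\<in>S. \<xi> l * c l\<bar>)) \<le>
      2 * exp (s\<^sup>2 * V / 2) * exp (- s * t)"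
    using assms(1,2,4) by (intro avg_abs_tail finite_sign_vectors *) (auto simp: s_def)
  also have "\<dots> = 2 * exp (- t\<^sup>2 / (2 * V))"
    using assms(4) by (simp add: s_def exp_add[symmetric] power2_eq_square field_simps)
  finally show ?thesis .
qed

section \<open>Rademacher chaos\<close>

text \<open>Vectors are functions whose values off I are ignored, so the form is only semidefinite:
  a vector of length zero need not be the zero function.\<close>

definition ip :: "'b set \<Rightarrow> ('b \<Rightarrow> real) \<Rightarrow> ('b \<Rightarrow> real) \<Rightarrow> real" where
  "ip I x y = (\<Sum>j\<in>I. x j * y j)"

lemma ip_commute: "ip I x y = ip I y x"
  by (simp add: ip_def mult.commute)

lemma ip_nonneg: "0 \<le> ip I x x"
  by (auto simp: ip_def intro: sum_nonneg)

lemma ip_lin: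
  "ip I (\<lambda>j. x j + y j) z = ip I x z + ip I y z"
  "ip I z (\<lambda>j. x j + y j) = ip I z x + ip I z y"
  "ip I (\<lambda>j. c * x j) z = c * ip I x z"
  "ip I z (\<lambda>j. c * x j) = c * ip I z x"
  by (simp_all add: ip_def algebra_simps sum.distrib sum_distrib_left)

lemma ip_sum:
  "ip I (\<lambda>j. \<Sum>k\<in>K. f k j) z = (\<Sum>k\<in>K. ip I (f k) z)"
  "ip I z (\<lambda>j. \<Sum>k\<in>K. f k j) = (\<Sum>k\<in>K. ip I z (f k))"
  by (simp_all add: ip_def sum_distrib_left sum_distrib_right sum.swap[of _ _ K])

lemma ip_cauchy_schwarz: "(ip I x y)\<^sup>2 \<le> ip I x x * ip I y y"
  using Cauchy_Schwarz_ineq_sum[of x y I] by (simp add: ip_def power2_eq_square)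

lemma exp_avg_le:
  assumes "finite X" "X \<noteq> {}"
  shows "exp (avg X f) \<le> avg X (\<lambda>x. exp (f x))"
proof -
  let ?m = "avg X f"
  have "avg X (\<lambda>x. exp ?m * (1 + (f x - ?m))) \<le> avg X (\<lambda>x. exp (f x))"
  proof (rule avg_mono)
    fix x
    have "exp ?m * (1 + (f x - ?m)) \<le> exp ?m * exp (f x - ?m)"
      by (intro mult_left_mono exp_ge_add_one_self) auto
    then show "exp ?m * (1 + (f x - ?m)) \<le> exp (f x)" by (simp flip: exp_add)
  qed
  moreover have "avg X (\<lambda>x. exp ?m * (1 + (f x - ?m))) = exp ?m"
    using assms by (simp add: avg_cmult avg_add avg_diff avg_const)
  ultimately show ?thesis by simp
qed

text \<open>Jensen's inequality for the power \<theta>, read on cumulants: shrinking the parameter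
  by \<theta> shrinks the bound by \<theta>. This is what lets the chaos estimate close on
  itself.\<close>

lemma avg_exp_mult_le:
  assumes "0 \<le> \<theta>" "\<theta> \<le> 1" "avg X (\<lambda>x. exp (f x)) \<le> exp c" "finite X" "X \<noteq> {}"
  shows "avg X (\<lambda>x. exp (\<theta> * f x)) \<le> exp (\<theta> * c)"
proof -
  have "avg X (\<lambda>x. exp (\<theta> * f x)) \<le>
      avg X (\<lambda>x. exp (\<theta> * c) * ((1 - \<theta>) + \<theta> * exp (- c) * exp (f x)))"
  proof (rule avg_mono)
    fix x
    have "exp ((1 - \<theta>) *\<^sub>R 0 + \<theta> *\<^sub>R (f x - c)) \<le> (1 - \<theta>) * exp 0 + \<theta> * exp (f x - c)"
      using assms by (intro convex_onD[OF exp_convex]) auto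
    then have "exp (\<theta> * c) * exp (\<theta> * (f x - c)) \<le> exp (\<theta> * c) * ((1 - \<theta>) + \<theta> * exp (f x - c))"
      by (intro mult_left_mono) auto
    moreover have "exp (\<theta> * c) * exp (\<theta> * (f x - c)) = exp (\<theta> * f x)"
      by (simp add: algebra_simps flip: exp_add)
    moreover have "exp (f x - c) = exp (- c) * exp (f x)" by (simp flip: exp_add)
    ultimately show "exp (\<theta> * f x) \<le> exp (\<theta> * c) * ((1 - \<theta>) + \<theta> * exp (- c) * exp (f x))"
      by (simp add: mult.assoc)
  qed
  also have "\<dots> = exp (\<theta> * c) * ((1 - \<theta>) + \<theta> * exp (- c) * avg X (\<lambda>x. exp (f x)))"
    using assms by (simp add: avg_cmult avg_add avg_const)
  also have "\<dots> \<le> exp (\<theta> * c) * ((1 - \<theta>) + \<theta> * exp (- c) * exp c)"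
    using assms by (intro mult_left_mono add_left_mono) auto
  finally show ?thesis by (simp add: mult.assoc flip: exp_add)
qed

text \<open>Toggling the membership of one point preserves the uniform law on subsets, so k and l
  are members independently with probability 1/2 each.\<close>

lemma avg_Pow_separates:
  assumes J: "finite J" and kl: "k \<in> J" "l \<in> J" "k \<noteq> l"
  shows "avg (Pow J) (\<lambda>A. of_bool (k \<in> A \<and> l \<notin> A)) = 1 / 4"
proof -
  have fin: "finite (Pow J)" "Pow J \<noteq> {}" using J by auto
  have half: "avg (Pow J) f = avg (Pow J) (\<lambda>A. (1 / 2) * (f A + f (A - {i} \<union> ({i} - A))))"
    if i: "i \<in> J" for i and f :: "'a set \<Rightarrow> real"
  proof -
    have "bij_betw (\<lambda>A. A - {i} \<union> ({i} - A)) (Pow J) (Pow J)"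
      using i by (intro bij_betwI[where g="\<lambda>A. A - {i} \<union> ({i} - A)"]) auto
    from avg_reindex[OF this] show ?thesis unfolding avg_cmult avg_add by simp
  qed
  have "avg (Pow J) (\<lambda>A. of_bool (k \<in> A \<and> l \<notin> A)) = avg (Pow J) (\<lambda>A. (1 / 2) * of_bool (l \<notin> A))"
    by (subst half[OF kl(1)]) (rule avg_cong, use kl in auto)
  also have "\<dots> = (1 / 2) * avg (Pow J) (\<lambda>A. of_bool (l \<notin> A))" by (rule avg_cmult)
  also have "avg (Pow J) (\<lambda>A. of_bool (l \<notin> A)) = avg (Pow J) (\<lambda>A. 1 / 2)"
    by (subst half[OF kl(2)]) (rule avg_cong, use kl in auto)
  finally show ?thesis using fin by (simp add: avg_const)
qed

definition sign_sum :: "('a \<Rightarrow> 'b \<Rightarrow> real) \<Rightarrow> 'a set \<Rightarrow> ('a \<Rightarrow> real) \<Rightarrow> 'b \<Rightarrow> real" where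
  "sign_sum p J \<xi> = (\<lambda>j. \<Sum>k\<in>J. \<xi> k * p k j)"

text \<open>On sign vectors the subtracted sum is the diagonal of the quadratic form, since squared
  signs are 1; what is left is the off-diagonal part of the Gram matrix of p.\<close>

definition chaos :: "'b set \<Rightarrow> ('a \<Rightarrow> 'b \<Rightarrow> real) \<Rightarrow> 'a set \<Rightarrow> ('a \<Rightarrow> real) \<Rightarrow> real" where
  "chaos I p J \<xi> = ip I (sign_sum p J \<xi>) (sign_sum p J \<xi>) - (\<Sum>k\<in>J. ip I (p k) (p k))"

lemma ip_sign_sum:
  "ip I (sign_sum p J \<xi>) z = (\<Sum>k\<in>J. \<xi> k * ip I (p k) z)"
  "ip I z (sign_sum p J \<xi>) = (\<Sum>k\<in>J. \<xi> k * ip I z (p k))"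
  by (simp_all add: sign_sum_def ip_sum ip_lin)

text \<open>A uniformly random A contains k and omits l with probability 1/4 if k and l differ, and
  never if they agree. This accounts both for the factor 4 and for the disappearance of the
  diagonal.\<close>

lemma chaos_decouple:
  assumes S: "finite S" "J \<subseteq> S" and xi: "\<xi> \<in> sign_vectors S"
  shows "chaos I p J \<xi> =
    avg (Pow J) (\<lambda>A. 4 * ip I (sign_sum p A \<xi>) (sign_sum p (J - A) \<xi>))"
proof -
  let ?D = "\<lambda>A. ip I (sign_sum p A \<xi>) (sign_sum p (J - A) \<xi>)"
  have J: "finite J" using S finite_subset by blast
  define X where "X k l = \<xi> k * \<xi> l * ip I (p k) (p l)" for k l
  have "avg (Pow J) (\<lambda>A. 4 * ?D A) =
      avg (Pow J) (\<lambda>A. \<Sum>k\<in>J. \<Sum>l\<in>J. (4 * X k l) * of_bool (k \<in> A \<and> l \<notin> A))"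
  proof (rule avg_cong)
    fix A assume "A \<in> Pow J"
    then have A: "A \<subseteq> J" by auto
    have "?D A = (\<Sum>k\<in>A. \<Sum>l\<in>J-A. X k l)"
      by (simp only: ip_sign_sum(1)) (simp add: ip_sign_sum(2) X_def sum_distrib_left mult_ac)
    also have "\<dots> = (\<Sum>k\<in>A. \<Sum>l\<in>J. X k l * of_bool (l \<notin> A))"
      using J by (intro sum.cong refl sum.mono_neutral_cong_left) auto
    also have "\<dots> = (\<Sum>k\<in>J. \<Sum>l\<in>J. X k l * of_bool (k \<in> A \<and> l \<notin> A))"
      using J A by (intro sum.mono_neutral_cong_left) auto
    finally show "4 * ?D A =
        (\<Sum>k\<in>J. \<Sum>l\<in>J. (4 * X k l) * of_bool (k \<in> A \<and> l \<notin> A))"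
      by (simp add: sum_distrib_left mult_ac)
  qed
  also have "\<dots> = (\<Sum>k\<in>J. \<Sum>l\<in>J. (4 * X k l) * avg (Pow J) (\<lambda>A. of_bool (k \<in> A \<and> l \<notin> A)))"
    by (simp only: avg_sum avg_cmult)
  also have "\<dots> = (\<Sum>k\<in>J. \<Sum>l\<in>J. X k l - of_bool (k = l) * X k l)"
  proof (intro sum.cong refl)
    fix k l assume "k \<in> J" "l \<in> J"
    then show "(4 * X k l) * avg (Pow J) (\<lambda>A. of_bool (k \<in> A \<and> l \<notin> A)) = X k l - of_bool (k = l) * X k l"
      using avg_Pow_separates[OF J, of k l] by (cases "k = l") (auto simp: avg_def)
  qed
  also have "\<dots> = (\<Sum>k\<in>J. \<Sum>l\<in>J. X k l) - (\<Sum>k\<in>J. X k k)"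
    using J by (simp add: sum_subtractf of_bool_def if_distrib[of "\<lambda>x. x * _"] sum.delta' cong: if_cong)
  also have "(\<Sum>k\<in>J. X k k) = (\<Sum>k\<in>J. ip I (p k) (p k))"
    using S(2) sign_vectors_square[OF xi] by (intro sum.cong) (auto simp: X_def)
  also have "(\<Sum>k\<in>J. \<Sum>l\<in>J. X k l) = ip I (sign_sum p J \<xi>) (sign_sum p J \<xi>)"
    by (simp only: ip_sign_sum(1)) (simp add: ip_sign_sum(2) X_def sum_distrib_left mult_ac)
  finally show ?thesis by (simp add: chaos_def)
qed

text \<open>Given the signs in A, the decoupled form is linear in the signs of \<open>J - A\<close>.
  Integrating these out leaves, by the frame bound h, the squared norm of
  \<open>sign_sum p A\<close>. That is a diagonal of at most T plus a chaos on A, now with the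
  quadratic parameter 8 s^2 h.\<close>

lemma avg_exp_chaos_step:
  assumes S: "finite S" "J \<subseteq> S"
    and h: "\<And>x. (\<Sum>k\<in>S. (ip I (p k) x)\<^sup>2) \<le> h * ip I x x" "0 \<le> h"
    and T: "(\<Sum>k\<in>S. ip I (p k) (p k)) = T"
  shows "avg (sign_vectors S) (\<lambda>\<xi>. exp (s * chaos I p J \<xi>)) \<le>
    exp (8 * s\<^sup>2 * h * T) *
      avg (Pow J) (\<lambda>A. avg (sign_vectors S) (\<lambda>\<xi>. exp (8 * s\<^sup>2 * h * chaos I p A \<xi>)))"
proof -
  have J: "finite (Pow J)" "Pow J \<noteq> {}" using S finite_subset by auto
  let ?V = "avg (sign_vectors S)"
  let ?D = "\<lambda>A \<xi>. ip I (sign_sum p A \<xi>) (sign_sum p (J - A) \<xi>)"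
  let ?e = "\<lambda>A \<xi>. exp (8 * s\<^sup>2 * h * chaos I p A \<xi>)"
  have "?V (\<lambda>\<xi>. exp (s * chaos I p J \<xi>)) \<le>
      ?V (\<lambda>\<xi>. avg (Pow J) (\<lambda>A. exp (s * (4 * ?D A \<xi>))))"
  proof (rule avg_mono)
    fix \<xi> assume xi: "\<xi> \<in> sign_vectors S"
    show "exp (s * chaos I p J \<xi>) \<le>
        avg (Pow J) (\<lambda>A. exp (s * (4 * ?D A \<xi>)))"
      using exp_avg_le[OF J, of "\<lambda>A. s * (4 * ?D A \<xi>)"]
      unfolding avg_cmult[of _ s] chaos_decouple[OF S xi] .
  qed
  also have "\<dots> = avg (Pow J) (\<lambda>A. ?V (\<lambda>\<xi>. exp (s * (4 * ?D A \<xi>))))"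
    by (rule avg_swap)
  also have "\<dots> \<le> avg (Pow J) (\<lambda>A. exp (8 * s\<^sup>2 * h * T) * ?V (?e A))"
  proof (rule avg_mono)
    fix A assume "A \<in> Pow J"
    then have A: "A \<subseteq> J" "A \<subseteq> S" using S by auto
    define c where "c l \<xi> = 4 * s * ip I (p l) (sign_sum p A \<xi>)" for l \<xi>
    have "sign_sum p A (flip l \<xi>) = sign_sum p A \<xi>" if "l \<in> J - A" for l \<xi>
      using that by (auto simp: sign_sum_def flip_def intro!: ext sum.cong)
    then have inv: "c l' (flip l \<xi>) = c l' \<xi>" if "l \<in> J - A" for l l' \<xi>
      using that by (simp add: c_def)
    have "?V (\<lambda>\<xi>. exp (s * (4 * ?D A \<xi>))) =
        ?V (\<lambda>\<xi>. 1 * exp (\<Sum>l\<in>J-A. \<xi> l * c l \<xi>))"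
      by (simp add: ip_sign_sum(2) c_def sum_distrib_left ip_commute[of I "sign_sum p A _"] mult_ac)
    also have "\<dots> \<le> ?V (\<lambda>\<xi>. 1 * exp ((\<Sum>l\<in>J-A. (c l \<xi>)\<^sup>2) / 2))"
      using S inv by (intro avg_sign_vectors_exp_le) auto
    also have "\<dots> \<le> ?V (\<lambda>\<xi>. exp (8 * s\<^sup>2 * h * T) * ?e A \<xi>)"
    proof (rule avg_mono)
      fix \<xi>
      let ?y = "sign_sum p A \<xi>"
      have "(\<Sum>l\<in>J-A. (c l \<xi>)\<^sup>2) \<le> (\<Sum>l\<in>S. (c l \<xi>)\<^sup>2)"
        using S by (intro sum_mono2) auto
      also have "\<dots> = 16 * s\<^sup>2 * (\<Sum>l\<in>S. (ip I (p l) ?y)\<^sup>2)"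
        by (simp add: c_def power_mult_distrib sum_distrib_left)
      also have "\<dots> \<le> 16 * s\<^sup>2 * (h * ip I ?y ?y)"
        using h by (intro mult_left_mono) auto
      also have "\<dots> = 16 * s\<^sup>2 * (h * (chaos I p A \<xi> + (\<Sum>k\<in>A. ip I (p k) (p k))))"
        by (simp add: chaos_def)
      also have "\<dots> \<le> 16 * s\<^sup>2 * (h * (chaos I p A \<xi> + T))"
        unfolding T[symmetric] using S A h(2)
        by (intro mult_left_mono add_left_mono sum_mono2) (auto simp: ip_nonneg)
      finally show "1 * exp ((\<Sum>l\<in>J-A. (c l \<xi>)\<^sup>2) / 2) \<le>
          exp (8 * s\<^sup>2 * h * T) * ?e A \<xi>"
        by (simp add: exp_add[symmetric] algebra_simps)
    qed
    also have "\<dots> = exp (8 * s\<^sup>2 * h * T) * ?V (?e A)"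
      by (rule avg_cmult)
    finally show "?V (\<lambda>\<xi>. exp (s * (4 * ?D A \<xi>))) \<le> \<dots>" .
  qed
  also have "\<dots> = exp (8 * s\<^sup>2 * h * T) *
      avg (Pow J) (\<lambda>A. ?V (?e A))"
    by (rule avg_cmult)
  finally show ?thesis .
qed

text \<open>
  The decoupling step bounds the cumulant at s by half of the worst cumulant over all
  sub-chaoses, so the worst cumulant absorbs itself.
\<close>

lemma avg_exp_chaos_le:
  assumes S: "finite S" "J \<subseteq> S"
    and h: "\<And>x. (\<Sum>k\<in>S. (ip I (p k) x)\<^sup>2) \<le> h * ip I x x" "0 \<le> h"
    and T: "(\<Sum>k\<in>S. ip I (p k) (p k)) = T"
    and s: "16 * h * \<bar>s\<bar> \<le> 1"
  shows "avg (sign_vectors S) (\<lambda>\<xi>. exp (s * chaos I p J \<xi>)) \<le> exp (16 * s\<^sup>2 * h * T)"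
proof -
  let ?V = "avg (sign_vectors S)"
  have V: "finite (sign_vectors S)" "sign_vectors S \<noteq> {}"
    using S by (auto simp: finite_sign_vectors sign_vectors_nonempty)
  \<comment> \<open>The absolute value is taken because the decoupling step returns a nonnegative
    parameter; a negative s is reached by one further step at the end.\<close>
  define K where "K A = ?V (\<lambda>\<xi>. exp (\<bar>s\<bar> * chaos I p A \<xi>))" for A
  have K_pos: "0 < K A" for A
    unfolding K_def avg_def using V by (intro divide_pos_pos sum_pos) (auto simp: card_gt_0_iff)
  define c where "c = Max ((\<lambda>A. ln (K A)) ` Pow S)"
  have fin: "finite ((\<lambda>A. ln (K A)) ` Pow S)" "(\<lambda>A. ln (K A)) ` Pow S \<noteq> {}" using S by auto
  have K_le: "K A \<le> exp c" if "A \<subseteq> S" for A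
  proof -
    have "ln (K A) \<le> c" unfolding c_def using that fin by (intro Max_ge) auto
    then show ?thesis using K_pos[of A] by (metis exp_le_cancel_iff exp_ln)
  qed
  \<comment> \<open>The empty chaos makes c nonnegative, so that \<theta> c \<le> c / 2
    below.\<close>
  have "K {} = 1" using V by (simp add: K_def chaos_def sign_sum_def ip_def avg_const)
  then have c0: "0 \<le> c" using K_le[of "{}"] by simp
  \<comment> \<open>The parameter 8 s^2 h returned by the step is \<theta> times the absolute value
    of s, and the hypothesis on s says \<theta> \<le> 1/2.\<close>
  define \<theta> where "\<theta> = 8 * \<bar>s\<bar> * h"
  have \<theta>: "0 \<le> \<theta>" "\<theta> \<le> 1 / 2" using s h by (auto simp: \<theta>_def mult_ac)
  have step: "?V (\<lambda>\<xi>. exp (s' * chaos I p J' \<xi>)) \<le> exp (8 * s\<^sup>2 * h * T + c / 2)"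
    if J': "J' \<subseteq> S" and s': "s' = s \<or> s' = \<bar>s\<bar>" for s' J'
  proof -
    have s2: "s'\<^sup>2 = s\<^sup>2" using s' by auto
    have fJ: "finite (Pow J')" "Pow J' \<noteq> {}" using S(1) J' finite_subset by auto
    have "avg (Pow J') (\<lambda>A. ?V (\<lambda>\<xi>. exp (8 * s\<^sup>2 * h * chaos I p A \<xi>))) \<le> avg (Pow J') (\<lambda>A. exp (c / 2))"
    proof (rule avg_mono)
      fix A assume "A \<in> Pow J'"
      then have A: "A \<subseteq> S" using J' by auto
      have "?V (\<lambda>\<xi>. exp (8 * s\<^sup>2 * h * chaos I p A \<xi>)) = ?V (\<lambda>\<xi>. exp (\<theta> * (\<bar>s\<bar> * chaos I p A \<xi>)))"
        by (simp add: \<theta>_def power2_eq_square mult_ac)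
          (metis (no_types, opaque_lifting) abs_mult_self_eq mult.left_commute mult.commute)
      also have "\<dots> \<le> exp (\<theta> * c)"
        using \<theta> V K_le[OF A] by (intro avg_exp_mult_le) (auto simp: K_def)
      also have "\<dots> \<le> exp (c / 2)" using \<theta> c0 mult_right_mono[of \<theta> "1/2" c] by simp
      finally show "?V (\<lambda>\<xi>. exp (8 * s\<^sup>2 * h * chaos I p A \<xi>)) \<le> exp (c / 2)" .
    qed
    then have "exp (8 * s\<^sup>2 * h * T) * avg (Pow J') (\<lambda>A. ?V (\<lambda>\<xi>. exp (8 * s\<^sup>2 * h * chaos I p A \<xi>))) \<le>
        exp (8 * s\<^sup>2 * h * T) * exp (c / 2)"
      using fJ by (intro mult_left_mono) (auto simp: avg_const)
    from order_trans[OF avg_exp_chaos_step[OF S(1) J' h T, of s', unfolded s2] this]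
    show ?thesis unfolding exp_add .
  qed
  have "c \<in> (\<lambda>A. ln (K A)) ` Pow S" unfolding c_def using fin by (rule Max_in)
  then obtain A where A: "A \<subseteq> S" "c = ln (K A)" by auto
  have "K A \<le> exp (8 * s\<^sup>2 * h * T + c / 2)" unfolding K_def using step[OF A(1)] by simp
  then have "c \<le> 8 * s\<^sup>2 * h * T + c / 2" using K_pos[of A] A(2) by (metis exp_le_cancel_iff exp_ln)
  then have "8 * s\<^sup>2 * h * T + c / 2 \<le> 16 * s\<^sup>2 * h * T" by linarith
  then have "exp (8 * s\<^sup>2 * h * T + c / 2) \<le> exp (16 * s\<^sup>2 * h * T)" by (subst exp_le_cancel_iff)
  from order_trans[OF step[OF S(2) disjI1[OF refl]] this] show ?thesis .
qed

section \<open>Positive operators and their moments\<close>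

type_synonym 'b operator = "('b \<Rightarrow> real) \<Rightarrow> 'b \<Rightarrow> real"

text \<open>Linearity is an equality of whole functions, including values off I, because iterates of
  T are expanded as functions before any inner product is taken.\<close>

definition psd_op :: "'b set \<Rightarrow> 'b operator \<Rightarrow> bool" where
  "psd_op I T \<longleftrightarrow> (\<forall>x y. ip I x (T y) = ip I (T x) y) \<and> (\<forall>x. 0 \<le> ip I x (T x)) \<and>
    (\<forall>x y c. T (\<lambda>j. x j + c * y j) = (\<lambda>j. T x j + c * T y j))"

lemma psd_opD:
  assumes "psd_op I T"
  shows psd_op_sym: "ip I x (T y) = ip I (T x) y"
    and psd_op_nonneg: "0 \<le> ip I x (T x)"
    and psd_op_linear: "T (\<lambda>j. x j + c * y j) = (\<lambda>j. T x j + c * T y j)"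
  using assms by (auto simp: psd_op_def)

lemma psd_op_pow_sym:
  assumes "psd_op I T"
  shows "ip I x ((T ^^ n) y) = ip I ((T ^^ n) x) y"
proof (induction n arbitrary: x y)
  case (Suc n)
  have "ip I x ((T ^^ Suc n) y) = ip I (T x) ((T ^^ n) y)"
    by (simp add: psd_op_sym[OF assms])
  also have "\<dots> = ip I ((T ^^ n) (T x)) y" by (rule Suc)
  finally show ?case by (simp add: funpow_swap1)
qed simp

lemma psd_op_pow_linear:
  assumes "psd_op I T"
  shows "(T ^^ n) (\<lambda>j. x j + c * y j) = (\<lambda>j. (T ^^ n) x j + c * (T ^^ n) y j)"
  by (induction n) (simp_all add: psd_op_linear[OF assms])

lemma psd_op_moment_split:
  assumes "psd_op I T"
  shows "ip I ((T ^^ a) x) ((T ^^ b) y) = ip I x ((T ^^ (a + b)) y)"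
  by (simp add: psd_op_pow_sym[OF assms, symmetric] funpow_add)

lemma psd_op_cauchy_schwarz:
  assumes T: "psd_op I T"
  shows "(ip I x (T y))\<^sup>2 \<le> ip I x (T x) * ip I y (T y)"
proof -
  define A B C where "A = ip I x (T x)" and "B = ip I x (T y)" and "C = ip I y (T y)"
  have B': "ip I y (T x) = B" unfolding B_def by (simp add: psd_op_sym[OF T, of y x] ip_commute)
  have q: "0 \<le> A + 2 * c * B + c\<^sup>2 * C" for c
  proof -
    have "0 \<le> ip I (\<lambda>j. x j + c * y j) (T (\<lambda>j. x j + c * y j))" by (rule psd_op_nonneg[OF T])
    also have "\<dots> = A + 2 * c * B + c\<^sup>2 * C"
      unfolding psd_op_linear[OF T] ip_lin B' by (simp add: A_def B_def[symmetric] C_def power2_eq_square algebra_simps)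
    finally show ?thesis .
  qed
  have A: "0 \<le> A" and C: "0 \<le> C" unfolding A_def C_def by (auto intro: psd_op_nonneg[OF T])
  have "B\<^sup>2 \<le> A * C"
  proof (cases "C = 0")
    case True
    have "B = 0"
    proof (rule ccontr)
      assume B: "B \<noteq> 0"
      \<comment> \<open>At this c the expression equals -1.\<close>
      have "0 \<le> A + 2 * (- (A + 1) / (2 * B)) * B" using q[of "- (A + 1) / (2 * B)"] True by simp
      with B show False by (simp add: field_simps)
    qed
    then show ?thesis using A C by simp
  next
    case False
    with C have C: "0 < C" by simp
    \<comment> \<open>The minimum of the quadratic, attained at c = -B / C, multiplied by C.\<close>
    have "0 \<le> (A + 2 * (- B / C) * B + (- B / C)\<^sup>2 * C) * C" by (rule mult_nonneg_nonneg[OF q less_imp_le[OF C]])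
    also have "\<dots> = A * C - B\<^sup>2" using C by (simp add: field_simps power2_eq_square)
    finally show ?thesis by simp
  qed
  then show ?thesis by (simp add: A_def B_def C_def)
qed

text \<open>Half of the powers move to the other argument. An even exponent leaves a squared norm,
  an odd one leaves a single T in the middle.\<close>

lemma psd_op_moment_nonneg:
  assumes T: "psd_op I T"
  shows "0 \<le> ip I x ((T ^^ n) x)"
proof (cases "even n")
  case True
  then obtain q where "n = q + q" by (auto elim!: evenE simp: mult_2)
  then show ?thesis using psd_op_moment_split[OF T, of q x q x] ip_nonneg[of I "(T ^^ q) x"] by simp
next
  case False
  then obtain q where "n = q + Suc q" by (auto elim!: oddE simp: mult_2)
  then show ?thesis
    using psd_op_moment_split[OF T, of q x "Suc q" x] psd_op_nonneg[OF T, of "(T ^^ q) x"] by simp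
qed

text \<open>This is the log-convexity of the moments of the spectral measure of T at x. The split by
  parity obtains it from Cauchy-Schwarz for \<open>ip\<close> or for the form of T, without spectral
  theory.\<close>

lemma psd_op_moment_log_convex:
  assumes T: "psd_op I T"
  shows "(ip I x ((T ^^ (n + 1)) x))\<^sup>2 \<le> ip I x ((T ^^ n) x) * ip I x ((T ^^ (n + 2)) x)"
proof (cases "even n")
  case True
  then obtain q where n: "n = q + q" by (auto elim!: evenE simp: mult_2)
  show ?thesis
    using ip_cauchy_schwarz[of I "(T ^^ q) x" "(T ^^ Suc q) x"]
    unfolding psd_op_moment_split[OF T] by (simp add: n)
next
  case False
  then obtain q where n: "n = q + Suc q" by (auto elim!: oddE simp: mult_2)
  have *: "ip I ((T ^^ a) x) (T ((T ^^ b) x)) = ip I x ((T ^^ (a + Suc b)) x)" for a b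
    using psd_op_moment_split[OF T, of a x "Suc b" x] by simp
  show ?thesis
    using psd_op_cauchy_schwarz[OF T, of "(T ^^ q) x" "(T ^^ Suc q) x"]
    unfolding * by (simp add: n)
qed

text \<open>Log-convexity makes successive ratios increase, so moving the indices a, b outwards to
  0, a + b can only enlarge the product. The ratios are kept cross-multiplied because terms may
  vanish.\<close>

lemma log_convex_seq_mult_le:
  fixes t :: "nat \<Rightarrow> real"
  assumes nonneg: "\<And>n. 0 \<le> t n" and lc: "\<And>n. (t (n + 1))\<^sup>2 \<le> t n * t (n + 2)"
  shows "t a * t b \<le> t 0 * t (a + b)"
proof -
  have ratio: "t (n + 1) * t (n + k) \<le> t n * t (n + k + 1)" for n k
  proof (induction k)
    case (Suc k)
    let ?m = "n + k"
    have lc': "t (?m + 1) * t (?m + 1) \<le> t ?m * t (?m + 2)"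
      using lc[of ?m] by (simp add: power2_eq_square)
    show ?case
    proof (cases "t ?m = 0")
      \<comment> \<open>A zero term forces the next term to vanish, which makes the left side
        zero.\<close>
      case True
      with lc' have "t (?m + 1) * t (?m + 1) \<le> 0" by simp
      then have "t (?m + 1) = 0" using mult_le_0_iff[of "t (?m + 1)" "t (?m + 1)"] nonneg[of "?m + 1"] by auto
      then show ?thesis using nonneg[of n] nonneg[of "n + Suc k + 1"] by simp
    next
      case False
      then have pos: "0 < t ?m" using nonneg[of ?m] by simp
      have "t ?m * (t (n + 1) * t (?m + 1)) = (t (n + 1) * t ?m) * t (?m + 1)" by simp
      also have "\<dots> \<le> (t n * t (?m + 1)) * t (?m + 1)"
        using Suc nonneg by (intro mult_right_mono) auto
      also have "\<dots> = t n * (t (?m + 1) * t (?m + 1))" by simp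
      also have "\<dots> \<le> t n * (t ?m * t (?m + 2))"
        using lc' nonneg by (intro mult_left_mono) auto
      also have "\<dots> = t ?m * (t n * t (?m + 2))" by simp
      finally show ?thesis using pos by (simp add: mult_le_cancel_left_pos)
    qed
  qed (simp add: mult.commute)
  have "t a * t (a' + a) \<le> t 0 * t (a + (a' + a))" for a a'
  proof (induction a arbitrary: a')
    case (Suc a)
    have "t (Suc a) * t (a' + Suc a) \<le> t a * t (Suc a' + Suc a)"
      using ratio[of a "Suc a'"] by (simp add: add_ac)
    also have "\<dots> = t a * t (Suc (Suc a') + a)" by simp
    also have "\<dots> \<le> t 0 * t (a + (Suc (Suc a') + a))" by (rule Suc)
    also have "a + (Suc (Suc a') + a) = Suc a + (a' + Suc a)" by simp
    finally show ?case .
  qed simp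
  from this[of a "b - a"] this[of b "a - b"] show ?thesis
    by (cases "a \<le> b") (simp_all add: mult.commute add.commute)
qed

lemma psd_op_moment_mult_le:
  assumes "psd_op I T"
  shows "ip I x ((T ^^ a) x) * ip I x ((T ^^ b) x) \<le> ip I x x * ip I x ((T ^^ (a + b)) x)"
  using log_convex_seq_mult_le[of "\<lambda>n. ip I x ((T ^^ n) x)" a b]
    psd_op_moment_nonneg[OF assms] psd_op_moment_log_convex[OF assms] by simp

section \<open>Rank one updates compared with scalar shifts\<close>

definition shift_op :: "'b operator \<Rightarrow> real \<Rightarrow> 'b operator" where
  "shift_op T c x = (\<lambda>j. T x j + c * x j)"

definition rank_one_update ::
  "'b set \<Rightarrow> 'b operator \<Rightarrow> ('b \<Rightarrow> real) \<Rightarrow> 'b operator" where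
  "rank_one_update I T x v = (\<lambda>j. T v j + ip I x v * x j)"

lemma psd_op_shift:
  assumes "psd_op I T" "0 \<le> c"
  shows "psd_op I (shift_op T c)"
  using psd_opD[OF assms(1)] assms(2) ip_nonneg[of I] unfolding psd_op_def
  by (simp add: shift_op_def ip_lin) (simp add: algebra_simps)

lemma psd_op_rank_one_update:
  assumes "psd_op I T"
  shows "psd_op I (rank_one_update I T x)"
proof -
  have "ip I v (\<lambda>j. ip I x w * x j) = ip I (\<lambda>j. ip I x v * x j) w" for v w
    by (simp add: ip_lin ip_commute[of I v x])
  moreover have "ip I v (\<lambda>j. ip I x v * x j) = (ip I x v)\<^sup>2" for v
    by (simp add: ip_lin ip_commute[of I v x] power2_eq_square)
  ultimately show ?thesis
    using psd_opD[OF assms] unfolding psd_op_def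
    by (simp add: rank_one_update_def ip_lin(1,2)) (simp add: ip_lin algebra_simps)
qed

lemma shift_op_shift_op: "shift_op (shift_op T a) b = shift_op T (a + b)"
  by (simp add: shift_op_def fun_eq_iff algebra_simps)

lemma shift_op_rank_one_update:
  "shift_op (rank_one_update I T x) c = rank_one_update I (shift_op T c) x"
  by (simp add: shift_op_def rank_one_update_def fun_eq_iff)

lemma shift_moment_Suc:
  assumes "psd_op I T"
  shows "ip I y ((T ^^ a) ((shift_op T \<beta> ^^ Suc b) x)) =
    ip I y ((T ^^ Suc a) ((shift_op T \<beta> ^^ b) x)) + \<beta> * ip I y ((T ^^ a) ((shift_op T \<beta> ^^ b) x))"
proof -
  have "(T ^^ a) ((shift_op T \<beta> ^^ Suc b) x) = (T ^^ a) (\<lambda>j. T ((shift_op T \<beta> ^^ b) x) j + \<beta> * (shift_op T \<beta> ^^ b) x j)"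
    by (simp add: shift_op_def)
  also have "\<dots> = (\<lambda>j. (T ^^ Suc a) ((shift_op T \<beta> ^^ b) x) j + \<beta> * (T ^^ a) ((shift_op T \<beta> ^^ b) x) j)"
    by (simp add: psd_op_pow_linear[OF assms] funpow_swap1)
  finally show ?thesis by (simp add: ip_lin)
qed

lemma shift_moment_ge:
  assumes T: "psd_op I T" and \<beta>: "0 \<le> \<beta>"
  shows "ip I x ((T ^^ (a + b)) x) \<le> ip I x ((T ^^ a) ((shift_op T \<beta> ^^ b) x))"
proof (induction b arbitrary: a)
  case (Suc b)
  have "0 \<le> ip I x ((T ^^ (a + b)) x)" by (rule psd_op_moment_nonneg[OF T])
  with Suc[of a] \<beta> have "0 \<le> \<beta> * ip I x ((T ^^ a) ((shift_op T \<beta> ^^ b) x))" by simp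
  with Suc[of "Suc a"] shift_moment_Suc[OF T, where y=x and x=x and a=a and b=b and \<beta>=\<beta>] show ?case by simp
qed simp

text \<open>For the spectral measure of T at x this is association: t^a and t^c (t + \<beta>)^b
  increase together on t \<ge> 0. The total mass |x|^2 is replaced by its bound \<beta>.\<close>

lemma moment_mult_shift_moment_le:
  assumes T: "psd_op I T" and \<beta>: "ip I x x \<le> \<beta>"
  shows "ip I x ((T ^^ a) x) * ip I x ((T ^^ c) ((shift_op T \<beta> ^^ b) x)) \<le>
    \<beta> * ip I x ((T ^^ (a + c)) ((shift_op T \<beta> ^^ b) x))"
proof (induction b arbitrary: c)
  case 0
  have "ip I x ((T ^^ a) x) * ip I x ((T ^^ c) x) \<le> ip I x x * ip I x ((T ^^ (a + c)) x)"
    by (rule psd_op_moment_mult_le[OF T])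
  also have "\<dots> \<le> \<beta> * ip I x ((T ^^ (a + c)) x)"
    using \<beta> psd_op_moment_nonneg[OF T] by (intro mult_right_mono) auto
  finally show ?case by simp
next
  case (Suc b)
  have \<beta>0: "0 \<le> \<beta>" using \<beta> ip_nonneg[of I x] by linarith
  show ?case
    using Suc[of "Suc c"] mult_left_mono[OF Suc[of c] \<beta>0]
    unfolding shift_moment_Suc[OF T] by (simp add: algebra_simps)
qed

text \<open>Expanding one factor T + x x^T yields a factor T and a product of two moments along x;
  association merges the product into a single moment at the price \<beta>. Seen from x, the update
  is therefore dominated by the shift.\<close>

lemma rank_one_moment_le:
  assumes T: "psd_op I T" and \<beta>: "ip I x x \<le> \<beta>"
  shows "ip I x ((T ^^ a) ((rank_one_update I T x ^^ b) x)) \<le>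
    ip I x ((T ^^ a) ((shift_op T \<beta> ^^ b) x))"
proof (induction b arbitrary: a)
  case (Suc b)
  let ?R = "rank_one_update I T x"
  have "(T ^^ a) ((?R ^^ Suc b) x) = (T ^^ a) (\<lambda>j. T ((?R ^^ b) x) j + ip I x ((?R ^^ b) x) * x j)"
    by (simp add: rank_one_update_def)
  also have "\<dots> = (\<lambda>j. (T ^^ Suc a) ((?R ^^ b) x) j + ip I x ((?R ^^ b) x) * (T ^^ a) x j)"
    by (simp add: psd_op_pow_linear[OF T] funpow_swap1)
  finally have "ip I x ((T ^^ a) ((?R ^^ Suc b) x)) =
      ip I x ((T ^^ Suc a) ((?R ^^ b) x)) + ip I x ((T ^^ a) x) * ip I x ((?R ^^ b) x)"
    by (simp add: ip_lin)
  also have "\<dots> \<le> ip I x ((T ^^ Suc a) ((shift_op T \<beta> ^^ b) x)) +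
      ip I x ((T ^^ a) x) * ip I x ((shift_op T \<beta> ^^ b) x)"
    using Suc[of "Suc a"] Suc[of 0] psd_op_moment_nonneg[OF T]
    by (intro add_mono mult_left_mono) auto
  also have "\<dots> \<le> ip I x ((T ^^ Suc a) ((shift_op T \<beta> ^^ b) x)) +
      \<beta> * ip I x ((T ^^ a) ((shift_op T \<beta> ^^ b) x))"
    using moment_mult_shift_moment_le[OF T \<beta>, of a 0 b] by simp
  finally show ?case by (simp only: shift_moment_Suc[OF T])
qed simp

section \<open>Traces of powers along a Parseval frame\<close>

text \<open>For a Parseval frame u this is the trace.\<close>

definition frame_trace ::
  "'b set \<Rightarrow> 'a set \<Rightarrow> ('a \<Rightarrow> 'b \<Rightarrow> real) \<Rightarrow> 'b operator \<Rightarrow> real" where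
  "frame_trace I S u Q = (\<Sum>k\<in>S. ip I (u k) (Q (u k)))"

definition parseval :: "'b set \<Rightarrow> 'a set \<Rightarrow> ('a \<Rightarrow> 'b \<Rightarrow> real) \<Rightarrow> bool" where
  "parseval I S u \<longleftrightarrow> (\<forall>x y. (\<Sum>k\<in>S. ip I (u k) x * ip I (u k) y) = ip I x y)"

text \<open>The factors T are exchanged for the updated operator one by one. The Parseval identity
  collapses the trace of the rank one term, so each exchange costs a single moment along x. After
  comparison with the shifted operator these moments are exactly the telescoping terms of the right
  side.\<close>

lemma frame_trace_rank_one_update_le:
  assumes T: "psd_op I T" and \<beta>: "ip I x x \<le> \<beta>" and u: "parseval I S u"
  shows "\<beta> * (frame_trace I S u (rank_one_update I T x ^^ p) - frame_trace I S u (T ^^ p)) \<le>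
    ip I x ((shift_op T \<beta> ^^ p) x) - ip I x ((T ^^ p) x)"
proof -
  let ?R = "rank_one_update I T x"
  have R: "psd_op I ?R" by (rule psd_op_rank_one_update[OF T])
  have \<beta>0: "0 \<le> \<beta>" using \<beta> ip_nonneg[of I x] by linarith
  have "\<beta> * (frame_trace I S u (\<lambda>v. (T ^^ a) ((?R ^^ b) v)) - frame_trace I S u (T ^^ (a + b))) \<le>
      ip I x ((T ^^ a) ((shift_op T \<beta> ^^ b) x)) - ip I x ((T ^^ (a + b)) x)" for a b
  proof (induction b arbitrary: a)
    case (Suc b)
    have "(T ^^ a) ((?R ^^ Suc b) v) = (T ^^ a) (\<lambda>j. T ((?R ^^ b) v) j + ip I x ((?R ^^ b) v) * x j)" for v
      by (simp add: rank_one_update_def)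
    then have "(T ^^ a) ((?R ^^ Suc b) v) =
        (\<lambda>j. (T ^^ Suc a) ((?R ^^ b) v) j + ip I x ((?R ^^ b) v) * (T ^^ a) x j)" for v
      by (simp add: psd_op_pow_linear[OF T] funpow_swap1)
    then have "frame_trace I S u (\<lambda>v. (T ^^ a) ((?R ^^ Suc b) v)) =
        frame_trace I S u (\<lambda>v. (T ^^ Suc a) ((?R ^^ b) v)) +
        (\<Sum>k\<in>S. ip I x ((?R ^^ b) (u k)) * ip I (u k) ((T ^^ a) x))"
      unfolding frame_trace_def by (simp only: ip_lin sum.distrib)
    also have "(\<Sum>k\<in>S. ip I x ((?R ^^ b) (u k)) * ip I (u k) ((T ^^ a) x)) =
        (\<Sum>k\<in>S. ip I (u k) ((?R ^^ b) x) * ip I (u k) ((T ^^ a) x))"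
      by (simp add: psd_op_pow_sym[OF R, of x] ip_commute[of I "(?R ^^ b) x"])
    also have "\<dots> = ip I ((?R ^^ b) x) ((T ^^ a) x)"
      using u by (simp add: parseval_def)
    also have "\<dots> = ip I x ((T ^^ a) ((?R ^^ b) x))"
      by (simp add: psd_op_pow_sym[OF T, of x] ip_commute)
    finally have eq: "frame_trace I S u (\<lambda>v. (T ^^ a) ((?R ^^ Suc b) v)) =
        frame_trace I S u (\<lambda>v. (T ^^ Suc a) ((?R ^^ b) v)) + ip I x ((T ^^ a) ((?R ^^ b) x))" .
    have "\<beta> * ip I x ((T ^^ a) ((?R ^^ b) x)) \<le> \<beta> * ip I x ((T ^^ a) ((shift_op T \<beta> ^^ b) x))"
      using \<beta>0 by (intro mult_left_mono rank_one_moment_le[OF T \<beta>])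
    with Suc[of "Suc a"] show ?case
      unfolding eq shift_moment_Suc[OF T] by (simp add: algebra_simps)
  qed (simp add: frame_trace_def)
  from this[of 0 p] show ?thesis by simp
qed

lemma moment_even_le_frame_trace:
  assumes T: "psd_op I T" and u: "parseval I S u"
  shows "ip I x ((T ^^ (q + q)) x) \<le> ip I x x * frame_trace I S u (T ^^ (q + q))"
proof -
  have "ip I x ((T ^^ (q + q)) x) = ip I ((T ^^ q) x) ((T ^^ q) x)"
    by (simp add: psd_op_moment_split[OF T])
  also have "\<dots> = (\<Sum>k\<in>S. (ip I (u k) ((T ^^ q) x))\<^sup>2)"
    using u by (simp add: parseval_def power2_eq_square)
  also have "\<dots> = (\<Sum>k\<in>S. (ip I ((T ^^ q) (u k)) x)\<^sup>2)"
    by (simp add: psd_op_pow_sym[OF T])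
  also have "\<dots> \<le> (\<Sum>k\<in>S. ip I ((T ^^ q) (u k)) ((T ^^ q) (u k)) * ip I x x)"
    by (intro sum_mono ip_cauchy_schwarz)
  also have "\<dots> = ip I x x * frame_trace I S u (T ^^ (q + q))"
    by (simp add: psd_op_moment_split[OF T] frame_trace_def sum_distrib_left mult.commute)
  finally show ?thesis .
qed

text \<open>A Rayleigh quotient above g persists for all consecutive moments, because the ratios of
  a log-convex sequence increase. The p-th moment is then at least g^p |x|^2, and for even p the
  trace controls it.\<close>

lemma power_le_frame_trace:
  assumes T: "psd_op I T" and u: "parseval I S u"
    and x: "g * ip I x x < ip I x (T x)" and g: "0 \<le> g" and p: "even p"
  shows "g ^ p \<le> frame_trace I S u (T ^^ p)"
proof -
  let ?t = "\<lambda>n. ip I x ((T ^^ n) x)"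
  \<comment> \<open>Null vectors of the semidefinite form have to be excluded separately:
    Cauchy-Schwarz makes the form of T vanish on them too.\<close>
  have t0: "0 < ip I x x"
  proof (rule ccontr)
    assume "\<not> ?thesis"
    then have z: "ip I x x = 0" using ip_nonneg[of I x] by simp
    have "(ip I x (T x))\<^sup>2 \<le> 0" using ip_cauchy_schwarz[of I x "T x"] z by simp
    with x z show False by simp
  qed
  have step: "g * ?t n \<le> ?t (Suc n)" for n
  proof -
    have "ip I x x * (g * ?t n) \<le> ip I x (T x) * ?t n"
      using x psd_op_moment_nonneg[OF T, of x n] mult_right_mono[of "g * ip I x x" "ip I x (T x)" "?t n"]
      by (simp add: mult_ac)
    also have "\<dots> \<le> ip I x x * ?t (Suc n)"
      using psd_op_moment_mult_le[OF T, of x 1 n] by simp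
    finally show ?thesis using t0 by (simp add: mult_le_cancel_left_pos)
  qed
  have "g ^ n * ip I x x \<le> ?t n" for n
  proof (induction n)
    case (Suc n)
    have "g ^ Suc n * ip I x x = g * (g ^ n * ip I x x)" by simp
    also have "\<dots> \<le> g * ?t n" using Suc g by (intro mult_left_mono)
    finally show ?case using step[of n] by linarith
  qed simp
  moreover obtain q where q: "p = q + q" using p by (auto elim!: evenE simp: mult_2)
  ultimately have "g ^ p * ip I x x \<le> ip I x x * frame_trace I S u (T ^^ p)"
    unfolding q using moment_even_le_frame_trace[OF T u] order_trans by blast
  then show ?thesis using t0 by (simp add: mult.commute[of _ "ip I x x"] mult_le_cancel_left_pos)
qed

section \<open>A matrix Chernoff bound for randomly permuted frames\<close>

definition frame_op ::
  "'b set \<Rightarrow> 'a set \<Rightarrow> ('a \<Rightarrow> real) \<Rightarrow> ('a \<Rightarrow> 'b \<Rightarrow> real) \<Rightarrow> 'b operator" where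
  "frame_op I J w u x = (\<lambda>j. \<Sum>i\<in>J. w i * ip I (u i) x * u i j)"

lemma ip_frame_op:
  "ip I y (frame_op I J w u x) = (\<Sum>i\<in>J. w i * ip I (u i) x * ip I (u i) y)"
  by (simp add: frame_op_def ip_sum ip_lin ip_commute[of I y])

lemma psd_op_frame_op:
  assumes "\<And>i. i \<in> J \<Longrightarrow> 0 \<le> w i"
  shows "psd_op I (frame_op I J w u)"
  unfolding psd_op_def
proof (intro conjI allI)
  fix x y :: "'b \<Rightarrow> real" and c :: real
  show "ip I x (frame_op I J w u y) = ip I (frame_op I J w u x) y"
    by (simp add: ip_frame_op ip_commute[of I "frame_op I J w u x"] mult_ac)
  show "0 \<le> ip I x (frame_op I J w u x)"
    unfolding ip_frame_op mult.assoc using assms by (intro sum_nonneg mult_nonneg_nonneg[OF _ zero_le_square]) auto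
  show "frame_op I J w u (\<lambda>j. x j + c * y j) = (\<lambda>j. frame_op I J w u x j + c * frame_op I J w u y j)"
    by (simp add: frame_op_def ip_lin fun_eq_iff sum.distrib sum_distrib_left algebra_simps)
qed

lemma frame_op_insert:
  assumes "finite J" "i \<notin> J" "0 \<le> w i"
  shows "frame_op I (insert i J) w u = rank_one_update I (frame_op I J w u) (\<lambda>j. sqrt (w i) * u i j)"
proof -
  have *: "sqrt (w i) * (sqrt (w i) * z) = w i * z" for z
    using assms(3) by (simp add: mult.assoc[symmetric])
  have "sqrt (w i) * ip I (u i) x * (sqrt (w i) * u i j) = w i * ip I (u i) x * u i j" for x j
    using *[of "ip I (u i) x * u i j"] by (simp only: mult_ac)
  then have eq: "sqrt (w i) * ip I (u i) x * (sqrt (w i) * u i j) = w i * ip I (u i) x * u i j" for x j .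
  show ?thesis
    by (intro ext) (simp only: frame_op_def rank_one_update_def ip_lin eq sum.insert[OF assms(1,2)] add.commute)
qed

text \<open>The base of the moment recursion: it trades the power of a scalar shift c for
  \<open>exp (s * c)\<close>, on which a further shift by \<beta> acts as a constant factor.\<close>

lemma power_le_fact_exp:
  assumes "0 \<le> (x::real)"
  shows "x ^ p \<le> fact p * exp x"
proof -
  have "(\<Sum>n\<in>{p}. inverse (fact n) * x ^ n) \<le> (\<Sum>n. inverse (fact n) * x ^ n)"
    using assms by (intro sum_le_suminf summable_exp) auto
  then have "x ^ p / fact p \<le> exp x" by (simp add: exp_def divide_inverse mult.commute)
  then show ?thesis by (simp add: field_simps)
qed

lemma avg_permutation_transpose:
  assumes "i \<in> S" "l \<in> S"
  shows "avg {\<tau>. \<tau> permutes S} (\<lambda>\<tau>. f (\<tau> \<circ> Transposition.transpose i l)) = avg {\<tau>. \<tau> permutes S} f"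
proof (rule avg_reindex)
  have t: "Transposition.transpose i l permutes S" using assms by (rule permutes_swap_id)
  show "bij_betw (\<lambda>\<tau>. \<tau> \<circ> Transposition.transpose i l) {\<tau>. \<tau> permutes S} {\<tau>. \<tau> permutes S}"
    by (rule bij_betwI[where g="\<lambda>\<tau>. \<tau> \<circ> Transposition.transpose i l"])
      (auto simp: o_assoc[symmetric] intro: permutes_compose[OF t] simp flip: o_assoc)
qed

text \<open>
  Moment method for a random permutation of a Parseval frame: as long as at most half of the
  frame is used, the next vector is, conditionally on the previous ones, at most twice as
  large on average as a uniform one.
\<close>

lemma avg_frame_trace_pow_le:
  fixes u :: "'a \<Rightarrow> 'b \<Rightarrow> real" and w :: "'a \<Rightarrow> real"
  assumes S: "finite S" "J \<subseteq> S" and half: "2 * card J \<le> card S + 1"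
    and u: "parseval I S u" and M: "(\<Sum>k\<in>S. ip I (u k) (u k)) = M"
    and w: "\<And>i. i \<in> S \<Longrightarrow> 0 \<le> w i" "\<And>i k. i \<in> S \<Longrightarrow> k \<in> S \<Longrightarrow> w i * ip I (u k) (u k) \<le> \<beta>"
    and \<beta>: "0 < \<beta>" "\<And>i. i \<in> S \<Longrightarrow> 2 * w i \<le> real (card S) * \<beta>"
    and s: "0 < s" and c: "0 \<le> c"
  shows "avg {\<tau>. \<tau> permutes S}
      (\<lambda>\<tau>. frame_trace I S u (shift_op (frame_op I J w (u \<circ> \<tau>)) c ^^ p)) \<le>
    M * fact p / s ^ p * exp (s * c + (exp (s * \<beta>) - 1) * (\<Sum>i\<in>J. 2 * w i / (real (card S) * \<beta>)))"
proof -
  have "finite J" using S finite_subset by blast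
  \<comment> \<open>The shift c varies in the induction, since each new vector also calls the
    hypothesis at c + \<beta>.\<close>
  from this S(2) half c show ?thesis
  proof (induction J arbitrary: c rule: finite_induct)
    case empty
    have T: "shift_op (frame_op I {} w (u \<circ> \<tau>)) c ^^ p = (\<lambda>v j. c ^ p * v j)" for \<tau> :: "'a \<Rightarrow> 'a"
    proof -
      have "(shift_op (frame_op I {} w (u \<circ> \<tau>)) c ^^ p) v = (\<lambda>j. c ^ p * v j)" for v
        by (induction p) (simp_all add: shift_op_def frame_op_def fun_eq_iff)
      then show ?thesis by blast
    qed
    have M0: "0 \<le> M" unfolding M[symmetric] by (intro sum_nonneg ip_nonneg)
    have ne: "finite {\<tau>. \<tau> permutes S}" "{\<tau>. \<tau> permutes S} \<noteq> {}"
      using finite_permutations[OF S(1)] permutes_id by blast+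
    have "(s * c) ^ p \<le> fact p * exp (s * c)"
      using s empty.prems by (intro power_le_fact_exp) auto
    then have "c ^ p \<le> fact p / s ^ p * exp (s * c)"
      using s by (simp add: field_simps power_mult_distrib)
    then have "c ^ p * M \<le> fact p / s ^ p * exp (s * c) * M"
      using M0 by (rule mult_right_mono)
    moreover have "frame_trace I S u (\<lambda>v j. c ^ p * v j) = c ^ p * M"
      unfolding frame_trace_def ip_lin M[symmetric] by (simp add: sum_distrib_left)
    ultimately show ?case unfolding T avg_const[OF ne] by (simp add: mult_ac)
  next
    case (insert i J)
    let ?n = "real (card S)"
    let ?P = "{\<tau>. \<tau> permutes S}"
    define T where "T \<tau> = frame_op I J w (u \<circ> \<tau>)" for \<tau>
    define Q where "Q \<tau> v = ip I v ((shift_op (T \<tau>) (c + \<beta>) ^^ p) v) - ip I v ((shift_op (T \<tau>) c ^^ p) v)" for \<tau> v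
    define D where "D c = avg ?P (\<lambda>\<tau>. frame_trace I S u (shift_op (T \<tau>) c ^^ p))" for c
    define B where "B c = M * fact p / s ^ p *
      exp (s * c + (exp (s * \<beta>) - 1) * (\<Sum>i\<in>J. 2 * w i / (?n * \<beta>)))" for c
    define \<theta> where "\<theta> = 2 * w i / (?n * \<beta>)"
    have i: "i \<in> S" "i \<notin> J" "J \<subseteq> S" "finite J" using insert by auto
    have n: "0 < ?n" using i S(1) by (auto simp: card_gt_0_iff)
    have cJ: "2 * card J + 1 \<le> card S" using insert.prems(2) i by simp
    have c: "0 \<le> c" by fact
    have Tpsd: "psd_op I (T \<tau>)" for \<tau>
      unfolding T_def using w(1) i by (intro psd_op_frame_op) auto
    have shift_psd: "psd_op I (shift_op (T \<tau>) c)" for \<tau>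
      using Tpsd c by (rule psd_op_shift)
    have Q0: "0 \<le> Q \<tau> v" for \<tau> v
      using shift_moment_ge[OF shift_psd, of \<beta> v 0 p \<tau>] \<beta>(1) by (simp add: Q_def shift_op_shift_op)
    have D_le_B: "D c' \<le> B c'" if "0 \<le> c'" for c'
      unfolding D_def T_def B_def using i cJ that by (intro insert.IH) auto
    have c\<beta>: "0 \<le> c + \<beta>" using c \<beta>(1) by simp
    have pointwise: "frame_trace I S u (shift_op (frame_op I (insert i J) w (u \<circ> \<tau>)) c ^^ p) \<le>
        frame_trace I S u (shift_op (T \<tau>) c ^^ p) + w i / \<beta> * Q \<tau> (u (\<tau> i))"
      if tau: "\<tau> \<in> ?P" for \<tau>
    proof -
      define x where "x = (\<lambda>j. sqrt (w i) * u (\<tau> i) j)"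
      have scale: "ip I x (\<lambda>j. (L ^^ p) x j) = w i * ip I (u (\<tau> i)) ((L ^^ p) (u (\<tau> i)))"
        if L: "psd_op I L" for L p
      proof -
        have "(L ^^ p) (\<lambda>j. 0 + sqrt (w i) * u (\<tau> i) j) =
            (\<lambda>j. (L ^^ p) (\<lambda>j. 0 + 0 * (u (\<tau> i) j)) j + sqrt (w i) * (L ^^ p) (u (\<tau> i)) j)"
          using psd_op_pow_linear[OF L, of p "\<lambda>_. 0" "sqrt (w i)" "u (\<tau> i)"] by simp
        moreover have "(L ^^ p) (\<lambda>j. 0 + 0 * (u (\<tau> i) j)) = (\<lambda>j. 0)"
          using psd_op_pow_linear[OF L, of p "\<lambda>_. 0" "-1" "\<lambda>_. 0"] by (simp add: fun_eq_iff)
        ultimately have "(L ^^ p) x = (\<lambda>j. sqrt (w i) * (L ^^ p) (u (\<tau> i)) j)"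
          by (simp add: x_def)
        then show ?thesis
          using w(1)[OF i(1)] by (simp add: x_def ip_lin mult.assoc[symmetric])
      qed
      have "\<tau> i \<in> S" using tau i(1) by (simp add: permutes_in_image)
      then have xb: "ip I x x \<le> \<beta>"
        using w(2)[OF i(1)] w(1)[OF i(1)] by (simp add: x_def ip_lin mult.assoc[symmetric])
      have "shift_op (frame_op I (insert i J) w (u \<circ> \<tau>)) c = rank_one_update I (shift_op (T \<tau>) c) x"
        using i w(1) by (simp add: frame_op_insert shift_op_rank_one_update T_def x_def)
      moreover have "\<beta> * (frame_trace I S u (rank_one_update I (shift_op (T \<tau>) c) x ^^ p) -
          frame_trace I S u (shift_op (T \<tau>) c ^^ p)) \<le> w i * Q \<tau> (u (\<tau> i))"
        using frame_trace_rank_one_update_le[OF shift_psd[of \<tau>] xb u, of p]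
          scale[OF shift_psd[of \<tau>], of p] scale[OF psd_op_shift[OF Tpsd[of \<tau>] c\<beta>], of p]
        by (simp add: Q_def shift_op_shift_op algebra_simps)
      ultimately show ?thesis using \<beta>(1) by (simp add: field_simps)
    qed
    let ?q = "\<lambda>l. avg ?P (\<lambda>\<tau>. Q \<tau> (u (\<tau> l)))"
    \<comment> \<open>\<open>Q \<tau>\<close> depends only on the values of \<tau> on J, so the new
      vector may equally sit at any position outside J. Extending the sum over positions to all of S
      adds nonnegative terms and turns it into a trace; dividing by |S - J| instead of |S| costs at
      most a factor 2.\<close>
    have next_vector: "?q i \<le> 2 / ?n * (D (c + \<beta>) - D c)"
    proof -
      have eq: "?q i = ?q l" if l: "l \<in> S - J" for l
      proof -
        have "frame_op I J w (u \<circ> (\<tau> \<circ> Transposition.transpose i l)) = frame_op I J w (u \<circ> \<tau>)" for \<tau>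
          using i(2) l by (auto simp: frame_op_def fun_eq_iff Transposition.transpose_def intro!: sum.cong)
        then have "Q (\<tau> \<circ> Transposition.transpose i l) v = Q \<tau> v" for \<tau> v by (simp add: Q_def T_def)
        with avg_permutation_transpose[OF i(1), of l "\<lambda>\<tau>. Q \<tau> (u (\<tau> i))"] l show ?thesis by simp
      qed
      have "real (card (S - J)) * ?q i = (\<Sum>l\<in>S - J. ?q i)"
        by simp
      also have "\<dots> = (\<Sum>l\<in>S - J. ?q l)"
        by (intro sum.cong eq) auto
      also have "\<dots> \<le> (\<Sum>l\<in>S. ?q l)"
        using S(1) Q0 by (intro sum_mono2 avg_nonneg) auto
      also have "\<dots> = avg ?P (\<lambda>\<tau>. \<Sum>l\<in>S. Q \<tau> (u (\<tau> l)))"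
        by (simp add: avg_sum)
      also have "\<dots> = avg ?P (\<lambda>\<tau>. \<Sum>k\<in>S. Q \<tau> (u k))"
        by (intro avg_cong sum.permute[symmetric, unfolded o_def]) auto
      also have "\<dots> = D (c + \<beta>) - D c"
        by (simp add: Q_def sum_subtractf D_def avg_diff frame_trace_def)
      finally have le: "real (card (S - J)) * ?q i \<le> D (c + \<beta>) - D c" .
      have "card (S - J) = card S - card J" using i by (intro card_Diff_subset)
      then have "?n / 2 \<le> real (card (S - J))" using cJ by linarith
      then have "?n / 2 * ?q i \<le> real (card (S - J)) * ?q i"
        using Q0 by (intro mult_right_mono avg_nonneg) auto
      with le have "?n / 2 * ?q i \<le> D (c + \<beta>) - D c" by linarith
      then show ?thesis using n by (simp add: field_simps)
    qed
    \<comment> \<open>With \<theta> \<le> 1 the recursion is a convex combination, so the induction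
      hypothesis can be inserted at both shifts.\<close>
    have \<theta>: "0 \<le> \<theta>" "\<theta> \<le> 1"
      unfolding \<theta>_def using w(1)[OF i(1)] \<beta>(1) \<beta>(2)[OF i(1)] n by (auto simp: divide_le_eq)
    have "avg ?P (\<lambda>\<tau>. frame_trace I S u (shift_op (frame_op I (insert i J) w (u \<circ> \<tau>)) c ^^ p)) \<le>
        avg ?P (\<lambda>\<tau>. frame_trace I S u (shift_op (T \<tau>) c ^^ p) + w i / \<beta> * Q \<tau> (u (\<tau> i)))"
      by (intro avg_mono pointwise)
    also have "\<dots> = D c + w i / \<beta> * avg ?P (\<lambda>\<tau>. Q \<tau> (u (\<tau> i)))"
      by (simp only: avg_add avg_cmult D_def)
    also have "\<dots> \<le> D c + w i / \<beta> * (2 / ?n * (D (c + \<beta>) - D c))"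
      using next_vector w(1)[OF i(1)] \<beta>(1) by (intro add_left_mono mult_left_mono) auto
    also have "\<dots> = (1 - \<theta>) * D c + \<theta> * D (c + \<beta>)"
    proof -
      have *: "w i / \<beta> * (2 / ?n * X) = \<theta> * X" for X by (simp add: \<theta>_def mult_ac)
      show ?thesis unfolding * by (simp add: left_diff_distrib right_diff_distrib)
    qed
    also have "\<dots> \<le> (1 - \<theta>) * B c + \<theta> * B (c + \<beta>)"
      using \<theta> c c\<beta> by (intro add_mono mult_left_mono D_le_B) auto
    also have "B (c + \<beta>) = B c * exp (s * \<beta>)"
      by (simp add: B_def exp_add[symmetric] algebra_simps)
    also have "(1 - \<theta>) * B c + \<theta> * (B c * exp (s * \<beta>)) = B c * (1 + (exp (s * \<beta>) - 1) * \<theta>)"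
      by (simp add: algebra_simps)
    also have "\<dots> \<le> B c * exp ((exp (s * \<beta>) - 1) * \<theta>)"
    proof (intro mult_left_mono exp_ge_add_one_self)
      have "0 \<le> M" unfolding M[symmetric] by (intro sum_nonneg ip_nonneg)
      then show "0 \<le> B c" using s by (simp add: B_def)
    qed
    also have "\<dots> = M * fact p / s ^ p *
        exp (s * c + (exp (s * \<beta>) - 1) * (\<Sum>i\<in>insert i J. 2 * w i / (?n * \<beta>)))"
      using i by (simp add: B_def \<theta>_def exp_add[symmetric] algebra_simps)
    finally show ?case .
  qed
qed

text \<open>The operator has expectation at most 1 / |S| times the identity, as the weights sum to
  at most 1. The level 4 / |S| leaves room for the factor 2 lost to sampling without replacement and
  for an exponential gain.\<close>

lemma avg_frame_op_large_le:
  fixes u :: "'a \<Rightarrow> 'b \<Rightarrow> real" and w :: "'a \<Rightarrow> real"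
  assumes S: "finite S" "J \<subseteq> S" and half: "2 * card J \<le> card S + 1"
    and u: "parseval I S u" and M: "(\<Sum>k\<in>S. ip I (u k) (u k)) = M"
    and w: "\<And>i. i \<in> S \<Longrightarrow> 0 \<le> w i" "\<And>i k. i \<in> S \<Longrightarrow> k \<in> S \<Longrightarrow> w i * ip I (u k) (u k) \<le> \<beta>"
    and w1: "(\<Sum>i\<in>J. w i) \<le> 1"
    and \<beta>: "0 < \<beta>" "\<And>i. i \<in> S \<Longrightarrow> 2 * w i \<le> real (card S) * \<beta>" and S0: "S \<noteq> {}"
  shows "avg {\<tau>. \<tau> permutes S}
      (\<lambda>\<tau>. of_bool (\<exists>x. 4 / real (card S) * ip I x x < (\<Sum>i\<in>J. w i * (ip I (u (\<tau> i)) x)\<^sup>2))) \<le>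
    8 * M * exp (- 1 / (5 * real (card S) * \<beta>))"
proof -
  let ?n = "real (card S)"
  let ?P = "{\<tau>. \<tau> permutes S}"
  define g where "g = 4 / ?n"
  \<comment> \<open>Then s \<beta> = 1/2, and each step of the recursion has the rate exp (1/2) - 1,
    about 0.65.\<close>
  define s where "s = 1 / (2 * \<beta>)"
  have n: "0 < ?n" using S S0 by (simp add: card_gt_0_iff)
  have s: "0 < s" using \<beta> by (simp add: s_def)
  have fP: "finite ?P" using finite_permutations[OF S(1)] .
  define bad where "bad \<tau> \<longleftrightarrow> (\<exists>x. g * ip I x x < (\<Sum>i\<in>J. w i * (ip I (u (\<tau> i)) x)\<^sup>2))" for \<tau>
  define pr where "pr = avg ?P (\<lambda>\<tau>. of_bool (bad \<tau>))"
  define W where "W = M * exp ((exp (1/2) - 1) * (2 / (?n * \<beta>)))"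
  have pr0: "0 \<le> pr" unfolding pr_def by (intro avg_nonneg) auto
  have M0: "0 \<le> M" unfolding M[symmetric] by (intro sum_nonneg ip_nonneg)
  have psd: "psd_op I (frame_op I J w (u \<circ> \<tau>))" for \<tau>
    using w(1) S by (intro psd_op_frame_op) auto
  have shift0: "shift_op T 0 = T" for T :: "'b operator"
    by (simp add: shift_op_def fun_eq_iff)
  have moment: "pr * g ^ p \<le> fact p / s ^ p * W" if p: "even p" for p
  proof -
    have "pr * g ^ p \<le> avg ?P (\<lambda>\<tau>. frame_trace I S u (frame_op I J w (u \<circ> \<tau>) ^^ p))"
      unfolding pr_def
    proof (rule avg_markov[OF fP])
      fix \<tau>
      show "0 \<le> frame_trace I S u (frame_op I J w (u \<circ> \<tau>) ^^ p)"
        unfolding frame_trace_def by (intro sum_nonneg psd_op_moment_nonneg[OF psd])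
      assume "bad \<tau>"
      then obtain x where "g * ip I x x < ip I x (frame_op I J w (u \<circ> \<tau>) x)"
        by (auto simp: bad_def ip_frame_op power2_eq_square mult_ac)
      then show "g ^ p \<le> frame_trace I S u (frame_op I J w (u \<circ> \<tau>) ^^ p)"
        using n p by (intro power_le_frame_trace[OF psd u]) (auto simp: g_def)
    qed
    also have "\<dots> \<le> M * fact p / s ^ p * exp (s * 0 + (exp (s * \<beta>) - 1) * (\<Sum>i\<in>J. 2 * w i / (?n * \<beta>)))"
      using avg_frame_trace_pow_le[OF S half u M w \<beta> s, where c=0 and p=p] by (simp add: shift0)
    also have "\<dots> \<le> M * fact p / s ^ p * exp ((exp (1/2) - 1) * (2 / (?n * \<beta>)))"
    proof -
      have "(\<Sum>i\<in>J. 2 * w i / (?n * \<beta>)) = 2 / (?n * \<beta>) * (\<Sum>i\<in>J. w i)"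
        by (simp add: sum_distrib_left)
      also have "\<dots> \<le> 2 / (?n * \<beta>)" using w1 n \<beta>(1) by (intro mult_left_le) auto
      finally have "(exp (1/2) - 1) * (\<Sum>i\<in>J. 2 * w i / (?n * \<beta>)) \<le> (exp (1/2) - 1) * (2 / (?n * \<beta>))"
        by (intro mult_left_mono) auto
      moreover have "s * \<beta> = 1 / 2" using \<beta>(1) by (simp add: s_def)
      ultimately have "exp (s * 0 + (exp (s * \<beta>) - 1) * (\<Sum>i\<in>J. 2 * w i / (?n * \<beta>))) \<le>
          exp ((exp (1/2) - 1) * (2 / (?n * \<beta>)))"
        by (simp only: mult_zero_right add_0_left exp_le_cancel_iff)
      then show ?thesis using M0 s by (intro mult_left_mono) auto
    qed
    finally show ?thesis by (simp add: W_def mult_ac)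
  qed
  \<comment> \<open>The p-th moment bound is weighted by (3/4)^p s^p / p!. The factorials cancel,
    the right sides are dominated by a geometric series with sum 4, and the left sides add up to
    \<open>cosh y\<close> because only even p are available.\<close>
  define y where "y = 3 / 4 * (s * g)"
  have "pr * cosh y \<le> W * (1 / (1 - 3 / 4))"
  proof (rule sums_le)
    show "(\<lambda>n. pr * (if even n then y ^ n /\<^sub>R fact n else 0)) sums (pr * cosh y)"
      by (intro sums_mult cosh_converges)
    show "(\<lambda>n. W * (3 / 4) ^ n) sums (W * (1 / (1 - 3 / 4)))"
      by (intro sums_mult geometric_sums) auto
    show "pr * (if even p then y ^ p /\<^sub>R fact p else 0) \<le> W * (3 / 4) ^ p" for p
    proof (cases "even p")
      case True
      have "pr * (y ^ p / fact p) = (3 / 4) ^ p * s ^ p / fact p * (pr * g ^ p)"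
      proof -
        have "y ^ p = (3 / 4) ^ p * (s ^ p * g ^ p)" by (simp only: y_def power_mult_distrib)
        then show ?thesis by (simp only: times_divide_eq_left times_divide_eq_right mult_ac)
      qed
      also have "\<dots> \<le> (3 / 4) ^ p * s ^ p / fact p * (fact p / s ^ p * W)"
        using s by (intro mult_left_mono moment[OF True]) auto
      also have "\<dots> = W * (3 / 4) ^ p" using s by simp
      moreover have "y ^ p /\<^sub>R fact p = y ^ p / fact p" by (simp only: real_scaleR_def divide_inverse mult.commute)
      ultimately show ?thesis using True by (simp only: if_True)
    qed (use M0 in \<open>simp add: W_def\<close>)
  qed
  moreover have "pr * (exp y / 2) \<le> pr * cosh y"
    by (intro mult_left_mono pr0) (simp add: cosh_def)
  ultimately have "pr * (exp y / 2) \<le> 4 * W" by simp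
  then have "pr * exp y * exp (- y) \<le> 8 * W * exp (- y)" by (intro mult_right_mono) auto
  moreover have "exp y * exp (- y) = 1" by (rule exp_minus_inverse)
  ultimately have "pr \<le> 8 * W * exp (- y)" by (simp only: mult.assoc mult_1_right)
  also have "\<dots> = 8 * M * exp ((exp (1/2) - 1) * (2 / (?n * \<beta>)) - y)"
    by (simp only: W_def mult.assoc exp_add[symmetric] diff_conv_add_uminus)
  also have "\<dots> \<le> 8 * M * exp (- 1 / (5 * ?n * \<beta>))"
  proof -
    define z where "z = 1 / (?n * \<beta>)"
    have z: "0 \<le> z" using n \<beta>(1) by (simp add: z_def)
    \<comment> \<open>The square of 33/20 is 2.7225, just above e. The exponent becomes 13/10 z -
      3/2 z = - z / 5.\<close>
    have "exp (1 / 2 :: real) \<le> 33 / 20"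
    proof (rule power2_le_imp_le)
      have "exp (1 / 2 :: real) ^ 2 = exp 1" by (simp flip: exp_of_nat_mult)
      then show "(exp (1 / 2 :: real))\<^sup>2 \<le> (33 / 20)\<^sup>2" using e_less_272 by (simp add: power2_eq_square)
    qed simp
    then have "(exp (1/2) - 1) * (2 * z) \<le> 13 / 20 * (2 * z)"
      using z by (intro mult_right_mono) auto
    moreover have e: "2 / (?n * \<beta>) = 2 * z" "y = 3 / 2 * z" "- 1 / (5 * ?n * \<beta>) = - z / 5"
      using \<beta>(1) n by (simp_all add: z_def y_def s_def g_def)
    ultimately have "(exp (1/2) - 1) * (2 / (?n * \<beta>)) - y \<le> - 1 / (5 * ?n * \<beta>)"
      unfolding e by linarith
    then show ?thesis using M0 by (intro mult_left_mono) auto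
  qed
  finally show ?thesis by (simp add: pr_def bad_def g_def)
qed

section \<open>Sudakov minoration\<close>

abbreviation std_normal :: "real measure" where
  "std_normal \<equiv> density lborel std_normal_density"

lemma prob_space_std_normal: "prob_space std_normal"
  using prob_space_normal_density[of 1 0] by simp

text \<open>The Cameron-Martin formula in dimension one; completing the square gives the density of
  the translate.\<close>

lemma nn_integral_std_normal_shift:
  assumes [measurable]: "F \<in> borel_measurable borel"
  shows "(\<integral>\<^sup>+x. F (x + s) \<partial>std_normal) = (\<integral>\<^sup>+x. F x * ennreal (exp (s * x - s\<^sup>2 / 2)) \<partial>std_normal)"
proof -
  have dens: "std_normal_density (x + s) * exp (s * (x + s) - s\<^sup>2 / 2) = std_normal_density x" for x
  proof -
    have "- (x + s)\<^sup>2 / 2 + (s * (x + s) - s\<^sup>2 / 2) = - x\<^sup>2 / 2"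
      by (simp add: power2_eq_square field_simps)
    then show ?thesis by (simp add: std_normal_density_def flip: exp_add)
  qed
  have "(\<integral>\<^sup>+x. F x * ennreal (exp (s * x - s\<^sup>2 / 2)) \<partial>std_normal) =
      (\<integral>\<^sup>+x. ennreal (std_normal_density x) * (F x * ennreal (exp (s * x - s\<^sup>2 / 2))) \<partial>lborel)"
    by (intro nn_integral_density) auto
  also have "\<dots> = ennreal \<bar>1\<bar> * (\<integral>\<^sup>+x. ennreal (std_normal_density (s + 1 * x)) *
      (F (s + 1 * x) * ennreal (exp (s * (s + 1 * x) - s\<^sup>2 / 2))) \<partial>lborel)"
    by (rule nn_integral_real_affine) auto
  also have "\<dots> = (\<integral>\<^sup>+x. ennreal (std_normal_density x) * F (x + s) \<partial>lborel)"
  proof -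
    have "ennreal (std_normal_density (s + 1 * x)) *
        (F (s + 1 * x) * ennreal (exp (s * (s + 1 * x) - s\<^sup>2 / 2))) =
        ennreal (std_normal_density (x + s) * exp (s * (x + s) - s\<^sup>2 / 2)) * F (x + s)" for x
      by (simp add: ennreal_mult'' mult_ac add.commute)
    then show ?thesis by (simp add: dens)
  qed
  also have "\<dots> = (\<integral>\<^sup>+x. F (x + s) \<partial>std_normal)"
    by (intro nn_integral_density[symmetric]) auto
  finally show ?thesis ..
qed

interpretation std_normal: product_sigma_finite "\<lambda>_::nat. std_normal"
  using prob_space_std_normal by (auto intro!: product_sigma_finite.intro prob_space_imp_sigma_finite)

text \<open>The formula for products, one coordinate at a time. The translated point is restricted
  to I because points of the product space are extensional functions.\<close>

lemma nn_integral_PiM_std_normal_shift: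
  fixes s :: "nat \<Rightarrow> real"
  assumes "finite I" "F \<in> borel_measurable (PiM I (\<lambda>_. std_normal))"
  shows "(\<integral>\<^sup>+g. F (\<lambda>i\<in>I. g i + s i) \<partial>PiM I (\<lambda>_. std_normal)) =
    (\<integral>\<^sup>+g. F g * ennreal (exp (\<Sum>i\<in>I. s i * g i - (s i)\<^sup>2 / 2)) \<partial>PiM I (\<lambda>_. std_normal))"
  using assms
proof (induction I arbitrary: F rule: finite_induct)
  case empty
  then show ?case by (simp add: PiM_empty nn_integral_count_space_finite restrict_def)
next
  case (insert i I)
  note [measurable] = insert.prems
  let ?P = "PiM I (\<lambda>_::nat. std_normal)"
  have shift_meas: "(\<lambda>g. \<lambda>j\<in>insert i I. g j + s j) \<in>
      PiM (insert i I) (\<lambda>_. std_normal) \<rightarrow>\<^sub>M PiM (insert i I) (\<lambda>_. std_normal)"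
    by measurable
  have "(\<integral>\<^sup>+g. F (\<lambda>j\<in>insert i I. g j + s j) \<partial>PiM (insert i I) (\<lambda>_. std_normal)) =
      (\<integral>\<^sup>+y. (\<integral>\<^sup>+g. F (\<lambda>j\<in>insert i I. (g(i := y)) j + s j) \<partial>?P) \<partial>std_normal)"
    using insert.hyps measurable_compose[OF shift_meas insert.prems]
    by (subst std_normal.product_nn_integral_insert_rev) auto
  also have "\<dots> = (\<integral>\<^sup>+y. (\<integral>\<^sup>+g. F ((\<lambda>j\<in>I. g j + s j)(i := y + s i)) \<partial>?P) \<partial>std_normal)"
  proof -
    have "(\<lambda>j\<in>insert i I. (g(i := y)) j + s j) = (\<lambda>j\<in>I. g j + s j)(i := y + s i)" for g :: "nat \<Rightarrow> real" and y
      using insert.hyps by (auto simp: fun_eq_iff)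
    then show ?thesis by simp
  qed
  also have "\<dots> = (\<integral>\<^sup>+y. (\<integral>\<^sup>+g. F (g(i := y + s i)) *
      ennreal (exp (\<Sum>j\<in>I. s j * g j - (s j)\<^sup>2 / 2)) \<partial>?P) \<partial>std_normal)"
  proof -
    have "(\<lambda>g. F (g(i := y))) \<in> borel_measurable ?P" for y by measurable
    from insert.IH[OF this] show ?thesis by (simp only:)
  qed
  also have "\<dots> = (\<integral>\<^sup>+y. (\<integral>\<^sup>+g. F (g(i := y)) *
      ennreal (exp (\<Sum>j\<in>I. s j * g j - (s j)\<^sup>2 / 2)) \<partial>?P) * ennreal (exp (s i * y - (s i)\<^sup>2 / 2)) \<partial>std_normal)"
  proof (rule nn_integral_std_normal_shift)
    interpret sigma_finite_measure ?P by (rule std_normal.sigma_finite) fact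
    have "(\<lambda>(y, g). F (g(i := y)) * ennreal (exp (\<Sum>j\<in>I. s j * g j - (s j)\<^sup>2 / 2))) \<in>
        borel_measurable (borel \<Otimes>\<^sub>M ?P)"
      by measurable
    then show "(\<lambda>y. \<integral>\<^sup>+g. F (g(i := y)) * ennreal (exp (\<Sum>j\<in>I. s j * g j - (s j)\<^sup>2 / 2)) \<partial>?P) \<in>
        borel_measurable borel"
      by (rule borel_measurable_nn_integral)
  qed
  also have "\<dots> = (\<integral>\<^sup>+y. (\<integral>\<^sup>+g. F (g(i := y)) *
      ennreal (exp (\<Sum>j\<in>insert i I. s j * (g(i := y)) j - (s j)\<^sup>2 / 2)) \<partial>?P) \<partial>std_normal)"
  proof (rule nn_integral_cong)
    fix y :: real
    have sum: "(\<Sum>j\<in>insert i I. s j * (g(i := y)) j - (s j)\<^sup>2 / 2) =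
        (s i * y - (s i)\<^sup>2 / 2) + (\<Sum>j\<in>I. s j * g j - (s j)\<^sup>2 / 2)" for g :: "nat \<Rightarrow> real"
      using insert.hyps by (auto intro!: sum.cong)
    show "(\<integral>\<^sup>+g. F (g(i := y)) * ennreal (exp (\<Sum>j\<in>I. s j * g j - (s j)\<^sup>2 / 2)) \<partial>?P) *
        ennreal (exp (s i * y - (s i)\<^sup>2 / 2)) =
        (\<integral>\<^sup>+g. F (g(i := y)) * ennreal (exp (\<Sum>j\<in>insert i I. s j * (g(i := y)) j - (s j)\<^sup>2 / 2)) \<partial>?P)"
      unfolding sum exp_add by (subst nn_integral_multc[symmetric]) (auto simp: ennreal_mult'' mult_ac)
  qed
  also have "\<dots> = (\<integral>\<^sup>+g. F g * ennreal (exp (\<Sum>j\<in>insert i I. s j * g j - (s j)\<^sup>2 / 2))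
      \<partial>PiM (insert i I) (\<lambda>_. std_normal))"
    using insert.hyps by (subst std_normal.product_nn_integral_insert_rev) auto
  finally show ?case .
qed

lemma sets_std_gaussian [measurable_cong]: "sets (std_gaussian d) = sets (PiM {..<d} (\<lambda>_. borel))"
  unfolding std_gaussian_def by (intro sets_PiM_cong) auto

lemma space_std_gaussian: "space (std_gaussian d) = {..<d} \<rightarrow>\<^sub>E UNIV"
  by (simp add: std_gaussian_def space_PiM)

lemma prob_space_std_gaussian: "prob_space (std_gaussian d)"
  unfolding std_gaussian_def by (intro prob_space_PiM prob_space_std_normal)

lemma measurable_ip_std_gaussian [measurable]: "(\<lambda>g. ip {..<d} g x) \<in> borel_measurable (std_gaussian d)"
  unfolding ip_def by measurable

lemma ip_diff: "ip I x (\<lambda>i. y i - z i) = ip I x y - ip I x z" "ip I (\<lambda>i. y i - z i) x = ip I y x - ip I z x"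
  by (simp_all add: ip_def algebra_simps sum_subtractf)

text \<open>
  Translating the Gaussian measure by a multiple of each point of a separated set moves most of
  the mass into the Voronoi cell of that point; the density of the translate is controlled, and
  the cells are disjoint.
\<close>

lemma local_packing_bound:
  fixes Y :: "(nat \<Rightarrow> real) set"
  assumes E: "E \<in> sets (std_gaussian d)" "3 / 4 \<le> measure (std_gaussian d) E"
    and W: "0 < W" "\<And>g y. g \<in> E \<Longrightarrow> y \<in> insert ctr Y \<Longrightarrow> \<bar>ip {..<d} g y\<bar> < 4 * W"
    and Y: "finite Y" "\<And>y y'. y \<in> Y \<Longrightarrow> y' \<in> Y \<Longrightarrow> y \<noteq> y' \<Longrightarrow> \<delta>\<^sup>2 \<le> ip {..<d} (\<lambda>i. y i - y' i) (\<lambda>i. y i - y' i)"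
    and R: "\<And>y. y \<in> Y \<Longrightarrow> ip {..<d} (\<lambda>i. y i - ctr i) (\<lambda>i. y i - ctr i) \<le> R\<^sup>2"
    and \<delta>: "0 < \<delta>"
  shows "real (card Y) * (3 / 4 * exp (- (128 * W\<^sup>2 / \<delta>\<^sup>2 + 128 * W\<^sup>2 * R\<^sup>2 / \<delta> ^ 4))) \<le> 1"
proof -
  let ?G = "std_gaussian d"
  let ?ip = "ip {..<d}"
  interpret prob_space ?G by (rule prob_space_std_gaussian)
  \<comment> \<open>The translates are by \<theta> (y - ctr). Separation contributes at least
    \<theta> \<delta>^2 = 16 W to the comparison of two cells, while on E the Gaussian terms
    contribute less than 2 * 8 W.\<close>
  define \<theta> where "\<theta> = 16 * W / \<delta>\<^sup>2"
  have \<theta>: "0 < \<theta>" "\<theta> * \<delta>\<^sup>2 = 16 * W" using W \<delta> by (simp_all add: \<theta>_def)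
  define nrm where "nrm y = ?ip (\<lambda>i. y i - ctr i) (\<lambda>i. y i - ctr i)" for y
  \<comment> \<open>The inequality says that h is nearer to \<theta> (y - ctr) than to \<theta> (y'
    - ctr), once the square of h is cancelled.\<close>
  define A where "A y = {h \<in> space ?G. \<forall>y'\<in>Y - {y}. \<theta> * (nrm y - nrm y') / 2 < ?ip h (\<lambda>i. y i - y' i)}" for y
  \<comment> \<open>K is \<theta> * 8 W + \<theta>^2 R^2 / 2, the largest exponent of the translated
    density that occurs on E.\<close>
  define K where "K = 128 * W\<^sup>2 / \<delta>\<^sup>2 + 128 * W\<^sup>2 * R\<^sup>2 / \<delta> ^ 4"
  have A_sets [measurable]: "A y \<in> sets ?G" for y
    unfolding A_def
  proof (rule sets.sets_Collect_finite_All)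
    fix y'
    show "{h \<in> space ?G. \<theta> * (nrm y - nrm y') / 2 < ?ip h (\<lambda>i. y i - y' i)} \<in> sets ?G"
      by measurable
  qed (use Y(1) in simp)
  have disj: "disjoint_family_on A Y"
    unfolding disjoint_family_on_def
  proof (intro ballI impI equals0I)
    fix y y' h assume yy: "y \<in> Y" "y' \<in> Y" "y \<noteq> y'" "h \<in> A y \<inter> A y'"
    then have "\<theta> * (nrm y - nrm y') / 2 < ?ip h (\<lambda>i. y i - y' i)"
      "\<theta> * (nrm y' - nrm y) / 2 < ?ip h (\<lambda>i. y' i - y i)"
      by (auto simp: A_def)
    then show False unfolding ip_diff by argo
  qed
  have cell: "3 / 4 * exp (- K) \<le> measure ?G (A y)" if y: "y \<in> Y" for y
  proof -
    define s where "s i = \<theta> * (y i - ctr i)" for i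
    \<comment> \<open>The inverse density is built into F, so that the translation formula leaves
      exactly the probability of the cell.\<close>
    define F where "F h = indicator (A y) h * ennreal (exp (- (\<Sum>i<d. s i * h i - (s i)\<^sup>2 / 2)))" for h
    have F_meas: "F \<in> borel_measurable ?G"
      unfolding F_def std_gaussian_def[symmetric] by measurable
    have quad: "(\<Sum>i<d. (s i)\<^sup>2) = \<theta>\<^sup>2 * nrm y"
      by (simp add: s_def nrm_def ip_def power2_eq_square sum_distrib_left mult_ac)
    have lower: "ennreal (exp (- K)) * indicator E g \<le> F (\<lambda>i\<in>{..<d}. g i + s i)" for g
    proof (cases "g \<in> E")
      case True
      let ?h = "\<lambda>i\<in>{..<d}. g i + s i"
      have ip_h: "?ip ?h v = ?ip g v + ?ip s v" for v
        by (simp add: ip_def algebra_simps sum.distrib)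
      have "?h \<in> A y"
        unfolding A_def
      proof (intro CollectI conjI ballI)
        show "?h \<in> space ?G" by (simp add: space_std_gaussian)
        fix y' assume y': "y' \<in> Y - {y}"
        define N where "N = ?ip (\<lambda>i. y i - y' i) (\<lambda>i. y i - y' i)"
        have "?ip s (\<lambda>i. y i - y' i) = \<theta> * ((nrm y + N - nrm y') / 2)"
          by (simp add: s_def nrm_def N_def ip_def sum_distrib_left sum.distrib[symmetric]
              sum_subtractf[symmetric] sum_divide_distrib)
            (intro sum.cong refl, simp add: field_simps)
        then have "2 * (?ip s y - ?ip s y') = \<theta> * nrm y + \<theta> * N - \<theta> * nrm y'"
          by (simp add: ip_diff algebra_simps)
        moreover have "?ip g y' - ?ip g y < 8 * W"
          using W(2)[OF True, of y] W(2)[OF True, of y'] y y' by auto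
        moreover have "16 * W \<le> \<theta> * N"
          using Y(2)[of y y'] y y' \<theta> unfolding N_def \<theta>(2)[symmetric] by (intro mult_left_mono) auto
        moreover have "?ip ?h (\<lambda>i. y i - y' i) = (?ip g y - ?ip g y') + (?ip s y - ?ip s y')"
          by (simp add: ip_h ip_diff)
        moreover have "\<theta> * (nrm y - nrm y') / 2 = (\<theta> * nrm y - \<theta> * nrm y') / 2"
          by (simp add: right_diff_distrib)
        ultimately show "\<theta> * (nrm y - nrm y') / 2 < ?ip ?h (\<lambda>i. y i - y' i)"
          by argo
      qed
      moreover have "(\<Sum>i<d. s i * ?h i - (s i)\<^sup>2 / 2) \<le> K"
      proof -
        have "(\<Sum>i<d. s i * ?h i - (s i)\<^sup>2 / 2) = (\<Sum>i<d. s i * g i) + (\<Sum>i<d. (s i)\<^sup>2) / 2"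
          by (simp add: sum_divide_distrib sum.distrib[symmetric])
            (intro sum.cong refl, simp add: power2_eq_square field_simps)
        also have "(\<Sum>i<d. s i * g i) = \<theta> * (?ip g y - ?ip g ctr)"
          by (simp add: s_def ip_def sum_subtractf[symmetric] sum_distrib_left algebra_simps)
        also have "\<theta> * (?ip g y - ?ip g ctr) + (\<Sum>i<d. (s i)\<^sup>2) / 2 \<le> \<theta> * (8 * W) + \<theta>\<^sup>2 * R\<^sup>2 / 2"
        proof (intro add_mono)
          show "\<theta> * (?ip g y - ?ip g ctr) \<le> \<theta> * (8 * W)"
            using W(2)[OF True, of y] W(2)[OF True, of ctr] y \<theta> by (intro mult_left_mono) auto
          show "(\<Sum>i<d. (s i)\<^sup>2) / 2 \<le> \<theta>\<^sup>2 * R\<^sup>2 / 2"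
            unfolding quad using R[OF y] by (simp add: nrm_def mult_left_mono)
        qed
        also have "\<dots> = K" using \<delta> by (simp add: K_def \<theta>_def field_simps eval_nat_numeral)
        finally show ?thesis .
      qed
      ultimately show ?thesis using True by (simp add: F_def)
    qed simp
    have "ennreal (exp (- K)) * emeasure ?G E = (\<integral>\<^sup>+g. ennreal (exp (- K)) * indicator E g \<partial>?G)"
      using E(1) by (simp add: nn_integral_cmult)
    also have "\<dots> \<le> (\<integral>\<^sup>+g. F (\<lambda>i\<in>{..<d}. g i + s i) \<partial>?G)"
      by (intro nn_integral_mono lower)
    also have "\<dots> = (\<integral>\<^sup>+g. F g * ennreal (exp (\<Sum>i<d. s i * g i - (s i)\<^sup>2 / 2)) \<partial>?G)"
      using F_meas unfolding std_gaussian_def by (intro nn_integral_PiM_std_normal_shift) auto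
    also have "\<dots> = (\<integral>\<^sup>+g. indicator (A y) g \<partial>?G)"
    proof -
      have "ennreal (exp (- z)) * ennreal (exp z) = 1" for z :: real
        by (simp add: ennreal_mult''[symmetric] flip: exp_add)
      then show ?thesis unfolding F_def mult.assoc by simp
    qed
    also have "\<dots> = emeasure ?G (A y)" by simp
    finally have "ennreal (exp (- K) * measure ?G E) \<le> ennreal (measure ?G (A y))"
      by (simp add: emeasure_eq_measure ennreal_mult'')
    then have "exp (- K) * measure ?G E \<le> measure ?G (A y)" by (simp add: ennreal_le_iff)
    moreover have "exp (- K) * (3 / 4) \<le> exp (- K) * measure ?G E"
      using E(2) by (intro mult_left_mono) auto
    ultimately show ?thesis by linarith
  qed
  have "real (card Y) * (3 / 4 * exp (- K)) = (\<Sum>y\<in>Y. 3 / 4 * exp (- K))" by simp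
  also have "\<dots> \<le> (\<Sum>y\<in>Y. measure ?G (A y))" by (intro sum_mono cell)
  also have "\<dots> = measure ?G (\<Union>y\<in>Y. A y)"
    using Y(1) disj by (intro finite_measure_finite_Union[symmetric]) auto
  also have "\<dots> \<le> 1" by (rule prob_le_1)
  finally show ?thesis by (simp add: K_def)
qed

section \<open>Measurability and integrability of the Gaussian supremum\<close>

lemma countable_dense_subset:
  fixes S :: "'a::second_countable_topology set"
  obtains T where "countable T" "T \<subseteq> S" "S \<subseteq> closure T"
proof -
  obtain B :: "'a set set" where B: "countable B" "topological_basis B"
    using ex_countable_basis by blast
  define f where "f b = (SOME x. x \<in> b \<inter> S)" for b
  have f: "f b \<in> b \<inter> S" if "b \<inter> S \<noteq> {}" for b
    unfolding f_def using that by (metis ex_in_conv someI_ex)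
  define T where "T = f ` {b \<in> B. b \<inter> S \<noteq> {}}"
  have "countable T" using B(1) by (simp add: T_def)
  moreover have "T \<subseteq> S" using f by (auto simp: T_def)
  moreover have "x \<in> closure T" if x: "x \<in> S" for x
    unfolding closure_iff_nhds_not_empty
  proof (intro allI impI)
    fix A V assume V: "V \<subseteq> A" "open V" "x \<in> V"
    obtain b where b: "b \<in> B" "x \<in> b" "b \<subseteq> V"
      using topological_basisE[OF B(2) V(2,3)] by blast
    then have "f b \<in> T" "f b \<in> b" using x f[of b] by (auto simp: T_def)
    then show "T \<inter> A \<noteq> {}" using b V by blast
  qed
  ultimately show ?thesis using that by blast
qed

lemma abs_ip_le_sum_abs:
  assumes "\<And>i. i \<in> I \<Longrightarrow> \<bar>z i\<bar> \<le> 1"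
  shows "\<bar>ip I g z\<bar> \<le> (\<Sum>i\<in>I. \<bar>g i\<bar>)"
proof -
  have "\<bar>ip I g z\<bar> \<le> (\<Sum>i\<in>I. \<bar>g i * z i\<bar>)" unfolding ip_def by (rule sum_abs)
  also have "\<dots> \<le> (\<Sum>i\<in>I. \<bar>g i\<bar> * 1)"
    unfolding abs_mult using assms by (intro sum_mono mult_left_mono) auto
  finally show ?thesis by simp
qed

lemma bdd_above_ip:
  assumes "\<And>z i. z \<in> Z \<Longrightarrow> i \<in> I \<Longrightarrow> \<bar>z i\<bar> \<le> 1"
  shows "bdd_above ((\<lambda>z. ip I g z) ` Z)"
  using abs_ip_le_sum_abs[of I _ g] assms
  by (intro bdd_aboveI2[where M="\<Sum>i\<in>I. \<bar>g i\<bar>"]) (meson abs_le_D1)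

text \<open>Linear forms in finitely many coordinates are continuous for the product topology, so a
  countable dense subset has the same supremum. Integrability rests on this, and without it the
  integral in the width would be 0 by convention.\<close>

lemma measurable_SUP_ip:
  fixes Z :: "(nat \<Rightarrow> real) set"
  assumes Z: "Z \<noteq> {}" "\<And>z i. z \<in> Z \<Longrightarrow> i < d \<Longrightarrow> \<bar>z i\<bar> \<le> 1"
  shows "(\<lambda>g. SUP z\<in>Z. ip {..<d} g z) \<in> borel_measurable (std_gaussian d)"
proof -
  obtain T where T: "countable T" "T \<subseteq> Z" "Z \<subseteq> closure T" by (rule countable_dense_subset)
  then have T0: "T \<noteq> {}" using Z(1) by auto
  have bdd: "bdd_above ((\<lambda>z. ip {..<d} g z) ` Z)" for g using Z(2) by (intro bdd_above_ip) auto
  have bddT: "bdd_above ((\<lambda>z. ip {..<d} g z) ` T)" for g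
    using bdd T(2) by (meson bdd_above_mono image_mono)
  have "(SUP z\<in>Z. ip {..<d} g z) = (SUP z\<in>T. ip {..<d} g z)" for g
  proof (rule antisym)
    have "closed {z. ip {..<d} g z \<le> (SUP z\<in>T. ip {..<d} g z)}"
      unfolding ip_def
      by (intro closed_Collect_le continuous_intros continuous_on_product_then_coordinatewise[OF continuous_on_id])
    moreover have "T \<subseteq> {z. ip {..<d} g z \<le> (SUP z\<in>T. ip {..<d} g z)}"
      using bddT by (auto intro: cSUP_upper)
    ultimately have "closure T \<subseteq> {z. ip {..<d} g z \<le> (SUP z\<in>T. ip {..<d} g z)}"
      by (rule closure_minimal[rotated])
    then show "(SUP z\<in>Z. ip {..<d} g z) \<le> (SUP z\<in>T. ip {..<d} g z)"
      using T(3) Z(1) by (intro cSUP_least) auto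
    show "(SUP z\<in>T. ip {..<d} g z) \<le> (SUP z\<in>Z. ip {..<d} g z)"
      using T(2) T0 bdd by (intro cSUP_subset_mono) auto
  qed
  moreover have "(\<lambda>g. SUP z\<in>T. ip {..<d} g z) \<in> borel_measurable (std_gaussian d)"
    using T(1) bddT by (intro borel_measurable_cSUP) auto
  ultimately show ?thesis by simp
qed

lemma integrable_std_gaussian_component:
  assumes "i < d"
  shows "integrable (std_gaussian d) (\<lambda>g. g i)"
proof -
  have "integrable std_normal (\<lambda>x. x)"
    using integrable_std_normal_distribution_moment[of 1] by simp
  then have "integrable (distr (std_gaussian d) std_normal (\<lambda>g. g i)) (\<lambda>x. x)"
    using assms unfolding std_gaussian_def
    by (subst distr_PiM_component) (auto intro: prob_space_std_normal)
  then show ?thesis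
    using assms by (subst (asm) integrable_distr_eq) (auto simp: std_gaussian_def)
qed

section \<open>Packing bounds and nets from the Gaussian width\<close>

abbreviation sqdist :: "nat \<Rightarrow> (nat \<Rightarrow> real) \<Rightarrow> (nat \<Rightarrow> real) \<Rightarrow> real" where
  "sqdist d y z \<equiv> ip {..<d} (\<lambda>i. y i - z i) (\<lambda>i. y i - z i)"

lemma sqdist_commute: "sqdist d y z = sqdist d z y"
  unfolding ip_def by (intro sum.cong refl) (simp add: algebra_simps)

text \<open>Symmetry is required only below d: the points will be the coordinate functions of
  vectors, whose values beyond the dimension are unspecified.\<close>

context
  fixes d :: nat and Z :: "(nat \<Rightarrow> real) set" and w :: real
  assumes Z_nonempty: "Z \<noteq> {}" and Z_unit: "\<And>z. z \<in> Z \<Longrightarrow> ip {..<d} z z = 1"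
    and Z_sym: "\<And>z. z \<in> Z \<Longrightarrow> \<exists>z'\<in>Z. \<forall>i<d. z' i = - z i"
    and w_def: "w = (\<integral>g. (SUP z\<in>Z. ip {..<d} g z) \<partial>std_gaussian d)"
begin

lemma abs_component_le_1: "z \<in> Z \<Longrightarrow> i < d \<Longrightarrow> \<bar>z i\<bar> \<le> 1"
proof -
  assume z: "z \<in> Z" "i < d"
  have "z i * z i \<le> ip {..<d} z z" unfolding ip_def using z by (intro member_le_sum) auto
  then have "(z i)\<^sup>2 \<le> 1" using Z_unit[OF z(1)] by (simp add: power2_eq_square)
  then show ?thesis by (simp add: abs_square_le_1)
qed

lemma abs_ip_le_SUP: "z \<in> Z \<Longrightarrow> \<bar>ip {..<d} g z\<bar> \<le> (SUP z\<in>Z. ip {..<d} g z)"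
proof -
  assume z: "z \<in> Z"
  obtain z' where z': "z' \<in> Z" "\<forall>i<d. z' i = - z i" using Z_sym[OF z] by blast
  have bdd: "bdd_above ((\<lambda>z. ip {..<d} g z) ` Z)"
    using abs_component_le_1 by (intro bdd_above_ip) auto
  have "ip {..<d} g z' = - ip {..<d} g z"
    using z'(2) by (simp add: ip_def sum_negf[symmetric])
  then have "- ip {..<d} g z \<le> (SUP z\<in>Z. ip {..<d} g z)"
    using cSUP_upper[OF z'(1) bdd] by simp
  moreover have "ip {..<d} g z \<le> (SUP z\<in>Z. ip {..<d} g z)" by (rule cSUP_upper[OF z bdd])
  ultimately show ?thesis by simp
qed

lemma SUP_ip_nonneg: "0 \<le> (SUP z\<in>Z. ip {..<d} g z)"
  using abs_ip_le_SUP Z_nonempty by (metis abs_ge_zero ex_in_conv order_trans)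

lemma integrable_SUP_ip: "integrable (std_gaussian d) (\<lambda>g. SUP z\<in>Z. ip {..<d} g z)"
proof (rule Bochner_Integration.integrable_bound)
  show "integrable (std_gaussian d) (\<lambda>g. \<Sum>i<d. \<bar>g i\<bar>)"
    by (intro Bochner_Integration.integrable_sum integrable_abs integrable_std_gaussian_component) auto
  show "(\<lambda>g. SUP z\<in>Z. ip {..<d} g z) \<in> borel_measurable (std_gaussian d)"
    using Z_nonempty abs_component_le_1 by (rule measurable_SUP_ip)
  have "(SUP z\<in>Z. ip {..<d} g z) \<le> (\<Sum>i<d. \<bar>g i\<bar>)" for g
  proof (rule cSUP_least[OF Z_nonempty])
    fix z assume z: "z \<in> Z"
    show "ip {..<d} g z \<le> (\<Sum>i<d. \<bar>g i\<bar>)"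
      using abs_ip_le_sum_abs[of "{..<d}" z g] abs_component_le_1[OF z] by auto
  qed
  then show "AE g in std_gaussian d. norm (SUP z\<in>Z. ip {..<d} g z) \<le> norm (\<Sum>i<d. \<bar>g i\<bar>)"
    using SUP_ip_nonneg by (intro AE_I2) (simp add: sum_nonneg)
qed

text \<open>Markov's inequality for the supremum at the level 4 W provides the event of probability
  3/4. A bound W stands in for the width because positivity of w is itself deduced from this
  estimate.\<close>

lemma packing_bound_aux:
  assumes W: "0 < W" "w \<le> W" and Y: "finite Y" "Y \<subseteq> Z" and ctr: "ctr \<in> Z"
    and sep: "\<And>y y'. y \<in> Y \<Longrightarrow> y' \<in> Y \<Longrightarrow> y \<noteq> y' \<Longrightarrow> \<delta>\<^sup>2 \<le> sqdist d y y'"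
    and R: "\<And>y. y \<in> Y \<Longrightarrow> sqdist d y ctr \<le> R\<^sup>2" and \<delta>: "0 < \<delta>"
  shows "real (card Y) * (3 / 4 * exp (- (128 * W\<^sup>2 / \<delta>\<^sup>2 + 128 * W\<^sup>2 * R\<^sup>2 / \<delta> ^ 4))) \<le> 1"
proof -
  interpret prob_space "std_gaussian d" by (rule prob_space_std_gaussian)
  let ?M = "\<lambda>g. SUP z\<in>Z. ip {..<d} g z"
  define E where "E = {g \<in> space (std_gaussian d). ?M g < 4 * W}"
  have [measurable]: "?M \<in> borel_measurable (std_gaussian d)"
    using integrable_SUP_ip by (rule borel_measurable_integrable)
  have E: "E \<in> events" unfolding E_def by measurable
  have "prob {g \<in> space (std_gaussian d). 4 * W \<le> ?M g} \<le> w / (4 * W)"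
    unfolding w_def using W SUP_ip_nonneg
    by (intro integral_Markov_inequality_measure[OF integrable_SUP_ip, where A="{}"]) auto
  also have "\<dots> \<le> 1 / 4" using W by (simp add: field_simps)
  also have "{g \<in> space (std_gaussian d). 4 * W \<le> ?M g} = space (std_gaussian d) - E"
    by (auto simp: E_def)
  finally have "3 / 4 \<le> prob E" using E by (simp add: prob_compl)
  moreover have "\<bar>ip {..<d} g y\<bar> < 4 * W" if "g \<in> E" "y \<in> insert ctr Y" for g y
  proof -
    have "y \<in> Z" using that Y ctr by auto
    from abs_ip_le_SUP[OF this, of g] that(1) show ?thesis by (simp add: E_def)
  qed
  ultimately show ?thesis
    using E W(1) Y(1) sep R \<delta> by (intro local_packing_bound[where E=E and ctr=ctr]) auto
qed

lemma sqdist_le_4: "y \<in> Z \<Longrightarrow> z \<in> Z \<Longrightarrow> sqdist d y z \<le> 4"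
proof -
  assume yz: "y \<in> Z" "z \<in> Z"
  have "(ip {..<d} y z)\<^sup>2 \<le> 1" using ip_cauchy_schwarz[of "{..<d}" y z] Z_unit yz by simp
  then have "\<bar>ip {..<d} y z\<bar> \<le> 1" by (simp add: abs_square_le_1)
  moreover have "sqdist d y z = 2 - 2 * ip {..<d} y z"
    using Z_unit yz by (simp add: ip_diff ip_commute[of _ z y])
  ultimately show ?thesis by linarith
qed

text \<open>The packing bound for a point and its antipode, with \<delta> = R = 2: both terms of the
  exponent equal 32 W^2, and the prefactor is 2 * 3/4.\<close>

lemma antipodal_bound: "0 < W \<Longrightarrow> w \<le> W \<Longrightarrow> 3 / 2 \<le> exp (64 * W\<^sup>2)"
proof -
  assume W: "0 < W" "w \<le> W"
  obtain z where z: "z \<in> Z" using Z_nonempty by auto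
  obtain z' where z': "z' \<in> Z" "\<forall>i<d. z' i = - z i" using Z_sym[OF z] by blast
  have dist: "sqdist d z z' = 4"
  proof -
    have "sqdist d z z' = (\<Sum>i<d. 4 * (z i * z i))"
      unfolding ip_def using z'(2) by (intro sum.cong) auto
    then show ?thesis using Z_unit[OF z] by (simp add: ip_def sum_distrib_left[symmetric])
  qed
  then have "z \<noteq> z'" by (auto simp: ip_def)
  then have card: "card {z, z'} = 2" by simp
  have self: "sqdist d z z = 0" by (simp add: ip_def)
  have "real (card {z, z'}) * (3 / 4 * exp (- (128 * W\<^sup>2 / 2\<^sup>2 + 128 * W\<^sup>2 * 2\<^sup>2 / 2 ^ 4))) \<le> 1"
    using W z z' dist self by (intro packing_bound_aux[where ctr=z]) (auto simp: sqdist_commute[of d z' z])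
  then have "3 / 2 * exp (- (64 * W\<^sup>2)) \<le> 1" by (simp add: card)
  then have "3 / 2 * exp (- (64 * W\<^sup>2)) * exp (64 * W\<^sup>2) \<le> 1 * exp (64 * W\<^sup>2)"
    by (intro mult_right_mono) auto
  then show ?thesis by (simp add: mult.assoc flip: exp_add)
qed

lemma width_pos: "0 < w"
proof (rule ccontr)
  assume "\<not> 0 < w"
  \<comment> \<open>A nonpositive width would admit every positive W. At W = 1/20 the exponent is
    0.16 and the exponential stays below 1.19.\<close>
  then have "3 / 2 \<le> exp (64 * (1 / 20 :: real)\<^sup>2)" by (intro antipodal_bound) auto
  also have "exp (64 * (1 / 20 :: real)\<^sup>2) \<le> 1 + 64 * (1 / 20)\<^sup>2 + (64 * (1 / 20)\<^sup>2)\<^sup>2"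
    by (intro exp_le_quadratic) (simp add: power2_eq_square)
  finally show False by (simp add: power2_eq_square)
qed

text \<open>A lower bound on the width, used to absorb constants such as 4/3 and 2 into exponents of
  order w^2.\<close>

lemma width_ge: "3 / 2 \<le> exp (64 * w\<^sup>2)"
  using antipodal_bound[OF width_pos] by simp

text \<open>A maximal \<delta>-separated set in the ball of radius 2 \<delta> is a net of that ball.
  The restriction to this radius keeps R^2 / \<delta>^4 of order 1 / \<delta>^2: the exponent has
  the constant 128 + 4 * 128 = 640, and the factor 4/3 goes into exp (64 w^2).\<close>

lemma local_net:
  assumes ctr: "ctr \<in> Z" and \<delta>: "0 < \<delta>"
  shows "\<exists>Y. finite Y \<and> Y \<subseteq> Z \<and> real (card Y) \<le> exp (64 * w\<^sup>2 + 640 * w\<^sup>2 / \<delta>\<^sup>2) \<and>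
    (\<forall>z\<in>Z. sqdist d z ctr \<le> (2 * \<delta>)\<^sup>2 \<longrightarrow> (\<exists>y\<in>Y. sqdist d z y \<le> \<delta>\<^sup>2))"
proof -
  define P where "P Y \<longleftrightarrow> finite Y \<and> Y \<subseteq> {z\<in>Z. sqdist d z ctr \<le> (2 * \<delta>)\<^sup>2} \<and>
    (\<forall>y\<in>Y. \<forall>y'\<in>Y. y \<noteq> y' \<longrightarrow> \<delta>\<^sup>2 \<le> sqdist d y y')" for Y
  let ?B = "exp (64 * w\<^sup>2 + 640 * w\<^sup>2 / \<delta>\<^sup>2)"
  have bound: "real (card Y) \<le> ?B" if Y: "P Y" for Y
  proof -
    define K where "K = 128 * w\<^sup>2 / \<delta>\<^sup>2 + 128 * w\<^sup>2 * (2 * \<delta>)\<^sup>2 / \<delta> ^ 4"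
    have K: "K = 640 * w\<^sup>2 / \<delta>\<^sup>2" using \<delta> by (simp add: K_def field_simps eval_nat_numeral)
    have "real (card Y) * (3 / 4 * exp (- K)) \<le> 1"
      unfolding K_def using Y ctr \<delta> width_pos by (intro packing_bound_aux[where ctr=ctr]) (auto simp: P_def)
    then have "real (card Y) * (3 / 4 * exp (- K)) * (4 / 3 * exp K) \<le> 1 * (4 / 3 * exp K)"
      by (intro mult_right_mono) auto
    moreover have "real (card Y) * (3 / 4 * exp (- K)) * (4 / 3 * exp K) = real (card Y) * (exp (- K) * exp K)"
      by simp
    moreover have "exp (- K) * exp K = 1" by (simp flip: exp_add)
    ultimately have "real (card Y) \<le> 4 / 3 * exp K" by simp
    also have "\<dots> \<le> exp (64 * w\<^sup>2) * exp K" using width_ge by (intro mult_right_mono) auto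
    finally show ?thesis by (simp add: K exp_add)
  qed
  have "P {}" by (simp add: P_def)
  moreover have "\<forall>Y. P Y \<longrightarrow> card Y < Suc (nat \<lfloor>?B\<rfloor>)"
    using bound by (simp add: le_nat_floor less_Suc_eq_le)
  ultimately have "\<exists>Y. P Y \<and> (\<forall>Y'. P Y' \<longrightarrow> card Y' \<le> card Y)"
    by (rule ex_has_greatest_nat[where f=card])
  then obtain Y where Y: "P Y" "\<And>Y'. P Y' \<Longrightarrow> card Y' \<le> card Y" by auto
  have "\<exists>y\<in>Y. sqdist d z y \<le> \<delta>\<^sup>2" if z: "z \<in> Z" "sqdist d z ctr \<le> (2 * \<delta>)\<^sup>2" for z
  proof (rule ccontr)
    assume "\<not> ?thesis"
    then have far: "\<And>y. y \<in> Y \<Longrightarrow> \<delta>\<^sup>2 \<le> sqdist d z y" by force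
    have "z \<notin> Y"
    proof
      assume "z \<in> Y"
      moreover have "sqdist d z z = 0" by (simp add: ip_def)
      ultimately show False using \<open>\<not> (\<exists>y\<in>Y. sqdist d z y \<le> \<delta>\<^sup>2)\<close> by force
    qed
    moreover have "P (insert z Y)"
      using Y(1) z far by (auto simp: P_def sqdist_commute[of d _ z])
    moreover have "finite Y" using Y(1) by (simp add: P_def)
    ultimately show False using Y(2)[of "insert z Y"] by simp
  qed
  then show ?thesis using Y(1) bound[OF Y(1)] by (intro exI[of _ Y]) (auto simp: P_def)
qed

text \<open>Each point of the net is replaced by a local net of half the mesh. Cardinalities
  multiply, and 240 is large enough for the exponents to sum geometrically: 240 + 640 + 64 \<le> 4 *
  240 in units of w^2 4^j.\<close>

lemma dyadic_net:
  "\<exists>N. finite N \<and> N \<subseteq> Z \<and> real (card N) \<le> exp (240 * w\<^sup>2 * 4 ^ j) \<and>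
    (\<forall>z\<in>Z. \<exists>y\<in>N. sqdist d z y \<le> (2 / 2 ^ j)\<^sup>2)"
proof (induction j)
  case 0
  obtain z where z: "z \<in> Z" using Z_nonempty by auto
  then show ?case using sqdist_le_4 by (intro exI[of _ "{z}"]) auto
next
  case (Suc j)
  then obtain N where N: "finite N" "N \<subseteq> Z" "real (card N) \<le> exp (240 * w\<^sup>2 * 4 ^ j)"
    "\<And>z. z \<in> Z \<Longrightarrow> \<exists>y\<in>N. sqdist d z y \<le> (2 / 2 ^ j)\<^sup>2" by blast
  define \<delta> :: real where "\<delta> = 2 / 2 ^ Suc j"
  have \<delta>: "0 < \<delta>" "2 * \<delta> = 2 / 2 ^ j" by (auto simp: \<delta>_def)
  have "\<forall>x\<in>N. \<exists>Y. finite Y \<and> Y \<subseteq> Z \<and> real (card Y) \<le> exp (64 * w\<^sup>2 + 640 * w\<^sup>2 / \<delta>\<^sup>2) \<and>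
      (\<forall>z\<in>Z. sqdist d z x \<le> (2 * \<delta>)\<^sup>2 \<longrightarrow> (\<exists>y\<in>Y. sqdist d z y \<le> \<delta>\<^sup>2))"
    using local_net[OF _ \<delta>(1)] N(2) by blast
  from bchoice[OF this] obtain Y where Y': "\<forall>x\<in>N. finite (Y x) \<and> Y x \<subseteq> Z \<and>
      real (card (Y x)) \<le> exp (64 * w\<^sup>2 + 640 * w\<^sup>2 / \<delta>\<^sup>2) \<and>
      (\<forall>z\<in>Z. sqdist d z x \<le> (2 * \<delta>)\<^sup>2 \<longrightarrow> (\<exists>y\<in>Y x. sqdist d z y \<le> \<delta>\<^sup>2))"
    by blast
  then have Y: "\<And>x. x \<in> N \<Longrightarrow> finite (Y x)" "\<And>x. x \<in> N \<Longrightarrow> Y x \<subseteq> Z"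
    "\<And>x. x \<in> N \<Longrightarrow> real (card (Y x)) \<le> exp (64 * w\<^sup>2 + 640 * w\<^sup>2 / \<delta>\<^sup>2)"
    "\<And>x z. x \<in> N \<Longrightarrow> z \<in> Z \<Longrightarrow> sqdist d z x \<le> (2 * \<delta>)\<^sup>2 \<Longrightarrow> \<exists>y\<in>Y x. sqdist d z y \<le> \<delta>\<^sup>2"
    by auto
  have "real (card (\<Union>x\<in>N. Y x)) \<le> (\<Sum>x\<in>N. real (card (Y x)))"
    using card_UN_le[OF N(1), of Y] by (simp flip: of_nat_sum)
  also have "\<dots> \<le> real (card N) * exp (64 * w\<^sup>2 + 640 * w\<^sup>2 / \<delta>\<^sup>2)"
    using sum_bounded_above[of N "\<lambda>x. real (card (Y x))"] Y(3) by simp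
  also have "\<dots> \<le> exp (240 * w\<^sup>2 * 4 ^ j) * exp (64 * w\<^sup>2 + 640 * w\<^sup>2 / \<delta>\<^sup>2)"
    using N(3) by (intro mult_right_mono) auto
  also have "\<dots> = exp (w\<^sup>2 * (240 * 4 ^ j + 64 + 160 * 4 ^ Suc j))"
  proof -
    have "(2 ^ Suc j :: real)\<^sup>2 = 4 ^ Suc j" by (simp add: power_even_eq[symmetric] power_mult[symmetric] mult.commute[of _ "2::nat"] power_mult[of 2 2, simplified])
    then have "\<delta>\<^sup>2 = 4 / 4 ^ Suc j" by (simp add: \<delta>_def power_divide)
    then have "640 * w\<^sup>2 / \<delta>\<^sup>2 = 160 * w\<^sup>2 * 4 ^ Suc j" by simp
    then show ?thesis by (simp only: exp_add[symmetric]) (simp add: algebra_simps)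
  qed
  also have "\<dots> \<le> exp (240 * w\<^sup>2 * 4 ^ Suc j)"
  proof -
    have "(1::real) \<le> 4 ^ j" by simp
    then have "(240 * 4 ^ j + 64 + 160 * 4 ^ Suc j :: real) \<le> 240 * 4 ^ Suc j"
      unfolding power_Suc by linarith
    then have "w\<^sup>2 * (240 * 4 ^ j + 64 + 160 * 4 ^ Suc j) \<le> w\<^sup>2 * (240 * 4 ^ Suc j)"
      by (intro mult_left_mono) auto
    then show ?thesis by (simp only: exp_le_cancel_iff mult.assoc mult.left_commute[of 240 "w\<^sup>2"])
  qed
  finally have "real (card (\<Union>x\<in>N. Y x)) \<le> exp (240 * w\<^sup>2 * 4 ^ Suc j)" .
  moreover have "\<exists>y\<in>(\<Union>x\<in>N. Y x). sqdist d z y \<le> (2 / 2 ^ Suc j)\<^sup>2" if z: "z \<in> Z" for z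
  proof -
    obtain x where "x \<in> N" "sqdist d z x \<le> (2 * \<delta>)\<^sup>2" using N(4)[OF z] unfolding \<delta>(2) by blast
    with Y(4)[OF _ z] show ?thesis by (fastforce simp: \<delta>_def)
  qed
  ultimately show ?case
    using N(1) Y(1,2) by (intro exI[of _ "\<Union>x\<in>N. Y x"]) blast
qed

lemma sudakov_net:
  assumes \<delta>: "0 < \<delta>" "\<delta> \<le> 2"
  shows "\<exists>N. finite N \<and> N \<subseteq> Z \<and> real (card N) \<le> exp (3840 * w\<^sup>2 / \<delta>\<^sup>2) \<and>
    (\<forall>z\<in>Z. \<exists>y\<in>N. sqdist d z y \<le> \<delta>\<^sup>2)"
proof -
  obtain j0 where "2 / \<delta> < 2 ^ j0" using real_arch_pow[of 2 "2 / \<delta>"] by auto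
  then have ex: "\<exists>j. 2 / 2 ^ j \<le> \<delta>" using \<delta> by (intro exI[of _ j0]) (simp add: field_simps)
  \<comment> \<open>The first dyadic mesh not above \<delta>. Minimality gives 4^j \<le> 16 /
    \<delta>^2, whence 3840 = 16 * 240.\<close>
  define j where "j = (LEAST j. 2 / 2 ^ j \<le> \<delta>)"
  have j: "2 / 2 ^ j \<le> \<delta>" unfolding j_def using ex by (rule LeastI_ex)
  have pow: "2 ^ j \<le> 4 / \<delta>"
  proof (cases j)
    case 0
    then show ?thesis using \<delta> by (simp add: field_simps)
  next
    case (Suc i)
    then have "\<not> 2 / 2 ^ i \<le> \<delta>" using not_less_Least[of i "\<lambda>j. 2 / 2 ^ j \<le> \<delta>"] by (simp add: j_def)
    then show ?thesis using \<delta> Suc by (simp add: field_simps)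
  qed
  have "(4::real) ^ j = (2 ^ j)\<^sup>2" by (simp add: power2_eq_square flip: power_mult_distrib)
  also have "\<dots> \<le> (4 / \<delta>)\<^sup>2" using pow by (intro power_mono) auto
  finally have four: "4 ^ j \<le> 16 / \<delta>\<^sup>2" by (simp add: power_divide)
  from dyadic_net[of j] obtain N where N: "finite N" "N \<subseteq> Z"
    "real (card N) \<le> exp (240 * w\<^sup>2 * 4 ^ j)"
    "\<forall>z\<in>Z. \<exists>y\<in>N. sqdist d z y \<le> (2 / 2 ^ j)\<^sup>2"
    by (elim exE conjE)
  have "240 * w\<^sup>2 * 4 ^ j \<le> 240 * w\<^sup>2 * (16 / \<delta>\<^sup>2)" using four by (intro mult_left_mono) auto
  also have "\<dots> = 3840 * w\<^sup>2 / \<delta>\<^sup>2" by (simp only: times_divide_eq_right)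
  finally have "exp (240 * w\<^sup>2 * 4 ^ j) \<le> exp (3840 * w\<^sup>2 / \<delta>\<^sup>2)" by (subst exp_le_cancel_iff)
  moreover have "(2 / 2 ^ j)\<^sup>2 \<le> \<delta>\<^sup>2" using j by (intro power_mono) auto
  ultimately have "real (card N) \<le> exp (3840 * w\<^sup>2 / \<delta>\<^sup>2)"
    and "\<exists>y\<in>N. sqdist d z y \<le> \<delta>\<^sup>2" if "z \<in> Z" for z
    using N(3) N(4)[rule_format, OF that] by (auto intro: order_trans)
  with N(1,2) Z_nonempty show ?thesis by (intro exI[of _ N]) auto
qed

end

section \<open>One vector\<close>

lemma avg_permutation_inverse: "avg {\<pi>. \<pi> permutes S} (\<lambda>\<pi>. f (inv_into UNIV \<pi>)) = avg {\<pi>. \<pi> permutes S} f"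
proof (rule avg_reindex)
  show "bij_betw (inv_into UNIV) {\<pi>. \<pi> permutes S} {\<pi>. \<pi> permutes S}"
    by (rule bij_betwI[where g="inv_into UNIV"]) (auto simp: permutes_inv permutes_inv_inv)
qed

lemma avg_of_bool_mono:
  "(\<And>x. x \<in> X \<Longrightarrow> P x \<Longrightarrow> Q x) \<Longrightarrow> avg X (\<lambda>x. of_bool (P x)) \<le> avg X (\<lambda>x. of_bool (Q x))"
  by (rule avg_mono) (auto simp: of_bool_def)

lemma avg_of_bool_disj:
  "avg X (\<lambda>x. of_bool (P x \<or> Q x)) \<le> avg X (\<lambda>x. of_bool (P x)) + avg X (\<lambda>x. of_bool (Q x))"
  unfolding avg_add[symmetric] by (rule avg_mono) (auto simp: of_bool_def)

text \<open>The moment bound covers only half of the frame, so the indices are cut into two halves,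
  each kept below 4 / d. Passing to the inverse permutation leaves the weights in fixed positions
  and permutes the frame vectors.\<close>

lemma avg_frame_op_permuted_large_le:
  fixes u :: "nat \<Rightarrow> 'b \<Rightarrow> real" and x :: "nat \<Rightarrow> real"
  assumes d: "0 < d" and u: "parseval I {..<d} u" and M: "(\<Sum>k<d. ip I (u k) (u k)) = M"
    and x: "\<And>i. i < d \<Longrightarrow> 0 \<le> x i" "\<And>i k. i < d \<Longrightarrow> k < d \<Longrightarrow> x i * ip I (u k) (u k) \<le> \<beta>"
    and x1: "(\<Sum>i<d. x i) = 1" and \<beta>: "0 < \<beta>" "\<And>i. i < d \<Longrightarrow> 2 * x i \<le> real d * \<beta>"
  shows "avg {\<pi>. \<pi> permutes {..<d}}
      (\<lambda>\<pi>. of_bool (\<exists>y. 8 / real d * ip I y y < (\<Sum>k<d. x (\<pi> k) * (ip I (u k) y)\<^sup>2))) \<le>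
    16 * M * exp (- 1 / (5 * real d * \<beta>))"
proof -
  let ?P = "{\<pi>. \<pi> permutes {..<d}}"
  define J1 J2 where "J1 = {..<(d + 1) div 2}" and "J2 = {(d + 1) div 2..<d}"
  have J: "J1 \<subseteq> {..<d}" "J2 \<subseteq> {..<d}" "J1 \<union> J2 = {..<d}" "J1 \<inter> J2 = {}"
    "2 * card J1 \<le> d + 1" "2 * card J2 \<le> d + 1"
    using d by (auto simp: J1_def J2_def)
  define bad where "bad J \<tau> \<longleftrightarrow> (\<exists>y. 4 / real d * ip I y y < (\<Sum>i\<in>J. x i * (ip I (u (\<tau> i)) y)\<^sup>2))" for J \<tau>
  have half: "avg ?P (\<lambda>\<tau>. of_bool (bad J \<tau>)) \<le> 8 * M * exp (- 1 / (5 * real d * \<beta>))"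
    if "J \<subseteq> {..<d}" "2 * card J \<le> d + 1" for J
  proof -
    have "(\<Sum>i\<in>J. x i) \<le> (\<Sum>i<d. x i)" using that x(1) by (intro sum_mono2) auto
    then have "(\<Sum>i\<in>J. x i) \<le> 1" using x1 by simp
    with avg_frame_op_large_le[of "{..<d}" J I u M x \<beta>] that assms show ?thesis
      by (auto simp: bad_def)
  qed
  have "avg ?P (\<lambda>\<pi>. of_bool (\<exists>y. 8 / real d * ip I y y < (\<Sum>k<d. x (\<pi> k) * (ip I (u k) y)\<^sup>2))) \<le>
      avg ?P (\<lambda>\<pi>. of_bool (bad J1 (inv_into UNIV \<pi>) \<or> bad J2 (inv_into UNIV \<pi>)))"
  proof (rule avg_of_bool_mono)
    fix \<pi> assume "\<pi> \<in> ?P"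
    then have pi: "\<pi> permutes {..<d}" by simp
    let ?h = "\<lambda>y i. x i * (ip I (u (inv_into UNIV \<pi> i)) y)\<^sup>2"
    assume "\<exists>y. 8 / real d * ip I y y < (\<Sum>k<d. x (\<pi> k) * (ip I (u k) y)\<^sup>2)"
    then obtain y where y: "8 / real d * ip I y y < (\<Sum>k<d. x (\<pi> k) * (ip I (u k) y)\<^sup>2)" by blast
    have "(\<Sum>k<d. x (\<pi> k) * (ip I (u k) y)\<^sup>2) = (\<Sum>k<d. x (\<pi> k) * (ip I (u (inv_into UNIV \<pi> (\<pi> k))) y)\<^sup>2)"
      using pi by (simp add: permutes_inverses)
    also have "\<dots> = (\<Sum>i<d. ?h y i)"
      using sum.permute[OF pi, of "\<lambda>i. ?h y i"] by (simp add: o_def)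
    also have "\<dots> = (\<Sum>i\<in>J1. ?h y i) + (\<Sum>i\<in>J2. ?h y i)"
      unfolding J(3)[symmetric] using J(4) by (intro sum.union_disjoint) (auto simp: J1_def J2_def)
    finally have "4 / real d * ip I y y + 4 / real d * ip I y y <
        (\<Sum>i\<in>J1. ?h y i) + (\<Sum>i\<in>J2. ?h y i)"
      using y by simp
    then have "4 / real d * ip I y y < (\<Sum>i\<in>J1. ?h y i) \<or>
        4 / real d * ip I y y < (\<Sum>i\<in>J2. ?h y i)" by linarith
    then show "bad J1 (inv_into UNIV \<pi>) \<or> bad J2 (inv_into UNIV \<pi>)" unfolding bad_def by blast
  qed
  also have "\<dots> = avg ?P (\<lambda>\<pi>. of_bool (bad J1 \<pi> \<or> bad J2 \<pi>))"
    by (rule avg_permutation_inverse[where f="\<lambda>\<pi>. of_bool (bad J1 \<pi> \<or> bad J2 \<pi>)"])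
  also have "\<dots> \<le> avg ?P (\<lambda>\<pi>. of_bool (bad J1 \<pi>)) + avg ?P (\<lambda>\<pi>. of_bool (bad J2 \<pi>))"
    by (rule avg_of_bool_disj)
  also have "\<dots> \<le> 8 * M * exp (- 1 / (5 * real d * \<beta>)) + 8 * M * exp (- 1 / (5 * real d * \<beta>))"
    using J by (intro add_mono half)
  finally show ?thesis by simp
qed

text \<open>Three exceptional events, each of probability at most 2 exp (- a): the diagonal leaves 1
  by \<epsilon> / 10, the operator norm after scaling exceeds 8 / m, or the chaos reaches 8
  \<epsilon> / 10. The first two depend on \<pi> alone; the third is estimated for every \<pi>
  outside them.\<close>

lemma avg_near_isometry_flat_le:
  fixes u :: "nat \<Rightarrow> 'b \<Rightarrow> real" and v :: "nat \<Rightarrow> real" and \<epsilon> a b \<kappa> :: real and m :: nat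
  assumes d: "0 < d" and u: "parseval I {..<d} u" "(\<Sum>k<d. ip I (u k) (u k)) = real m"
    and \<kappa>: "\<And>k. k < d \<Longrightarrow> real d / real m * ip I (u k) (u k) \<le> \<kappa>"
    and v: "(\<Sum>k<d. (v k)\<^sup>2) = 1" "\<And>k. k < d \<Longrightarrow> (v k)\<^sup>2 \<le> b"
    and b: "\<kappa> * b * (18 * real m * (a + ln (real m))) \<le> 1"
    and a: "3 \<le> a" and \<epsilon>: "0 < \<epsilon>" "\<epsilon> < 1" and m: "2025 * a \<le> \<epsilon>\<^sup>2 * real m"
  shows "avg {\<pi>. \<pi> permutes {..<d}} (\<lambda>\<pi>. avg (sign_vectors {..<d}) (\<lambda>\<xi>.
      of_bool (9 / 10 * \<epsilon> < \<bar>real d / real m *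
        ip I (sign_sum (\<lambda>k j. v (\<pi> k) * u k j) {..<d} \<xi>) (sign_sum (\<lambda>k j. v (\<pi> k) * u k j) {..<d} \<xi>) - 1\<bar>))) \<le>
    6 * exp (- a)"
proof -
  let ?P = "{\<pi>. \<pi> permutes {..<d}}"
  let ?n = "real d" and ?m = "real m"
  have "2025 * 3 \<le> \<epsilon>\<^sup>2 * ?m" using m a by linarith
  moreover have "\<epsilon>\<^sup>2 * ?m \<le> 1 * ?m" using \<epsilon> by (intro mult_right_mono) (auto simp: power_le_one)
  ultimately have m1: "6075 \<le> ?m" by simp
  have n: "0 < ?n" using d by simp
  define L where "L = a + ln ?m"
  have "0 \<le> ln ?m" using m1 by (intro ln_ge_zero) auto
  then have L: "a \<le> L" "0 < L" using a by (auto simp: L_def)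
  define c where "c k = ?n / ?m * ip I (u k) (u k)" for k
  have c: "\<And>k. 0 \<le> c k" "(\<Sum>k<d. c k) = ?n"
    unfolding c_def sum_distrib_left[symmetric] u(2) using m1 by (auto simp: ip_nonneg)
  have \<kappa>1: "1 \<le> \<kappa>"
  proof -
    have "?n \<le> (\<Sum>k<d. \<kappa>)" unfolding c(2)[symmetric] using \<kappa> by (intro sum_mono) (auto simp: c_def)
    then show ?thesis using n by simp
  qed
  have x\<kappa>: "\<kappa> * (v i)\<^sup>2 \<le> 1 / (18 * ?m * L)" if "i < d" for i
  proof -
    have "\<kappa> * (v i)\<^sup>2 \<le> \<kappa> * b" using v(2)[OF that] \<kappa>1 by (intro mult_left_mono) auto
    also have "\<dots> \<le> 1 / (18 * ?m * L)" using b L m1 by (simp add: L_def[symmetric] field_simps)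
    finally show ?thesis .
  qed
  define T where "T \<pi> = (\<Sum>k<d. c k * (v (\<pi> k))\<^sup>2)" for \<pi>
  define bad1 where "bad1 \<pi> \<longleftrightarrow> \<epsilon> / 10 \<le> \<bar>T \<pi> - 1\<bar>" for \<pi>
  define bad2 where "bad2 \<pi> \<longleftrightarrow> (\<exists>y. 8 / ?n * ip I y y < (\<Sum>k<d. (v (\<pi> k))\<^sup>2 * (ip I (u k) y)\<^sup>2))" for \<pi>
  have P1: "avg ?P (\<lambda>\<pi>. of_bool (bad1 \<pi>)) \<le> 2 * exp (- a)"
  proof -
    define \<omega> where "\<omega> = 1 / (18 * ?m * a)"
    \<comment> \<open>The minimizer of s^2 \<omega> - s \<epsilon> / 10, which is why s \<omega> =
      \<epsilon> / 20.\<close>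
    define s where "s = 9 / 10 * \<epsilon> * ?m * a"
    have s: "0 \<le> s" "s * \<omega> = \<epsilon> / 20" using \<epsilon> a m1 by (auto simp: s_def \<omega>_def)
    have *: "avg ?P (\<lambda>\<pi>. exp (s' * (T \<pi> - 1))) \<le> exp (s\<^sup>2 * \<omega>)" if s': "s' = s \<or> s' = - s" for s'
    proof -
      have "avg ?P (\<lambda>\<pi>. exp (s' * (T \<pi> - 1))) \<le> exp (s'\<^sup>2 * \<omega>)"
        unfolding T_def
      proof (rule avg_exp_permutation_le)
        fix k i assume ki: "k \<in> {..<d}" "i \<in> {..<d}"
        have "c k * (v i)\<^sup>2 \<le> \<kappa> * (v i)\<^sup>2" using \<kappa>[of k] ki by (intro mult_right_mono) (auto simp: c_def)
        also have "\<dots> \<le> 1 / (18 * ?m * L)" using x\<kappa> ki by simp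
        also have "\<dots> \<le> \<omega>" unfolding \<omega>_def using L a m1 by (intro divide_left_mono mult_left_mono) auto
        finally show "c k * (v i)\<^sup>2 \<le> \<omega>" .
      next
        have "\<bar>s'\<bar> = s" using s s' by auto
        then show "\<bar>s'\<bar> * \<omega> \<le> 1" using s \<epsilon> by simp
      qed (use d c v in auto)
      then show ?thesis using s' by auto
    qed
    have "avg ?P (\<lambda>\<pi>. of_bool (bad1 \<pi>)) \<le> 2 * exp (s\<^sup>2 * \<omega>) * exp (- s * (\<epsilon> / 10))"
      unfolding bad1_def using s by (intro avg_abs_tail * finite_permutations) auto
    also have "\<dots> = 2 * exp (s * (s * \<omega>) - s * (\<epsilon> / 10))"
      by (simp only: power2_eq_square mult.assoc exp_add[symmetric] diff_conv_add_uminus mult_minus_left)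
    also have "s * (s * \<omega>) - s * (\<epsilon> / 10) = - (9 / 200) * (\<epsilon>\<^sup>2 * ?m) * a"
      unfolding s(2) by (simp add: s_def power2_eq_square)
    also have "2 * exp (- (9 / 200) * (\<epsilon>\<^sup>2 * ?m) * a) \<le> 2 * exp (- a)"
    proof -
      have "1 \<le> 9 / 200 * (\<epsilon>\<^sup>2 * ?m)" using m a by simp
      then have "1 * a \<le> 9 / 200 * (\<epsilon>\<^sup>2 * ?m) * a" using a by (intro mult_right_mono) auto
      then show ?thesis by simp
    qed
    finally show ?thesis .
  qed
  have P2: "avg ?P (\<lambda>\<pi>. of_bool (bad2 \<pi>)) \<le> 2 * exp (- a)"
  proof -
    \<comment> \<open>Then 1 / (5 d \<beta>) = 18 L / 5, and the part ln m of L removes the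
      prefactor m.\<close>
    define \<beta> where "\<beta> = 1 / (18 * ?n * L)"
    have "avg ?P (\<lambda>\<pi>. of_bool (bad2 \<pi>)) \<le> 16 * ?m * exp (- 1 / (5 * ?n * \<beta>))"
      unfolding bad2_def
    proof (rule avg_frame_op_permuted_large_le[OF d u])
      fix i k assume ik: "i < d" "k < d"
      have "(v i)\<^sup>2 * ip I (u k) (u k) \<le> (v i)\<^sup>2 * (?m / ?n * \<kappa>)"
        using \<kappa>[OF ik(2)] n m1 by (intro mult_left_mono) (auto simp: field_simps)
      also have "\<dots> = ?m / ?n * (\<kappa> * (v i)\<^sup>2)" by simp
      also have "\<dots> \<le> ?m / ?n * (1 / (18 * ?m * L))" using x\<kappa>[OF ik(1)] by (intro mult_left_mono) auto
      also have "\<dots> = \<beta>" using m1 by (simp add: \<beta>_def)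
      finally show "(v i)\<^sup>2 * ip I (u k) (u k) \<le> \<beta>" .
    next
      fix i assume i: "i < d"
      have "2 * (v i)\<^sup>2 \<le> 2 * (\<kappa> * (v i)\<^sup>2)" using \<kappa>1 mult_right_mono[of 1 \<kappa> "(v i)\<^sup>2"] by simp
      also have "\<dots> \<le> 2 * (1 / (18 * ?m * L))" using x\<kappa>[OF i] by (intro mult_left_mono) auto
      also have "\<dots> \<le> 1 / (18 * L)" using L m1 by (simp add: field_simps)
      also have "\<dots> = ?n * \<beta>" using n by (simp add: \<beta>_def)
      finally show "2 * (v i)\<^sup>2 \<le> ?n * \<beta>" .
    qed (use v L n in \<open>auto simp: \<beta>_def\<close>)
    also have "- 1 / (5 * ?n * \<beta>) = - (18 / 5) * a - 18 / 5 * ln ?m"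
      using n L(2) by (simp add: \<beta>_def) (simp add: L_def add_divide_distrib)
    also have "16 * ?m * exp (- (18 / 5) * a - 18 / 5 * ln ?m) \<le> 2 * exp (- a)"
    proof -
      have "0 \<le> ln ?m" using m1 by simp
      then have "- (18 / 5) * a - 18 / 5 * ln ?m \<le> - (13 / 5 * a) + (- a) + (- ln ?m)" by simp
      then have "exp (- (18 / 5) * a - 18 / 5 * ln ?m) \<le> exp (- (13 / 5 * a)) * exp (- a) * exp (- ln ?m)"
        by (simp only: exp_add[symmetric] exp_le_cancel_iff)
      also have "exp (- ln ?m) = 1 / ?m" using m1 by (simp add: exp_minus inverse_eq_divide)
      finally have "16 * ?m * exp (- (18 / 5) * a - 18 / 5 * ln ?m) \<le>
          16 * ?m * (exp (- (13 / 5 * a)) * exp (- a) * (1 / ?m))"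
        by (intro mult_left_mono) auto
      also have "\<dots> = 16 * exp (- (13 / 5 * a)) * exp (- a)" using m1 by simp
      also have "\<dots> \<le> 2 * exp (- a)"
      proof (intro mult_right_mono)
        have "8 \<le> 1 + 13 / 5 * a" using a by simp
        also have "\<dots> \<le> exp (13 / 5 * a)" by (rule exp_ge_add_one_self)
        finally have "8 * exp (- (13 / 5 * a)) \<le> exp (13 / 5 * a) * exp (- (13 / 5 * a))"
          by (intro mult_right_mono) auto
        then show "16 * exp (- (13 / 5 * a)) \<le> 2" by (simp add: exp_minus_inverse)
      qed auto
      finally show ?thesis .
    qed
    finally show ?thesis .
  qed
  \<comment> \<open>The scaling d / m is shared equally by the two arguments of the form, so that
    the scaled squared norm is a chaos plus its diagonal for the vectors
    \<open>p \<pi> k\<close>.\<close>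
  define p where "p \<pi> k j = sqrt (?n / ?m) * (v (\<pi> k) * u k j)" for \<pi> k j
  define dev where "dev \<pi> \<xi> \<longleftrightarrow> 9 / 10 * \<epsilon> < \<bar>?n / ?m *
    ip I (sign_sum (\<lambda>k j. v (\<pi> k) * u k j) {..<d} \<xi>) (sign_sum (\<lambda>k j. v (\<pi> k) * u k j) {..<d} \<xi>) - 1\<bar>" for \<pi> \<xi>
  let ?A = "\<lambda>\<pi>. avg (sign_vectors {..<d}) (\<lambda>\<xi>. of_bool (dev \<pi> \<xi>))"
  have sq: "sqrt (?n / ?m) * sqrt (?n / ?m) = ?n / ?m" by simp
  have p_trace: "(\<Sum>k<d. ip I (p \<pi> k) (p \<pi> k)) = T \<pi>" for \<pi>
  proof -
    have "ip I (p \<pi> k) (p \<pi> k) = (sqrt (?n / ?m) * sqrt (?n / ?m)) * ((v (\<pi> k) * v (\<pi> k)) * ip I (u k) (u k))" for k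
      unfolding p_def ip_lin by (simp only: mult_ac)
    then show ?thesis unfolding sq by (simp add: T_def c_def power2_eq_square mult_ac)
  qed
  have p_ip: "(ip I (p \<pi> k) y)\<^sup>2 = ?n / ?m * ((v (\<pi> k))\<^sup>2 * (ip I (u k) y)\<^sup>2)" for \<pi> k y
    unfolding p_def ip_lin power_mult_distrib by simp
  have p_chaos: "?n / ?m * ip I (sign_sum (\<lambda>k j. v (\<pi> k) * u k j) {..<d} \<xi>) (sign_sum (\<lambda>k j. v (\<pi> k) * u k j) {..<d} \<xi>) =
      chaos I (p \<pi>) {..<d} \<xi> + T \<pi>" for \<pi> \<xi>
  proof -
    let ?y = "sign_sum (\<lambda>k j. v (\<pi> k) * u k j) {..<d} \<xi>"
    have "sign_sum (p \<pi>) {..<d} \<xi> = (\<lambda>j. sqrt (?n / ?m) * ?y j)"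
      by (simp add: sign_sum_def p_def sum_distrib_left mult_ac)
    then have "ip I (sign_sum (p \<pi>) {..<d} \<xi>) (sign_sum (p \<pi>) {..<d} \<xi>) =
        (sqrt (?n / ?m) * sqrt (?n / ?m)) * ip I ?y ?y"
      by (simp only: ip_lin mult.assoc)
    then show ?thesis unfolding sq by (simp add: chaos_def p_trace)
  qed
  have P3: "?A \<pi> \<le> 2 * exp (- a)"
    if good: "\<not> bad1 \<pi>" "\<not> bad2 \<pi>" for \<pi>
  proof -
    \<comment> \<open>Close to the minimizer \<epsilon> m / 352 of the exponent with h = 8 / m and
      diagonal 11/10. The exponent is at most -0.00112 \<epsilon>^2 m, which is below -a because
      0.00112 * 2025 > 2.\<close>
    define s where "s = \<epsilon> * ?m / 400"
    have s0: "0 \<le> s" using \<epsilon> by (simp add: s_def)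
    have "\<bar>T \<pi> - 1\<bar> < \<epsilon> / 10" using good(1) by (simp add: bad1_def not_le)
    then have T: "T \<pi> \<le> 11 / 10" "\<bar>T \<pi> - 1\<bar> < \<epsilon> / 10" using \<epsilon> by linarith+
    have h: "(\<Sum>k<d. (ip I (p \<pi> k) y)\<^sup>2) \<le> 8 / ?m * ip I y y" for y
    proof -
      have "(\<Sum>k<d. (v (\<pi> k))\<^sup>2 * (ip I (u k) y)\<^sup>2) \<le> 8 / ?n * ip I y y"
        using good(2) unfolding bad2_def not_ex not_less by blast
      then have "?n / ?m * (\<Sum>k<d. (v (\<pi> k))\<^sup>2 * (ip I (u k) y)\<^sup>2) \<le> ?n / ?m * (8 / ?n * ip I y y)"
        by (intro mult_left_mono) auto
      then show ?thesis using n by (simp add: p_ip sum_distrib_left)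
    qed
    have mgf: "avg (sign_vectors {..<d}) (\<lambda>\<xi>. exp (s' * chaos I (p \<pi>) {..<d} \<xi>)) \<le> exp (16 * s\<^sup>2 * (8 / ?m) * T \<pi>)"
      if s': "s' = s \<or> s' = - s" for s'
    proof -
      have "\<bar>s'\<bar> = s" using s0 s' by auto
      moreover have "16 * (8 / ?m) * s = 8 / 25 * \<epsilon>" using m1 by (simp add: s_def)
      ultimately have "16 * (8 / ?m) * \<bar>s'\<bar> \<le> 1" using \<epsilon> by simp
      then have "avg (sign_vectors {..<d}) (\<lambda>\<xi>. exp (s' * chaos I (p \<pi>) {..<d} \<xi>)) \<le> exp (16 * s'\<^sup>2 * (8 / ?m) * T \<pi>)"
        by (intro avg_exp_chaos_le h p_trace) auto
      then show ?thesis using s' by auto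
    qed
    have "?A \<pi> \<le>
        avg (sign_vectors {..<d}) (\<lambda>\<xi>. of_bool (8 / 10 * \<epsilon> \<le> \<bar>chaos I (p \<pi>) {..<d} \<xi>\<bar>))"
    proof (rule avg_of_bool_mono)
      fix \<xi> assume "dev \<pi> \<xi>"
      then have "9 / 10 * \<epsilon> < \<bar>chaos I (p \<pi>) {..<d} \<xi> + T \<pi> - 1\<bar>" unfolding dev_def p_chaos .
      with T(2) show "8 / 10 * \<epsilon> \<le> \<bar>chaos I (p \<pi>) {..<d} \<xi>\<bar>" by linarith
    qed
    also have "\<dots> \<le> 2 * exp (16 * s\<^sup>2 * (8 / ?m) * T \<pi>) * exp (- s * (8 / 10 * \<epsilon>))"
      using s0 by (intro avg_abs_tail mgf finite_sign_vectors) auto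
    also have "\<dots> = 2 * exp (16 * s\<^sup>2 * (8 / ?m) * T \<pi> + (- s * (8 / 10 * \<epsilon>)))"
      by (simp only: exp_add mult.assoc)
    also have "\<dots> \<le> 2 * exp (- a)"
    proof -
      have "16 * s\<^sup>2 * (8 / ?m) * T \<pi> \<le> 16 * s\<^sup>2 * (8 / ?m) * (11 / 10)"
        using T(1) by (intro mult_left_mono) auto
      also have "\<dots> = 22 / 25000 * (\<epsilon>\<^sup>2 * ?m)"
        using m1 by (simp add: s_def power2_eq_square field_simps)
      finally have "16 * s\<^sup>2 * (8 / ?m) * T \<pi> + (- s * (8 / 10 * \<epsilon>)) \<le> - (28 / 25000) * (\<epsilon>\<^sup>2 * ?m)"
        by (simp add: s_def power2_eq_square)
      then show ?thesis using m a by simp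
    qed
    finally show ?thesis .
  qed
  have ne: "finite ?P" "?P \<noteq> {}" using finite_permutations[of "{..<d}"] permutes_id by blast+
  have "avg ?P (\<lambda>\<pi>. ?A \<pi>) \<le>
      avg ?P (\<lambda>\<pi>. of_bool (bad1 \<pi>) + of_bool (bad2 \<pi>) + 2 * exp (- a))"
  proof (rule avg_mono)
    fix \<pi>
    have "?A \<pi> \<le> avg (sign_vectors {..<d}) (\<lambda>\<xi>. 1)"
      by (rule avg_mono) auto
    also have "\<dots> = 1" by (intro avg_const finite_sign_vectors sign_vectors_nonempty) auto
    finally have le_1: "?A \<pi> \<le> 1" .
    show "?A \<pi> \<le>
        of_bool (bad1 \<pi>) + of_bool (bad2 \<pi>) + 2 * exp (- a)"
    proof (cases "bad1 \<pi> \<or> bad2 \<pi>")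
      case True
      then have "1 \<le> of_bool (bad1 \<pi>) + (of_bool (bad2 \<pi>) :: real)" by auto
      then show ?thesis using le_1 exp_ge_zero[of "- a"] by linarith
    next
      case False
      then show ?thesis using P3[of \<pi>] by simp
    qed
  qed
  also have "\<dots> = avg ?P (\<lambda>\<pi>. of_bool (bad1 \<pi>)) + avg ?P (\<lambda>\<pi>. of_bool (bad2 \<pi>)) + 2 * exp (- a)"
    using ne by (simp add: avg_add avg_const)
  also have "\<dots> \<le> 6 * exp (- a)" using P1 P2 by simp
  finally show ?thesis by (simp only: dev_def)
qed

section \<open>From a net to the cone\<close>

lemma ip_symmetric_form:
  fixes G :: "'a \<Rightarrow> 'a \<Rightarrow> real"
  assumes "\<And>i l. G i l = G l i"
  shows "ip S x (\<lambda>i. ip S (G i) z) = ip S z (\<lambda>i. ip S (G i) x)"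
proof -
  have "ip S x (\<lambda>i. ip S (G i) z) = (\<Sum>i\<in>S. \<Sum>l\<in>S. x i * (G i l * z l))"
    by (simp add: ip_def sum_distrib_left)
  also have "\<dots> = (\<Sum>l\<in>S. \<Sum>i\<in>S. x i * (G i l * z l))" by (rule sum.swap)
  also have "\<dots> = (\<Sum>l\<in>S. \<Sum>i\<in>S. z l * (G l i * x i))"
  proof (intro sum.cong refl)
    fix l i
    show "x i * (G i l * z l) = z l * (G l i * x i)" using assms[of i l] by simp
  qed
  finally show ?thesis by (simp add: ip_def sum_distrib_left)
qed

lemma ip_bilinear_net_bound:
  fixes d :: nat and G :: "nat \<Rightarrow> nat \<Rightarrow> real" and Z N :: "(nat \<Rightarrow> real) set" and t \<delta> lam :: real
  defines "q \<equiv> \<lambda>x z. ip {..<d} x (\<lambda>i. ip {..<d} (G i) z)"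
  assumes sym: "\<And>i l. G i l = G l i"
    and Z: "\<And>z i. z \<in> Z \<Longrightarrow> i < d \<Longrightarrow> \<bar>z i\<bar> \<le> 1"
    and N: "N \<subseteq> Z" "\<And>z. z \<in> Z \<Longrightarrow> \<exists>y\<in>N. sqrt (sqdist d z y) \<le> \<delta>"
    and decomp: "\<And>x y. x \<in> Z \<Longrightarrow> y \<in> Z \<Longrightarrow> \<exists>(s::nat) c h. (\<forall>j<s. h j \<in> Z \<and> 0 \<le> c j) \<and>
      (\<forall>i<d. x i - y i = (\<Sum>j<s. c j * h j i)) \<and> (\<Sum>j<s. c j) \<le> lam * sqrt (sqdist d x y)"
    and lam: "0 \<le> lam" "lam * \<delta> \<le> 1 / 20"
    and t: "\<And>y y'. y \<in> N \<Longrightarrow> y' \<in> N \<Longrightarrow> \<bar>q y y'\<bar> \<le> t"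
    and x: "x \<in> Z"
  shows "\<bar>q x x\<bar> \<le> 10 / 9 * t"
proof -
  have q_sym: "q x z = q z x" for x z
    unfolding q_def using sym by (rule ip_symmetric_form)
  have q_decomp: "q x z = q y z + (\<Sum>j<s. c j * q (h j) z)"
    if "\<forall>i<d. x i - y i = (\<Sum>j<s. c j * h j i)" for x y z c h and s :: nat
  proof -
    have "q x z - q y z = ip {..<d} (\<lambda>i. x i - y i) (\<lambda>i. ip {..<d} (G i) z)"
      unfolding q_def ip_diff ..
    also have "\<dots> = ip {..<d} (\<lambda>i. \<Sum>j<s. c j * h j i) (\<lambda>i. ip {..<d} (G i) z)"
      unfolding ip_def using that by (intro sum.cong) auto
    also have "\<dots> = (\<Sum>j<s. c j * q (h j) z)"
      by (simp add: q_def ip_sum ip_lin)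
    finally show ?thesis by simp
  qed
  \<comment> \<open>A crude bound, but a finite one: it makes M below a genuine supremum, so that M
    / 10 can be moved to the other side.\<close>
  define K where "K = (\<Sum>i<d. \<Sum>l<d. \<bar>G i l\<bar>)"
  have K: "\<bar>q y z\<bar> \<le> K" if "y \<in> Z" "z \<in> Z" for y z
  proof -
    have "\<bar>q y z\<bar> \<le> (\<Sum>i<d. \<bar>ip {..<d} (G i) z\<bar>)"
      unfolding q_def ip_commute[of _ y] using Z that by (intro abs_ip_le_sum_abs) auto
    also have "\<dots> \<le> K" unfolding K_def using Z that by (intro sum_mono abs_ip_le_sum_abs) auto
    finally show ?thesis .
  qed
  \<comment> \<open>The supremum is over pairs, since the arguments are replaced one at a time and
    mixed values of q occur in between.\<close>
  define M where "M = (SUP (y, z)\<in>Z \<times> Z. \<bar>q y z\<bar>)"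
  have bdd: "bdd_above ((\<lambda>(y, z). \<bar>q y z\<bar>) ` (Z \<times> Z))"
    using K by (intro bdd_aboveI2[where M=K]) auto
  have M: "\<bar>q y z\<bar> \<le> M" if "y \<in> Z" "z \<in> Z" for y z
    using cSUP_upper[OF _ bdd, of "(y, z)"] that by (auto simp: M_def)
  have M0: "0 \<le> M" using M[OF x x] abs_ge_zero order_trans by blast
  have step: "\<exists>y\<in>N. \<bar>q x z\<bar> \<le> \<bar>q y z\<bar> + M / 20" if x: "x \<in> Z" and z: "z \<in> Z" for x z
  proof -
    obtain y where y: "y \<in> N" "sqrt (sqdist d x y) \<le> \<delta>" using N(2)[OF x] by blast
    obtain s :: nat and c h where h: "\<And>j. j < s \<Longrightarrow> h j \<in> Z \<and> 0 \<le> c j"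
      "\<forall>i<d. x i - y i = (\<Sum>j<s. c j * h j i)" "(\<Sum>j<s. c j) \<le> lam * sqrt (sqdist d x y)"
      using decomp[OF x, of y] y(1) N(1) by blast
    have "\<bar>\<Sum>j<s. c j * q (h j) z\<bar> \<le> (\<Sum>j<s. \<bar>c j * q (h j) z\<bar>)" by (rule sum_abs)
    also have "\<dots> \<le> (\<Sum>j<s. c j * M)"
      using h(1) M z by (intro sum_mono) (auto simp: abs_mult intro!: mult_left_mono)
    also have "\<dots> = (\<Sum>j<s. c j) * M" by (simp add: sum_distrib_right)
    also have "\<dots> \<le> (lam * \<delta>) * M"
      using h(3) mult_left_mono[OF y(2) lam(1)] M0 by (intro mult_right_mono) auto
    also have "\<dots> \<le> 1 / 20 * M" using lam(2) M0 by (intro mult_right_mono) auto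
    finally have "\<bar>q x z\<bar> \<le> \<bar>q y z\<bar> + M / 20" unfolding q_decomp[OF h(2)] by linarith
    then show ?thesis using y(1) by blast
  qed
  have "\<bar>q x z\<bar> \<le> t + M / 10" if "x \<in> Z" "z \<in> Z" for x z
  proof -
    obtain y where y: "y \<in> N" "\<bar>q x z\<bar> \<le> \<bar>q y z\<bar> + M / 20" using step[OF \<open>x \<in> Z\<close> \<open>z \<in> Z\<close>] by blast
    then have "y \<in> Z" using N(1) by blast
    from step[OF \<open>z \<in> Z\<close> this] obtain y' where y': "y' \<in> N" "\<bar>q z y\<bar> \<le> \<bar>q y' y\<bar> + M / 20" by blast
    have "\<bar>q y' y\<bar> \<le> t" using t y y' by blast
    then show ?thesis using y(2) y'(2) unfolding q_sym[of z y] by linarith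
  qed
  then have "M \<le> t + M / 10" unfolding M_def using x by (intro cSUP_least) auto
  then show ?thesis using M[OF x x] by linarith
qed

text \<open>The squared lengths of z + z' and z - z' add up to 4 by the parallelogram law, matching
  the 4 of the polarization identity; the bound t therefore passes from the quadratic to the
  bilinear form without loss.\<close>

lemma ip_polarization_bound:
  fixes d :: nat and G :: "nat \<Rightarrow> nat \<Rightarrow> real" and z z' :: "nat \<Rightarrow> real" and t :: real
  defines "q \<equiv> \<lambda>x z. ip {..<d} x (\<lambda>i. ip {..<d} (G i) z)"
  assumes sym: "\<And>i l. G i l = G l i"
    and unit: "ip {..<d} z z = 1" "ip {..<d} z' z' = 1"
    and t: "\<And>w. w = (\<lambda>i. z i + z' i) \<or> w = (\<lambda>i. z i - z' i) \<Longrightarrow> \<bar>q w w\<bar> \<le> t * ip {..<d} w w"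
  shows "\<bar>q z z'\<bar> \<le> t"
proof -
  let ?p = "\<lambda>i. z i + z' i" and ?m = "\<lambda>i. z i - z' i"
  have q_sym: "q z' z = q z z'"
    unfolding q_def using sym by (rule ip_symmetric_form)
  have "q ?p ?p - q ?m ?m = 2 * q z z' + 2 * q z' z"
    unfolding q_def ip_lin(1,2) ip_diff by simp
  moreover have "ip {..<d} ?p ?p + ip {..<d} ?m ?m = 4"
    unfolding ip_lin(1,2) ip_diff using unit by simp
  then have "t * ip {..<d} ?p ?p + t * ip {..<d} ?m ?m = 4 * t"
    by (simp flip: distrib_left)
  moreover have "\<bar>q ?p ?p\<bar> \<le> t * ip {..<d} ?p ?p" "\<bar>q ?m ?m\<bar> \<le> t * ip {..<d} ?m ?m"
    by (rule t, simp)+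
  ultimately show ?thesis unfolding q_sym by linarith
qed

section \<open>The random map in coordinates\<close>

lemma avg_Times: "avg (X \<times> Y) f = avg X (\<lambda>x. avg Y (\<lambda>y. f (x, y)))"
  by (simp add: avg_def sum.cartesian_product' card_cartesian_product sum_divide_distrib[symmetric])

lemma prob_pmf_of_set_avg:
  assumes "finite X" "X \<noteq> {}"
  shows "measure_pmf.prob (pmf_of_set X) E = avg X (\<lambda>x. of_bool (x \<in> E))"
  using assms by (simp add: measure_pmf_of_set avg_def of_bool_def sum.If_cases Int_def)

lemma pair_pmf_of_set_Times:
  assumes "finite X" "X \<noteq> {}" "finite Y" "Y \<noteq> {}"
  shows "pair_pmf (pmf_of_set X) (pmf_of_set Y) = pmf_of_set (X \<times> Y)"
proof (rule pmf_eqI)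
  fix t :: "'a \<times> 'b"
  obtain a b where t: "t = (a, b)" by (cases t)
  have "X \<times> Y \<noteq> {}" "finite (X \<times> Y)" using assms by auto
  then show "pmf (pair_pmf (pmf_of_set X) (pmf_of_set Y)) t = pmf (pmf_of_set (X \<times> Y)) t"
    unfolding t pmf_pair pmf_of_set[OF assms(2,1)] pmf_of_set[OF assms(4,3)] pmf_of_set[of "X \<times> Y"]
    by (simp add: card_cartesian_product indicator_def)
qed

lemma prob_randomness:
  "measure_pmf.prob (randomness d) E =
    avg (sign_vectors {..<d}) (\<lambda>\<xi>. avg {\<pi>. \<pi> permutes {..<d}} (\<lambda>\<pi>. avg (sign_vectors {..<d})
      (\<lambda>\<xi>'. of_bool ((\<xi>, \<pi>, \<xi>') \<in> E))))"
proof -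
  have V: "finite (sign_vectors {..<d})" "sign_vectors {..<d} \<noteq> {}"
    by (auto simp: finite_sign_vectors sign_vectors_nonempty)
  have P: "finite {\<pi>. \<pi> permutes {..<d}}" "{\<pi>. \<pi> permutes {..<d}} \<noteq> {}"
    using finite_permutations[of "{..<d}"] permutes_id by blast+
  have "randomness d = pmf_of_set (sign_vectors {..<d} \<times> {\<pi>. \<pi> permutes {..<d}} \<times> sign_vectors {..<d})"
    unfolding randomness_def uniform_signs_def uniform_permutation_def sign_vectors_def[symmetric]
    using V P by (simp add: pair_pmf_of_set_Times)
  then show ?thesis using V P by (simp add: prob_pmf_of_set_avg avg_Times)
qed

lemma scalar_prod_ip:
  "y \<in> carrier_vec d \<Longrightarrow> x \<bullet> y = ip {..<d} (vec_index x) (vec_index y)"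
  by (simp add: scalar_prod_def ip_def atLeast0LessThan)

lemma norm2_power2: "x \<in> carrier_vec d \<Longrightarrow> (norm2 x)\<^sup>2 = ip {..<d} (vec_index x) (vec_index x)"
  by (simp add: norm2_def scalar_prod_ip ip_nonneg)

lemma norm2_nonneg: "0 \<le> norm2 x"
  by (simp add: norm2_def scalar_prod_def sum_nonneg)

definition rotated :: "nat \<Rightarrow> real mat \<Rightarrow> (nat \<Rightarrow> real) \<Rightarrow> (nat \<Rightarrow> real) \<Rightarrow> nat \<Rightarrow> real" where
  "rotated d B \<xi>' x k = (\<Sum>l<d. \<xi>' l * (B $$ (k, l) * x l))"

text \<open>The image before restriction and scaling, written as a signed sum of columns of A so
  that the chaos estimates apply in the signs \<xi>.\<close>

definition rows_out ::
  "nat \<Rightarrow> real mat \<Rightarrow> real mat \<Rightarrow> (nat \<Rightarrow> real) \<Rightarrow> (nat \<Rightarrow> nat) \<Rightarrow> (nat \<Rightarrow> real) \<Rightarrow> (nat \<Rightarrow> real) \<Rightarrow> nat \<Rightarrow> real" where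
  "rows_out d A B \<xi> p \<xi>' x = sign_sum (\<lambda>k j. rotated d B \<xi>' x (p k) * A $$ (j, k)) {..<d} \<xi>"

text \<open>The factors are applied one at a time from the right. The order in which the restriction
  lists I disappears in the sum of squares.\<close>

lemma norm2_random_map:
  assumes A: "A \<in> carrier_mat d d" and B: "B \<in> carrier_mat d d" and I: "I \<subseteq> {..<d}"
    and p: "p permutes {..<d}" and x: "x \<in> carrier_vec d"
  shows "(norm2 (random_map d I A B \<xi> p \<xi>' *\<^sub>v x))\<^sup>2 = real d / real (card I) *
    ip I (rows_out d A B \<xi> p \<xi>' (vec_index x)) (rows_out d A B \<xi> p \<xi>' (vec_index x))"
proof -
  let ?R = "restriction_mat d I" and ?P = "permutation_mat d p"
  let ?m = "card I" and ?l = "sorted_list_of_set I" and ?s = "sqrt (real d / real (card I))"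
  let ?y = "rows_out d A B \<xi> p \<xi>' (vec_index x)"
  have fI: "finite I" using I finite_subset by blast
  have carr: "?R \<in> carrier_mat ?m d" "?P \<in> carrier_mat d d" "mat_diag d \<xi> \<in> carrier_mat d d"
    "mat_diag d \<xi>' \<in> carrier_mat d d"
    by (auto simp: restriction_mat_def permutation_mat_def)
  have pd: "p k < d" if "k < d" for k using p that by (metis lessThan_iff permutes_in_image)
  have mv: "(M *\<^sub>v z) $ i = (\<Sum>j<d. M $$ (i, j) * z $ j)"
    if "M \<in> carrier_mat n d" "z \<in> carrier_vec d" "i < n" for M :: "real mat" and z n i
    using that by (auto simp: scalar_prod_def atLeast0LessThan intro!: sum.cong)
  have diag: "(mat_diag d f *\<^sub>v z) $ i = f i * z $ i" if "z \<in> carrier_vec d" "i < d" for f :: "nat \<Rightarrow> real" and z i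
  proof -
    have eq: "(mat_diag d f *\<^sub>v z) $ i = (\<Sum>j<d. if i = j then f j * z $ j else 0)"
      unfolding mv[OF mat_diag_dim that] by (intro sum.cong refl) (use that in \<open>simp add: mat_diag_def\<close>)
    show ?thesis unfolding eq using that by simp
  qed
  have perm: "(?P *\<^sub>v z) $ k = z $ p k" if "z \<in> carrier_vec d" "k < d" for z k
  proof -
    have eq: "(?P *\<^sub>v z) $ k = (\<Sum>j<d. if p k = j then z $ j else 0)"
      unfolding mv[OF carr(2) that] by (intro sum.cong refl) (use that in \<open>auto simp: permutation_mat_def\<close>)
    show ?thesis unfolding eq using pd[OF that(2)] by simp
  qed
  have len: "length ?l = ?m" "set ?l = I" "distinct ?l" using fI by auto
  have nth: "?l ! i \<in> I" if "i < ?m" for i using len that by (metis nth_mem)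
  have restr: "(?R *\<^sub>v z) $ i = z $ (?l ! i)" if "z \<in> carrier_vec d" "i < ?m" for z i
  proof -
    have eq: "(?R *\<^sub>v z) $ i = (\<Sum>j<d. if ?l ! i = j then z $ j else 0)"
      unfolding mv[OF carr(1) that] by (intro sum.cong refl) (use that in \<open>auto simp: restriction_mat_def\<close>)
    show ?thesis unfolding eq using nth[OF that(2)] I by auto
  qed
  define v0 where "v0 = mat_diag d \<xi>' *\<^sub>v x"
  define v1 where "v1 = B *\<^sub>v v0"
  define v2 where "v2 = ?P *\<^sub>v v1"
  define v3 where "v3 = mat_diag d \<xi> *\<^sub>v v2"
  define v4 where "v4 = A *\<^sub>v v3"
  have c0: "v0 \<in> carrier_vec d" unfolding v0_def using carr(4) x by (rule mult_mat_vec_carrier)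
  have c1: "v1 \<in> carrier_vec d" unfolding v1_def using B c0 by (rule mult_mat_vec_carrier)
  have c2: "v2 \<in> carrier_vec d" unfolding v2_def using carr(2) c1 by (rule mult_mat_vec_carrier)
  have c3: "v3 \<in> carrier_vec d" unfolding v3_def using carr(3) c2 by (rule mult_mat_vec_carrier)
  have c4: "v4 \<in> carrier_vec d" unfolding v4_def using A c3 by (rule mult_mat_vec_carrier)
  have v1: "v1 $ k = rotated d B \<xi>' (vec_index x) k" if "k < d" for k
    unfolding v1_def mv[OF B c0 that] rotated_def
    by (intro sum.cong refl) (simp add: v0_def diag[OF x] mult_ac)
  have v2: "v2 $ k = v1 $ p k" if "k < d" for k
    unfolding v2_def by (rule perm[OF c1 that])
  have v3: "v3 $ k = \<xi> k * v2 $ k" if "k < d" for k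
    unfolding v3_def by (rule diag[OF c2 that])
  have v4: "v4 $ j = ?y j" if "j < d" for j
    unfolding v4_def mv[OF A c3 that] rows_out_def sign_sum_def
    by (intro sum.cong refl) (simp add: v3 v2 v1 pd mult_ac)
  have RA: "?R * A \<in> carrier_mat ?m d" using carr A by simp
  have RAD: "?R * A * mat_diag d \<xi> \<in> carrier_mat ?m d" using RA carr by simp
  have RADP: "?R * A * mat_diag d \<xi> * ?P \<in> carrier_mat ?m d" using RAD carr by simp
  have RADPB: "?R * A * mat_diag d \<xi> * ?P * B \<in> carrier_mat ?m d" using RADP B by simp
  have RADPBD: "?R * A * mat_diag d \<xi> * ?P * B * mat_diag d \<xi>' \<in> carrier_mat ?m d" using RADPB carr by simp
  have prod: "(?R * A * mat_diag d \<xi> * ?P * B * mat_diag d \<xi>') *\<^sub>v x = ?R *\<^sub>v v4"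
    by (simp only: assoc_mult_mat_vec[OF RADPB carr(4) x] assoc_mult_mat_vec[OF RADP B c0]
        assoc_mult_mat_vec[OF RAD carr(2) c1] assoc_mult_mat_vec[OF RA carr(3) c2]
        assoc_mult_mat_vec[OF carr(1) A c3] v0_def[symmetric] v1_def[symmetric] v2_def[symmetric]
        v3_def[symmetric] v4_def[symmetric])
  have out: "random_map d I A B \<xi> p \<xi>' *\<^sub>v x = ?s \<cdot>\<^sub>v (?R *\<^sub>v v4)"
  proof -
    have "(?s \<cdot>\<^sub>m M) *\<^sub>v x = ?s \<cdot>\<^sub>v (M *\<^sub>v x)" if "M \<in> carrier_mat ?m d" for M
      using that x by (intro eq_vecI) (auto simp: scalar_prod_def sum_distrib_left mult_ac)
    from this[OF RADPBD] show ?thesis unfolding random_map_def prod .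
  qed
  have carr_out: "?s \<cdot>\<^sub>v (?R *\<^sub>v v4) \<in> carrier_vec ?m" using carr(1) c4 by simp
  have idx: "(?s \<cdot>\<^sub>v (?R *\<^sub>v v4)) $ i = ?s * ?y (?l ! i)" if "i < ?m" for i
    using that carr(1) restr[OF c4 that] v4 nth[OF that] I by auto
  have "(norm2 (random_map d I A B \<xi> p \<xi>' *\<^sub>v x))\<^sup>2 = (\<Sum>i<?m. (?s * ?y (?l ! i)) * (?s * ?y (?l ! i)))"
    unfolding out norm2_power2[OF carr_out] ip_def using idx by (intro sum.cong) auto
  also have "\<dots> = (\<Sum>j\<in>I. (?s * ?y j) * (?s * ?y j))"
    using len by (intro sum.reindex_bij_betw bij_betw_nth) auto
  also have "\<dots> = (?s * ?s) * ip I ?y ?y"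
    unfolding ip_def sum_distrib_left by (intro sum.cong refl) (simp only: mult_ac)
  also have "?s * ?s = real d / real ?m" by simp
  finally show ?thesis .
qed

lemma orthogonal_group_carrier: "A \<in> orthogonal_group d \<Longrightarrow> A \<in> carrier_mat d d"
  by (simp add: orthogonal_group_def)

lemma orthogonal_group_columns:
  assumes "A \<in> orthogonal_group d" "i < d" "l < d"
  shows "(\<Sum>k<d. A $$ (k, i) * A $$ (k, l)) = of_bool (i = l)"
proof -
  have A: "A \<in> carrier_mat d d" "transpose_mat A * A = 1\<^sub>m d" using assms(1) by (auto simp: orthogonal_group_def)
  have "(transpose_mat A * A) $$ (i, l) = (\<Sum>k<d. A $$ (k, i) * A $$ (k, l))"
    using A(1) assms(2,3) by (simp add: scalar_prod_def atLeast0LessThan)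
  moreover have "1\<^sub>m d $$ (i, l) = (of_bool (i = l) :: real)" using assms(2,3) by simp
  ultimately show ?thesis unfolding A(2) by (simp only:)
qed

text \<open>For square matrices a left inverse is a right inverse, which turns orthonormal columns
  into orthonormal rows.\<close>

lemma orthogonal_group_rows:
  assumes "A \<in> orthogonal_group d" "i < d" "l < d"
  shows "(\<Sum>k<d. A $$ (i, k) * A $$ (l, k)) = of_bool (i = l)"
proof -
  have A: "A \<in> carrier_mat d d" "transpose_mat A * A = 1\<^sub>m d" using assms(1) by (auto simp: orthogonal_group_def)
  have AT: "A * transpose_mat A = 1\<^sub>m d"
    by (rule mat_mult_left_right_inverse[OF transpose_carrier_mat[THEN iffD2, OF A(1)] A])
  have "(A * transpose_mat A) $$ (i, l) = row A i \<bullet> row A l"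
    using A(1) assms(2,3) by (subst index_mult_mat(1)) auto
  also have "\<dots> = (\<Sum>k<d. A $$ (i, k) * A $$ (l, k))"
    unfolding scalar_prod_def using A(1) assms(2,3) by (intro sum.cong) auto
  finally have "(A * transpose_mat A) $$ (i, l) = (\<Sum>k<d. A $$ (i, k) * A $$ (l, k))" .
  moreover have "1\<^sub>m d $$ (i, l) = (of_bool (i = l) :: real)" using assms(2,3) by simp
  ultimately show ?thesis unfolding AT by (simp only:)
qed

text \<open>Parseval for orthonormal columns. It serves twice: B preserves lengths, and the rows of
  A in I, being orthonormal, make the restricted columns of A a Parseval frame.\<close>

lemma sum_orthonormal:
  fixes M :: "'a \<Rightarrow> 'b \<Rightarrow> real"
  assumes "finite J" and orth: "\<And>i l. i \<in> J \<Longrightarrow> l \<in> J \<Longrightarrow> (\<Sum>k\<in>S. M k i * M k l) = of_bool (i = l)"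
  shows "(\<Sum>k\<in>S. ip J (M k) x * ip J (M k) y) = ip J x y"
proof -
  have "(\<Sum>k\<in>S. ip J (M k) x * ip J (M k) y) =
      (\<Sum>k\<in>S. \<Sum>i\<in>J. \<Sum>l\<in>J. (x i * y l) * (M k i * M k l))"
    by (simp add: ip_def sum_product mult_ac)
  also have "\<dots> = (\<Sum>i\<in>J. \<Sum>k\<in>S. \<Sum>l\<in>J. (x i * y l) * (M k i * M k l))" by (rule sum.swap)
  also have "\<dots> = (\<Sum>i\<in>J. \<Sum>l\<in>J. \<Sum>k\<in>S. (x i * y l) * (M k i * M k l))"
    by (intro sum.cong refl sum.swap)
  also have "\<dots> = (\<Sum>i\<in>J. \<Sum>l\<in>J. (x i * y l) * of_bool (i = l))"
    by (intro sum.cong refl) (simp only: sum_distrib_left[symmetric] orth)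
  also have "\<dots> = ip J x y"
    unfolding ip_def
  proof (intro sum.cong refl)
    fix i assume i: "i \<in> J"
    have "(\<Sum>l\<in>J. (x i * y l) * of_bool (i = l)) = (\<Sum>l\<in>J. if i = l then x i * y l else 0)"
      by (intro sum.cong) auto
    also have "\<dots> = x i * y i" using assms(1) i by (simp only: sum.delta' if_True)
    finally show "(\<Sum>l\<in>J. (x i * y l) * of_bool (i = l)) = x i * y i" .
  qed
  finally show ?thesis .
qed

lemma sum_rotated_power2:
  assumes B: "B \<in> orthogonal_group d" and xi: "\<xi>' \<in> sign_vectors {..<d}"
  shows "(\<Sum>k<d. (rotated d B \<xi>' x k)\<^sup>2) = ip {..<d} x x"
proof -
  have "rotated d B \<xi>' x k = ip {..<d} (\<lambda>l. B $$ (k, l)) (\<lambda>l. \<xi>' l * x l)" for k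
    unfolding rotated_def ip_def by (intro sum.cong refl mult.left_commute)
  then have "(\<Sum>k<d. (rotated d B \<xi>' x k)\<^sup>2) = ip {..<d} (\<lambda>l. \<xi>' l * x l) (\<lambda>l. \<xi>' l * x l)"
    unfolding power2_eq_square
    by (simp only:) (rule sum_orthonormal, auto simp only: finite_lessThan lessThan_iff orthogonal_group_columns[OF B])
  also have "\<dots> = ip {..<d} x x"
    unfolding ip_def
  proof (intro sum.cong refl)
    fix l assume "l \<in> {..<d}"
    then have "\<xi>' l * \<xi>' l = 1" using sign_vectors_square[OF xi] by blast
    then have "(\<xi>' l * \<xi>' l) * (x l * x l) = x l * x l" by simp
    then show "\<xi>' l * x l * (\<xi>' l * x l) = x l * x l" by (simp only: mult_ac)
  qed
  finally show ?thesis .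
qed

text \<open>Hoeffding's inequality in each coordinate of the rotated vector; the term ln d in the
  level pays for the union bound over coordinates.\<close>

lemma avg_rotated_not_flat_le:
  assumes d: "0 < d" and V: "0 < V" "\<And>k. k < d \<Longrightarrow> (\<Sum>l<d. (B $$ (k, l) * x l)\<^sup>2) \<le> V" and a: "0 \<le> a"
  shows "avg (sign_vectors {..<d}) (\<lambda>\<xi>'. of_bool (\<exists>k\<in>{..<d}. 2 * V * (a + ln (real d)) < (rotated d B \<xi>' x k)\<^sup>2)) \<le>
    2 * exp (- a)"
proof -
  let ?far = "\<lambda>k \<xi>'. 2 * V * (a + ln (real d)) < (rotated d B \<xi>' x k)\<^sup>2"
  define t where "t = sqrt (2 * V * (a + ln (real d)))"
  have "0 \<le> ln (real d)" using d by (intro ln_ge_zero) auto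
  then have t: "0 \<le> t" "t\<^sup>2 = 2 * V * (a + ln (real d))" using V(1) a by (auto simp: t_def)
  have "avg (sign_vectors {..<d}) (\<lambda>\<xi>'. of_bool (\<exists>k\<in>{..<d}. ?far k \<xi>')) \<le>
      (\<Sum>k\<in>{..<d}. avg (sign_vectors {..<d}) (\<lambda>\<xi>'. of_bool (?far k \<xi>')))"
    by (intro avg_union_bound) auto
  also have "\<dots> \<le> (\<Sum>k\<in>{..<d}. 2 * exp (- a) / real d)"
  proof (rule sum_mono)
    fix k assume k: "k \<in> {..<d}"
    have "avg (sign_vectors {..<d}) (\<lambda>\<xi>'. of_bool (?far k \<xi>')) \<le>
        avg (sign_vectors {..<d}) (\<lambda>\<xi>'. of_bool (t \<le> \<bar>\<Sum>l<d. \<xi>' l * (B $$ (k, l) * x l)\<bar>))"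
    proof (rule avg_of_bool_mono)
      fix \<xi>' assume "?far k \<xi>'"
      then have "t\<^sup>2 \<le> \<bar>rotated d B \<xi>' x k\<bar>\<^sup>2" unfolding t(2) by simp
      then show "t \<le> \<bar>\<Sum>l<d. \<xi>' l * (B $$ (k, l) * x l)\<bar>"
        unfolding rotated_def by (rule power2_le_imp_le) simp
    qed
    also have "\<dots> \<le> 2 * exp (- t\<^sup>2 / (2 * V))"
      using t(1) V k by (intro avg_sign_vectors_tail) auto
    also have "- t\<^sup>2 / (2 * V) = - a + - ln (real d)" unfolding t(2) using V(1) by simp
    also have "2 * exp (- a + - ln (real d)) = 2 * exp (- a) / real d"
    proof -
      have "exp (- ln (real d)) = inverse (real d)" using d by (simp add: exp_minus)
      then show ?thesis by (simp only: exp_add divide_inverse mult.assoc)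
    qed
    finally show "avg (sign_vectors {..<d}) (\<lambda>\<xi>'. of_bool (?far k \<xi>')) \<le>
        2 * exp (- a) / real d" .
  qed
  also have "\<dots> = 2 * exp (- a)" using d by simp
  finally show ?thesis .
qed

text \<open>Flatness of the rotated vector depends on \<xi>' alone, so the averages are reordered
  with \<xi>' outermost. Failure of flatness adds 2 to the 6 multiples of exp (- a) from the flat
  case.\<close>

lemma avg_random_map_fixed_vector_le:
  assumes d: "0 < d" and A: "A \<in> orthogonal_group d" and B: "B \<in> orthogonal_group d"
    and I: "I \<subseteq> {..<d}" and m: "card I = m"
    and x: "x \<in> carrier_vec d" "norm2 x = 1"
    and V: "0 < V" "\<And>k. k < d \<Longrightarrow> (\<Sum>l<d. (B $$ (k, l))\<^sup>2 * (x $ l)\<^sup>2) \<le> V"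
    and cond: "36 * kappa d I A * V * real m * (a + ln (real d)) * (a + ln (real m)) \<le> 1"
    and a: "3 \<le> a" and \<epsilon>: "0 < \<epsilon>" "\<epsilon> < 1" and m_ge: "2025 * a \<le> \<epsilon>\<^sup>2 * real m"
  shows "avg (sign_vectors {..<d}) (\<lambda>\<xi>. avg {\<pi>. \<pi> permutes {..<d}} (\<lambda>\<pi>. avg (sign_vectors {..<d})
      (\<lambda>\<xi>'. of_bool (9 / 10 * \<epsilon> < \<bar>(norm2 (random_map d I A B \<xi> \<pi> \<xi>' *\<^sub>v x))\<^sup>2 - 1\<bar>)))) \<le> 8 * exp (- a)"
proof -
  let ?V = "sign_vectors {..<d}" and ?P = "{\<pi>. \<pi> permutes {..<d}}"
  let ?x = "vec_index x"
  have "id \<in> ?P" by (simp add: permutes_id)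
  then have fin: "finite ?V" "?V \<noteq> {}" "finite ?P" "?P \<noteq> {}"
    using finite_permutations[of "{..<d}"] by (auto simp only: finite_sign_vectors sign_vectors_nonempty finite_lessThan)
  have fI: "finite I" using I finite_subset by blast
  have unit: "ip {..<d} ?x ?x = 1" using norm2_power2[OF x(1)] x(2) by simp
  define u where "u k j = A $$ (j, k)" for k j
  have u: "parseval I {..<d} u"
    unfolding parseval_def u_def
    by (intro allI sum_orthonormal fI orthogonal_group_rows[OF A]) (use I in auto)
  have u_trace: "(\<Sum>k<d. ip I (u k) (u k)) = real m"
  proof -
    have "(\<Sum>k<d. ip I (u k) (u k)) = (\<Sum>j\<in>I. \<Sum>k<d. A $$ (j, k) * A $$ (j, k))"
      unfolding ip_def u_def by (rule sum.swap)
    also have "\<dots> = (\<Sum>j\<in>I. 1)" using I orthogonal_group_rows[OF A] by (intro sum.cong) auto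
    finally show ?thesis using m by simp
  qed
  have \<kappa>: "real d / real m * ip I (u k) (u k) \<le> kappa d I A" if "k < d" for k
    unfolding kappa_def m using that
    by (intro mult_left_mono Max_ge) (auto simp: ip_def u_def power2_eq_square)
  define dev where "dev \<xi> \<pi> \<xi>' \<longleftrightarrow> 9 / 10 * \<epsilon> < \<bar>(norm2 (random_map d I A B \<xi> \<pi> \<xi>' *\<^sub>v x))\<^sup>2 - 1\<bar>" for \<xi> \<pi> \<xi>'
  \<comment> \<open>The 2 here and the 18 of the flat estimate multiply to the 36 in the
    hypothesis.\<close>
  define b where "b = 2 * V * (a + ln (real d))"
  define bad where "bad \<xi>' \<longleftrightarrow> (\<exists>k\<in>{..<d}. b < (rotated d B \<xi>' ?x k)\<^sup>2)" for \<xi>'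
  have inner: "avg ?P (\<lambda>\<pi>. avg ?V (\<lambda>\<xi>. of_bool (dev \<xi> \<pi> \<xi>'))) \<le> of_bool (bad \<xi>') + 6 * exp (- a)"
    if xi': "\<xi>' \<in> ?V" for \<xi>'
  proof (cases "bad \<xi>'")
    case True
    have "avg ?P (\<lambda>\<pi>. avg ?V (\<lambda>\<xi>. of_bool (dev \<xi> \<pi> \<xi>'))) \<le> avg ?P (\<lambda>\<pi>. avg ?V (\<lambda>\<xi>. 1))"
      by (intro avg_mono) auto
    also have "\<dots> = 1" using fin by (simp add: avg_const)
    also have "1 \<le> of_bool (bad \<xi>') + 6 * exp (- a)" using True by simp
    finally show ?thesis .
  next
    case False
    let ?v = "rotated d B \<xi>' ?x"
    have "avg ?P (\<lambda>\<pi>. avg ?V (\<lambda>\<xi>. of_bool (dev \<xi> \<pi> \<xi>'))) =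
        avg ?P (\<lambda>\<pi>. avg ?V (\<lambda>\<xi>. of_bool (9 / 10 * \<epsilon> < \<bar>real d / real m *
          ip I (sign_sum (\<lambda>k j. ?v (\<pi> k) * u k j) {..<d} \<xi>) (sign_sum (\<lambda>k j. ?v (\<pi> k) * u k j) {..<d} \<xi>) - 1\<bar>)))"
    proof (intro avg_cong)
      fix \<pi> \<xi> assume "\<pi> \<in> ?P"
      then have "\<pi> permutes {..<d}" by simp
      from norm2_random_map[OF orthogonal_group_carrier[OF A] orthogonal_group_carrier[OF B] I this x(1)]
      show "of_bool (dev \<xi> \<pi> \<xi>') = (of_bool (9 / 10 * \<epsilon> < \<bar>real d / real m *
          ip I (sign_sum (\<lambda>k j. ?v (\<pi> k) * u k j) {..<d} \<xi>) (sign_sum (\<lambda>k j. ?v (\<pi> k) * u k j) {..<d} \<xi>) - 1\<bar>) :: real)"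
        unfolding dev_def rows_out_def u_def m by (simp only:)
    qed
    also have "\<dots> \<le> 6 * exp (- a)"
    proof (rule avg_near_isometry_flat_le[OF d u u_trace \<kappa>])
      show "(\<Sum>k<d. (?v k)\<^sup>2) = 1" using sum_rotated_power2[OF B xi'] unit by simp
      show "(?v k)\<^sup>2 \<le> b" if "k < d" for k using False that by (auto simp: bad_def not_less)
      show "kappa d I A * b * (18 * real m * (a + ln (real m))) \<le> 1"
      proof -
        have *: "k * (2 * V * X) * (18 * real m * Y) = 36 * k * V * real m * X * Y" for k X Y by simp
        show ?thesis unfolding b_def * using cond .
      qed
    qed (use a \<epsilon> m_ge in auto)
    finally show ?thesis using False by simp
  qed
  have "avg ?V (\<lambda>\<xi>. avg ?P (\<lambda>\<pi>. avg ?V (\<lambda>\<xi>'. of_bool (dev \<xi> \<pi> \<xi>')))) =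
      avg ?V (\<lambda>\<xi>. avg ?V (\<lambda>\<xi>'. avg ?P (\<lambda>\<pi>. of_bool (dev \<xi> \<pi> \<xi>'))))"
    by (rule avg_cong) (rule avg_swap)
  also have "\<dots> = avg ?V (\<lambda>\<xi>'. avg ?V (\<lambda>\<xi>. avg ?P (\<lambda>\<pi>. of_bool (dev \<xi> \<pi> \<xi>'))))"
    by (rule avg_swap)
  also have "\<dots> = avg ?V (\<lambda>\<xi>'. avg ?P (\<lambda>\<pi>. avg ?V (\<lambda>\<xi>. of_bool (dev \<xi> \<pi> \<xi>'))))"
    by (rule avg_cong) (rule avg_swap)
  also have "\<dots> \<le> avg ?V (\<lambda>\<xi>'. of_bool (bad \<xi>') + 6 * exp (- a))"
    by (intro avg_mono inner)
  also have "\<dots> = avg ?V (\<lambda>\<xi>'. of_bool (bad \<xi>')) + 6 * exp (- a)"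
    unfolding avg_add avg_const[OF fin(1,2)] ..
  also have "\<dots> \<le> 2 * exp (- a) + 6 * exp (- a)"
    unfolding bad_def b_def using V(2) a
    by (intro add_right_mono avg_rotated_not_flat_le[OF d V(1)]) (auto simp: power_mult_distrib)
  finally show ?thesis by (simp add: dev_def)
qed

section \<open>Norms, spheres and secants of balanced cones\<close>

lemma ip_cong: "(\<And>i. i \<in> I \<Longrightarrow> x i = x' i) \<Longrightarrow> (\<And>i. i \<in> I \<Longrightarrow> y i = y' i) \<Longrightarrow> ip I x y = ip I x' y'"
  by (auto simp: ip_def intro: sum.cong)

lemma norm2_smult: "x \<in> carrier_vec d \<Longrightarrow> norm2 (c \<cdot>\<^sub>v x) = \<bar>c\<bar> * norm2 x"
proof -
  assume x: "x \<in> carrier_vec d"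
  have "(norm2 (c \<cdot>\<^sub>v x))\<^sup>2 = ip {..<d} (\<lambda>i. c * x $ i) (\<lambda>i. c * x $ i)"
    using x by (subst norm2_power2[of _ d]) (auto intro!: ip_cong)
  also have "\<dots> = (c * c) * ip {..<d} (vec_index x) (vec_index x)" by (simp only: ip_lin mult.assoc)
  also have "\<dots> = (\<bar>c\<bar> * norm2 x)\<^sup>2"
    unfolding norm2_power2[OF x, symmetric] by (simp add: power2_eq_square)
  finally show ?thesis by (rule power2_eq_imp_eq) (auto simp: norm2_nonneg)
qed

lemma norm2_minus:
  assumes "x \<in> carrier_vec d" "y \<in> carrier_vec d"
  shows "norm2 (x - y) = sqrt (sqdist d (vec_index x) (vec_index y))"
proof -
  have "(norm2 (x - y))\<^sup>2 = sqdist d (vec_index x) (vec_index y)"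
    using assms by (subst norm2_power2[of _ d]) (auto intro!: ip_cong)
  then show ?thesis by (metis norm2_nonneg real_sqrt_unique)
qed

lemma norm2_eq_0_imp:
  assumes x: "x \<in> carrier_vec d" "norm2 x = 0"
  shows "x = 0\<^sub>v d"
proof (rule eq_vecI)
  fix i assume "i < dim_vec (0\<^sub>v d :: real vec)"
  then have i: "i < d" by simp
  have "x $ i * x $ i \<le> ip {..<d} (vec_index x) (vec_index x)"
    unfolding ip_def using i by (intro member_le_sum) auto
  then have "x $ i * x $ i \<le> 0" using norm2_power2[OF x(1)] x(2) by simp
  then show "x $ i = (0\<^sub>v d :: real vec) $ i" using i by (auto simp: mult_le_0_iff)
qed (use x in auto)

lemma norm2_minus_neq_0:
  assumes x: "x \<in> carrier_vec d" and y: "y \<in> carrier_vec d" and "x \<noteq> y"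
  shows "norm2 (x - y) \<noteq> 0"
proof
  assume "norm2 (x - y) = 0"
  then have z: "x - y = 0\<^sub>v d" using norm2_eq_0_imp[of "x - y" d] x y by simp
  have "x = y"
  proof (rule eq_vecI)
    fix i assume "i < dim_vec y"
    then have i: "i < d" using y by simp
    have "(x - y) $ i = 0" unfolding z using i by simp
    then show "x $ i = y $ i" using x y i by simp
  qed (use x y in simp)
  then show False using assms(3) by simp
qed

lemma cone_sphereD:
  assumes "x \<in> cone_sphere d C"
  shows "x \<in> C" "x \<in> carrier_vec d" "norm2 x = 1" "ip {..<d} (vec_index x) (vec_index x) = 1"
proof -
  show *: "x \<in> C" "x \<in> carrier_vec d" "norm2 x = 1"
    using assms by (auto simp: cone_sphere_def unit_sphere_def)
  show "ip {..<d} (vec_index x) (vec_index x) = 1" using norm2_power2[OF *(2)] *(3) by simp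
qed

lemma balanced_coneD:
  assumes "balanced_cone d C" "x \<in> C"
  shows "x \<in> carrier_vec d" "t \<cdot>\<^sub>v x \<in> C"
  using assms by (auto simp: balanced_cone_def)

lemma normalize_in_cone_sphere:
  assumes C: "balanced_cone d C" and x: "x \<in> C" "norm2 x \<noteq> 0"
  shows "(1 / norm2 x) \<cdot>\<^sub>v x \<in> cone_sphere d C"
  using balanced_coneD[OF C x(1)] x(2) norm2_nonneg[of x]
  by (auto simp: cone_sphere_def unit_sphere_def norm2_smult)

lemma uminus_in_cone_sphere:
  assumes C: "balanced_cone d C" and x: "x \<in> cone_sphere d C"
  shows "(- 1) \<cdot>\<^sub>v x \<in> cone_sphere d C"
  using cone_sphereD[OF x] balanced_coneD(2)[OF C, of x "- 1"]
  by (auto simp: cone_sphere_def unit_sphere_def norm2_smult)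

lemma cone_sphere_nonempty:
  assumes C: "balanced_cone d C"
  shows "cone_sphere d C \<noteq> {}" "0 < d"
proof -
  obtain x where x: "x \<in> C" "x \<noteq> 0\<^sub>v d" using C by (auto simp: balanced_cone_def)
  then have "norm2 x \<noteq> 0" using norm2_eq_0_imp balanced_coneD(1)[OF C x(1)] by blast
  from normalize_in_cone_sphere[OF C x(1) this] have s: "(1 / norm2 x) \<cdot>\<^sub>v x \<in> cone_sphere d C" .
  then show "cone_sphere d C \<noteq> {}" by blast
  show "0 < d" using cone_sphereD(4)[OF s] by (cases d) (auto simp: ip_def)
qed

lemma cone_scaled_sphere:
  assumes C: "balanced_cone d C" and x: "x \<in> C"
  shows "\<exists>z\<in>cone_sphere d C. \<forall>i<d. x $ i = norm2 x * z $ i"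
proof (cases "norm2 x = 0")
  case True
  \<comment> \<open>The zero vector takes any point of the sphere with coefficient 0.\<close>
  then have "x = 0\<^sub>v d" using norm2_eq_0_imp balanced_coneD(1)[OF C x] by blast
  then show ?thesis using cone_sphere_nonempty(1)[OF C] True by auto
next
  case False
  then show ?thesis
    using balanced_coneD(1)[OF C x]
    by (intro bexI[OF _ normalize_in_cone_sphere[OF C x False]]) auto
qed

text \<open>The summands become nonnegative multiples of sphere points, the form in which a supremum
  over the sphere controls them.\<close>

lemma secant_generating_normalized:
  assumes C: "balanced_cone d C" and sec: "secant_generating d lam C"
    and x: "x \<in> cone_sphere d C" and y: "y \<in> cone_sphere d C"
  shows "\<exists>(s::nat) c h. (\<forall>j<s. h j \<in> vec_index ` cone_sphere d C \<and> 0 \<le> c j) \<and>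
    (\<forall>i<d. x $ i - y $ i = (\<Sum>j<s. c j * h j i)) \<and>
    (\<Sum>j<s. c j) \<le> lam * sqrt (sqdist d (vec_index x) (vec_index y))"
proof -
  obtain s :: nat and h where h: "\<And>j. j < s \<Longrightarrow> h j \<in> C"
    "x - y = finsum_vec TYPE(real) d h {..<s}" "(\<Sum>j<s. norm2 (h j)) \<le> lam * norm2 (x - y)"
    using sec x y unfolding secant_generating_def by blast
  have "\<forall>j. \<exists>z. j < s \<longrightarrow> z \<in> cone_sphere d C \<and> (\<forall>i<d. h j $ i = norm2 (h j) * z $ i)"
    using cone_scaled_sphere[OF C h(1)] by blast
  then obtain z where z: "\<And>j. j < s \<Longrightarrow> z j \<in> cone_sphere d C"
    "\<And>j i. j < s \<Longrightarrow> i < d \<Longrightarrow> h j $ i = norm2 (h j) * z j $ i"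
    by metis
  have "x $ i - y $ i = (\<Sum>j<s. norm2 (h j) * vec_index (z j) i)" if i: "i < d" for i
  proof -
    have "x $ i - y $ i = (x - y) $ i" using cone_sphereD(2)[OF x] cone_sphereD(2)[OF y] i by simp
    also have "\<dots> = (\<Sum>j<s. h j $ i)"
      unfolding h(2) using i h(1) balanced_coneD(1)[OF C] by (intro index_finsum_vec) auto
    finally show ?thesis using z(2) i by simp
  qed
  moreover have "(\<Sum>j<s. norm2 (h j)) \<le> lam * sqrt (sqdist d (vec_index x) (vec_index y))"
    using h(3) norm2_minus[OF cone_sphereD(2)[OF x] cone_sphereD(2)[OF y]] by simp
  ultimately show ?thesis
    using z(1) norm2_nonneg
    by (intro exI[of _ s] exI[of _ "\<lambda>j. norm2 (h j)"] exI[of _ "\<lambda>j. vec_index (z j)"]) auto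
qed

lemma near_isometry_from_secants:
  assumes A: "A \<in> carrier_mat d d" and B: "B \<in> carrier_mat d d" and I: "I \<subseteq> {..<d}" and p: "p permutes {..<d}"
    and C: "balanced_cone d C" and sec: "secant_generating d lam C" and lam: "1 \<le> lam"
    and N: "N \<subseteq> cone_sphere d C" "\<And>x. x \<in> cone_sphere d C \<Longrightarrow> \<exists>y\<in>N. norm2 (x - y) \<le> \<delta>"
    and \<delta>: "lam * \<delta> \<le> 1 / 20"
    and good: "\<And>x y. x \<in> N \<Longrightarrow> y \<in> N \<union> (\<lambda>x. (- 1) \<cdot>\<^sub>v x) ` N \<Longrightarrow> x \<noteq> y \<Longrightarrow>
      \<bar>(norm2 (random_map d I A B \<xi> p \<xi>' *\<^sub>v ((1 / norm2 (x - y)) \<cdot>\<^sub>v (x - y))))\<^sup>2 - 1\<bar> \<le> 9 / 10 * \<epsilon>"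
    and x: "x \<in> C"
  shows "\<bar>(norm2 (random_map d I A B \<xi> p \<xi>' *\<^sub>v x))\<^sup>2 - (norm2 x)\<^sup>2\<bar> \<le> \<epsilon> * (norm2 x)\<^sup>2"
proof -
  let ?\<Phi> = "random_map d I A B \<xi> p \<xi>'" and ?S = "cone_sphere d C"
  let ?r = "real d / real (card I)"
  \<comment> \<open>\<open>f i\<close> is the image of the i-th unit vector before restriction and
    scaling, so G is the Gram matrix of the map minus the identity and q its bilinear error
    form.\<close>
  define f where "f i j = (\<Sum>k<d. \<xi> k * (\<xi>' i * B $$ (p k, i) * A $$ (j, k)))" for i j
  define G where "G i l = ?r * ip I (f i) (f l) - of_bool (i = l)" for i l
  define q where "q x z = ip {..<d} x (\<lambda>i. ip {..<d} (G i) z)" for x z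
  have G_sym: "G i l = G l i" for i l
    by (simp add: G_def ip_commute[of I "f i"] eq_commute[of i])
  have rows: "rows_out d A B \<xi> p \<xi>' x = (\<lambda>j. \<Sum>i<d. x i * f i j)" for x
  proof
    fix j
    have "rows_out d A B \<xi> p \<xi>' x j = (\<Sum>k<d. \<Sum>i<d. x i * (\<xi> k * (\<xi>' i * B $$ (p k, i) * A $$ (j, k))))"
      unfolding rows_out_def sign_sum_def rotated_def sum_distrib_left sum_distrib_right
      by (intro sum.cong refl) (simp only: mult_ac)
    also have "\<dots> = (\<Sum>i<d. \<Sum>k<d. x i * (\<xi> k * (\<xi>' i * B $$ (p k, i) * A $$ (j, k))))" by (rule sum.swap)
    finally show "rows_out d A B \<xi> p \<xi>' x j = (\<Sum>i<d. x i * f i j)"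
      by (simp only: f_def sum_distrib_left)
  qed
  have q_eq: "q z z = ?r * ip I (rows_out d A B \<xi> p \<xi>' z) (rows_out d A B \<xi> p \<xi>' z) - ip {..<d} z z" for z
  proof -
    have delta: "(\<Sum>l<d. z i * (of_bool (i = l) * z l)) = z i * z i" if "i < d" for i
    proof -
      have "(\<Sum>l<d. z i * (of_bool (i = l) * z l)) = (\<Sum>l<d. if i = l then z i * z l else 0)"
        by (intro sum.cong) auto
      then show ?thesis using that by simp
    qed
    have "ip I (rows_out d A B \<xi> p \<xi>' z) (rows_out d A B \<xi> p \<xi>' z) =
        (\<Sum>i<d. \<Sum>l<d. z i * (ip I (f i) (f l) * z l))"
      unfolding rows ip_sum(1) by (simp only: ip_sum(2) ip_lin sum_distrib_left) (simp only: mult_ac)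
    moreover have "q z z = (\<Sum>i<d. \<Sum>l<d. ?r * (z i * (ip I (f i) (f l) * z l)) - z i * (of_bool (i = l) * z l))"
      unfolding q_def ip_def[of "{..<d}"] G_def sum_distrib_left
      by (intro sum.cong refl) (simp only: left_diff_distrib right_diff_distrib mult_ac)
    moreover have "ip {..<d} z z = (\<Sum>i<d. \<Sum>l<d. z i * (of_bool (i = l) * z l))"
      unfolding ip_def using delta by (intro sum.cong) auto
    ultimately show ?thesis by (simp only: sum_subtractf sum_distrib_left)
  qed
  have q_norm: "(norm2 (?\<Phi> *\<^sub>v y))\<^sup>2 - (norm2 y)\<^sup>2 = q (vec_index y) (vec_index y)"
    if "y \<in> carrier_vec d" for y
    unfolding q_eq norm2_random_map[OF A B I p that] norm2_power2[OF that] ..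
  have q_scale: "q y y = t\<^sup>2 * q z z" if "\<And>i. i < d \<Longrightarrow> y i = t * z i" for y z t
  proof -
    have "q y y = q (\<lambda>i. t * z i) (\<lambda>i. t * z i)"
      unfolding q_def using that by (intro ip_cong) auto
    also have "\<dots> = t\<^sup>2 * q z z" by (simp add: q_def ip_lin power2_eq_square)
    finally show ?thesis .
  qed
  have secant: "\<bar>q v v\<bar> \<le> 9 / 10 * \<epsilon> * ip {..<d} v v"
    if y: "y \<in> N" and y': "y' \<in> N \<union> (\<lambda>x. (- 1) \<cdot>\<^sub>v x) ` N" and v: "\<And>i. i < d \<Longrightarrow> v i = y $ i - y' $ i" for y y' v
  proof -
    have carr: "y \<in> carrier_vec d" "y' \<in> carrier_vec d"
      using y y' N(1) cone_sphereD(2) by auto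
    define s where "s = (1 / norm2 (y - y')) \<cdot>\<^sub>v (y - y')"
    have vv: "ip {..<d} v v = (norm2 (y - y'))\<^sup>2"
      using carr v by (subst norm2_power2[of _ d]) (auto intro!: ip_cong)
    show ?thesis
    proof (cases "y = y'")
      case True
      then have "q v v = 0\<^sup>2 * q v v" using v by (intro q_scale) auto
      moreover have "ip {..<d} v v = 0" using v True by (auto simp: ip_def)
      ultimately show ?thesis by simp
    next
      case False
      have ne: "norm2 (y - y') \<noteq> 0" using carr False by (rule norm2_minus_neq_0)
      have s: "s \<in> carrier_vec d" "norm2 s = 1"
        using carr ne norm2_nonneg[of "y - y'"] by (auto simp: s_def norm2_smult[of _ d])
      have "q v v = (norm2 (y - y'))\<^sup>2 * q (vec_index s) (vec_index s)"
        using v carr ne by (intro q_scale) (auto simp: s_def)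
      then have "\<bar>q v v\<bar> = \<bar>q (vec_index s) (vec_index s)\<bar> * (norm2 (y - y'))\<^sup>2"
        by (simp add: abs_mult)
      moreover have "\<bar>q (vec_index s) (vec_index s)\<bar> \<le> 9 / 10 * \<epsilon>"
        using good[OF y y' False] q_norm[OF s(1)] s(2) by (simp add: s_def)
      ultimately show ?thesis
        unfolding vv by (simp only: mult_right_mono[OF _ zero_le_power2])
    qed
  qed
  obtain z where z: "z \<in> ?S" "\<And>i. i < d \<Longrightarrow> x $ i = norm2 x * z $ i"
    using cone_scaled_sphere[OF C x] by blast
  have "\<bar>q (vec_index z) (vec_index z)\<bar> \<le> 10 / 9 * (9 / 10 * \<epsilon>)"
    unfolding q_def
  proof (rule ip_bilinear_net_bound[where Z="vec_index ` ?S" and N="vec_index ` N" and lam=lam and \<delta>=\<delta>])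
    show "G i l = G l i" for i l by (rule G_sym)
    show "\<bar>y i\<bar> \<le> 1" if "y \<in> vec_index ` ?S" "i < d" for y i
    proof -
      have "y i * y i \<le> ip {..<d} y y" unfolding ip_def using that(2) by (intro member_le_sum) auto
      also have "\<dots> = 1" using that(1) cone_sphereD(4) by auto
      finally show ?thesis by (simp add: abs_square_le_1[symmetric] power2_eq_square)
    qed
    show "vec_index ` N \<subseteq> vec_index ` ?S" using N(1) by blast
    show "\<exists>y\<in>vec_index ` N. sqrt (sqdist d z y) \<le> \<delta>" if "z \<in> vec_index ` ?S" for z
    proof -
      obtain x where x: "x \<in> ?S" "z = vec_index x" using \<open>z \<in> vec_index ` ?S\<close> by auto
      obtain y where y: "y \<in> N" "norm2 (x - y) \<le> \<delta>" using N(2)[OF x(1)] by blast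
      then show ?thesis using norm2_minus[of x d y] cone_sphereD(2) x N(1) by (intro bexI[of _ "vec_index y"]) auto
    qed
    show "\<exists>(s::nat) c h. (\<forall>j<s. h j \<in> vec_index ` ?S \<and> 0 \<le> c j) \<and>
        (\<forall>i<d. x i - y i = (\<Sum>j<s. c j * h j i)) \<and> (\<Sum>j<s. c j) \<le> lam * sqrt (sqdist d x y)"
      if "x \<in> vec_index ` ?S" "y \<in> vec_index ` ?S" for x y
      using that secant_generating_normalized[OF C sec] by blast
    show "\<bar>ip {..<d} y (\<lambda>i. ip {..<d} (G i) y')\<bar> \<le> 9 / 10 * \<epsilon>" if yy: "y \<in> vec_index ` N" "y' \<in> vec_index ` N" for y y'
    proof (rule ip_polarization_bound[OF G_sym])
      obtain v v' where v: "v \<in> N" "y = vec_index v" "v' \<in> N" "y' = vec_index v'" using yy by blast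
      then show "ip {..<d} y y = 1" "ip {..<d} y' y' = 1" using N(1) cone_sphereD(4) by auto
      have v'd: "v' \<in> carrier_vec d" using v N(1) cone_sphereD(2) by blast
      fix u assume "u = (\<lambda>i. y i + y' i) \<or> u = (\<lambda>i. y i - y' i)"
      then have "\<bar>q u u\<bar> \<le> 9 / 10 * \<epsilon> * ip {..<d} u u"
      proof
        assume "u = (\<lambda>i. y i + y' i)"
        then show ?thesis using v v'd by (intro secant[of v "(- 1) \<cdot>\<^sub>v v'"]) auto
      next
        assume "u = (\<lambda>i. y i - y' i)"
        then show ?thesis using v by (intro secant[of v v']) auto
      qed
      then show "\<bar>ip {..<d} u (\<lambda>i. ip {..<d} (G i) u)\<bar> \<le> 9 / 10 * \<epsilon> * ip {..<d} u u"
        by (simp only: q_def)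
    qed
  qed (use lam \<delta> z(1) in auto)
  then have "\<bar>q (vec_index z) (vec_index z)\<bar> \<le> \<epsilon>" by simp
  then have "(norm2 x)\<^sup>2 * \<bar>q (vec_index z) (vec_index z)\<bar> \<le> (norm2 x)\<^sup>2 * \<epsilon>"
    by (intro mult_left_mono) auto
  moreover have "q (vec_index x) (vec_index x) = (norm2 x)\<^sup>2 * q (vec_index z) (vec_index z)"
    using z(2) by (intro q_scale) auto
  ultimately show ?thesis
    unfolding q_norm[OF balanced_coneD(1)[OF C x]] by (simp add: abs_mult mult.commute)
qed

lemma cone_sphere_sudakov_net:
  assumes C: "balanced_cone d C" and \<delta>: "0 < \<delta>" "\<delta> \<le> 2"
  defines "w \<equiv> gaussian_width d (cone_sphere d C)"
  shows "3 / 2 \<le> exp (64 * w\<^sup>2)"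
    and "\<exists>N. finite N \<and> N \<subseteq> cone_sphere d C \<and> real (card N) \<le> exp (3840 * w\<^sup>2 / \<delta>\<^sup>2) \<and>
      (\<forall>x\<in>cone_sphere d C. \<exists>y\<in>N. norm2 (x - y) \<le> \<delta>)"
proof -
  let ?S = "cone_sphere d C"
  define Z :: "(nat \<Rightarrow> real) set" where "Z = vec_index ` ?S"
  have Z: "Z \<noteq> {}" "\<And>z. z \<in> Z \<Longrightarrow> ip {..<d} z z = 1" "\<And>z. z \<in> Z \<Longrightarrow> \<exists>z'\<in>Z. \<forall>i<d. z' i = - z i"
  proof -
    show "Z \<noteq> {}" using cone_sphere_nonempty(1)[OF C] by (simp add: Z_def)
    show "ip {..<d} z z = 1" if "z \<in> Z" for z using that cone_sphereD(4) by (auto simp: Z_def)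
    show "\<exists>z'\<in>Z. \<forall>i<d. z' i = - z i" if "z \<in> Z" for z
    proof -
      obtain x where x: "x \<in> ?S" "z = vec_index x" using \<open>z \<in> Z\<close> by (auto simp: Z_def)
      then show ?thesis
        using uminus_in_cone_sphere[OF C x(1)] cone_sphereD(2)[OF x(1)]
        by (intro bexI[of _ "vec_index ((- 1) \<cdot>\<^sub>v x)"]) (auto simp: Z_def)
    qed
  qed
  have w: "w = (\<integral>g. (SUP z\<in>Z. ip {..<d} g z) \<partial>std_gaussian d)"
  proof -
    have "vec d g \<bullet> x = ip {..<d} g (vec_index x)" if "x \<in> ?S" for x g
      unfolding scalar_prod_ip[OF cone_sphereD(2)[OF that]] by (intro ip_cong) auto
    then show ?thesis
      unfolding w_def gaussian_width_def Z_def image_image by (simp cong: SUP_cong)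
  qed
  show "3 / 2 \<le> exp (64 * w\<^sup>2)" by (rule width_ge[OF Z w])
  from sudakov_net[OF Z w \<delta>] obtain N' where N': "finite N'" "N' \<subseteq> Z" "real (card N') \<le> exp (3840 * w\<^sup>2 / \<delta>\<^sup>2)"
    "\<And>z. z \<in> Z \<Longrightarrow> \<exists>y\<in>N'. sqdist d z y \<le> \<delta>\<^sup>2" by auto
  \<comment> \<open>An injective choice of preimages keeps the cardinality of the net.\<close>
  obtain N where N: "N \<subseteq> ?S" "inj_on vec_index N" "N' = vec_index ` N"
    using N'(2) unfolding Z_def subset_image_inj by blast
  have "finite N" "card N = card N'" using N N'(1) by (auto simp: finite_image_iff card_image)
  moreover have "\<exists>y\<in>N. norm2 (x - y) \<le> \<delta>" if x: "x \<in> ?S" for x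
  proof -
    obtain y where y: "y \<in> N" "sqdist d (vec_index x) (vec_index y) \<le> \<delta>\<^sup>2"
      using N'(4)[of "vec_index x"] x N(3) by (auto simp: Z_def)
    have "y \<in> ?S" using y N(1) by blast
    then have "norm2 (x - y) = sqrt (sqdist d (vec_index x) (vec_index y))"
      using x by (intro norm2_minus) (auto dest: cone_sphereD(2))
    also have "\<dots> \<le> \<delta>" using y(2) \<delta>(1) by (intro real_le_lsqrt) (auto simp: ip_nonneg)
    finally show ?thesis using y(1) by blast
  qed
  ultimately show "\<exists>N. finite N \<and> N \<subseteq> ?S \<and> real (card N) \<le> exp (3840 * w\<^sup>2 / \<delta>\<^sup>2) \<and>
      (\<forall>x\<in>?S. \<exists>y\<in>N. norm2 (x - y) \<le> \<delta>)"
    using N(1) N'(3) by (intro exI[of _ N]) auto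
qed

lemma prob_randomness_mono:
  assumes "\<And>\<xi> \<pi> \<xi>'. \<pi> permutes {..<d} \<Longrightarrow> (\<xi>, \<pi>, \<xi>') \<in> E \<Longrightarrow> (\<xi>, \<pi>, \<xi>') \<in> E'"
  shows "measure_pmf.prob (randomness d) E \<le> measure_pmf.prob (randomness d) E'"
  unfolding prob_randomness using assms by (intro avg_mono) (auto simp: of_bool_def)

text \<open>Orthogonality bounds the entries of B by 1, so the supremum in \<open>Theta\<close> is a
  genuine upper bound. It is positive because a point and its antipode span a secant, and for any
  secant the sums over l add up to 1 when k varies.\<close>

lemma secant_theta_bounds:
  assumes B: "B \<in> orthogonal_group d" and C: "balanced_cone d C"
  defines "V \<equiv> Theta d B (secant_set (cone_sphere d C)) / real d"
  shows "s \<in> secant_set (cone_sphere d C) \<Longrightarrow> s \<in> carrier_vec d \<and> norm2 s = 1"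
    and "s \<in> secant_set (cone_sphere d C) \<Longrightarrow> k < d \<Longrightarrow> (\<Sum>l<d. (B $$ (k, l))\<^sup>2 * (s $ l)\<^sup>2) \<le> V"
    and "0 < V"
proof -
  let ?S = "cone_sphere d C"
  have d: "0 < d" using cone_sphere_nonempty(2)[OF C] .
  show unit: "s \<in> carrier_vec d \<and> norm2 s = 1" if s: "s \<in> secant_set ?S" for s
  proof -
    obtain x y where xy: "s = (1 / norm2 (x - y)) \<cdot>\<^sub>v (x - y)" "x \<in> ?S" "y \<in> ?S" "x \<noteq> y"
      using s by (auto simp: secant_set_def)
    have carr: "x \<in> carrier_vec d" "y \<in> carrier_vec d" using xy cone_sphereD(2) by auto
    have "norm2 (x - y) \<noteq> 0" using carr xy(4) by (rule norm2_minus_neq_0)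
    then show ?thesis using carr norm2_nonneg[of "x - y"] by (auto simp: xy(1) norm2_smult[of _ d])
  qed
  define g where "g = (\<lambda>(s, k). \<Sum>l<d. (B $$ (k, l))\<^sup>2 * (s $ l)\<^sup>2)"
  have V: "V = (SUP p\<in>secant_set ?S \<times> {..<d}. g p)"
    using d by (simp add: V_def Theta_def g_def)
  have B1: "(B $$ (k, l))\<^sup>2 \<le> 1" if "k < d" "l < d" for k l
  proof -
    have "B $$ (k, l) * B $$ (k, l) \<le> (\<Sum>k<d. B $$ (k, l) * B $$ (k, l))"
      using that(1) by (intro member_le_sum) auto
    then show ?thesis using orthogonal_group_columns[OF B that(2,2)] by (simp add: power2_eq_square)
  qed
  have sum1: "(\<Sum>l<d. (s $ l)\<^sup>2) = 1" if "s \<in> secant_set ?S" for s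
    using unit[OF that] norm2_power2[of s d] by (simp add: ip_def power2_eq_square)
  have bdd: "bdd_above (g ` (secant_set ?S \<times> {..<d}))"
  proof (rule bdd_aboveI2)
    fix p assume p: "p \<in> secant_set ?S \<times> {..<d}"
    obtain s k where sk: "p = (s, k)" by (cases p)
    have "g p \<le> (\<Sum>l<d. 1 * (s $ l)\<^sup>2)"
      unfolding sk g_def prod.case using B1 p sk by (intro sum_mono mult_right_mono) auto
    then show "g p \<le> 1" using sum1[of s] p sk by simp
  qed
  show le: "(\<Sum>l<d. (B $$ (k, l))\<^sup>2 * (s $ l)\<^sup>2) \<le> V" if "s \<in> secant_set ?S" "k < d" for s k
    using cSUP_upper[OF _ bdd, of "(s, k)"] that unfolding V by (simp add: g_def)
  obtain x where x: "x \<in> ?S" using cone_sphere_nonempty(1)[OF C] by blast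
  have "x \<noteq> (- 1) \<cdot>\<^sub>v x"
  proof
    assume "x = (- 1) \<cdot>\<^sub>v x"
    then have eq: "x $ i = ((- 1) \<cdot>\<^sub>v x) $ i" for i by simp
    have "x $ i = 0" if "i < d" for i using eq[of i] cone_sphereD(2)[OF x] that by simp
    then have "ip {..<d} (vec_index x) (vec_index x) = 0" by (simp add: ip_def)
    then show False using cone_sphereD(4)[OF x] by simp
  qed
  then obtain s where s: "s \<in> secant_set ?S"
    using x uminus_in_cone_sphere[OF C x] by (auto simp: secant_set_def)
  have "1 = (\<Sum>l<d. (\<Sum>k<d. (B $$ (k, l))\<^sup>2) * (s $ l)\<^sup>2)"
    using sum1[OF s] orthogonal_group_columns[OF B] by (simp add: power2_eq_square)
  also have "\<dots> = (\<Sum>k<d. \<Sum>l<d. (B $$ (k, l))\<^sup>2 * (s $ l)\<^sup>2)"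
    unfolding sum_distrib_right by (rule sum.swap)
  also have "\<dots> \<le> (\<Sum>k<d. V)" using le[OF s] by (intro sum_mono) auto
  finally have "1 \<le> real d * V" by simp
  then have "0 < real d * V" by linarith
  then show "0 < V" by (simp add: zero_less_mult_iff)
qed

theorem corollary5p5:
  shows "\<exists>C0::real. C0 > 0 \<and>
    (\<forall>(d::nat) (lam::real) (C::real vec set) (\<epsilon>::real) (\<eta>::real)
       (A::real mat) (B::real mat) (I::nat set) (m::nat) (a::real).
      1 \<le> lam \<longrightarrow>
      balanced_cone d C \<longrightarrow>
      secant_generating d lam C \<longrightarrow>
      0 < \<epsilon> \<longrightarrow> \<epsilon> < 1 \<longrightarrow>
      0 < \<eta> \<longrightarrow> \<eta> < 1 / 2 \<longrightarrow>
      a = cone_complexity C0 lam d C \<eta> \<longrightarrow>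
      A \<in> orthogonal_group d \<longrightarrow>
      B \<in> orthogonal_group d \<longrightarrow>
      I \<subseteq> {..<d} \<longrightarrow> card I = m \<longrightarrow>
      real m \<ge> 2025 * (1 / \<epsilon>\<^sup>2) * a \<longrightarrow>
      36 * kappa d I A * Theta d B (secant_set (cone_sphere d C)) * real m
        * (a + ln (real d)) * (a + ln (real m)) \<le> real d \<longrightarrow>
      measure_pmf.prob (randomness d)
        {(\<xi>, p, \<xi>').
          \<forall>x\<in>C. \<bar>(norm2 (random_map d I A B \<xi> p \<xi>' *\<^sub>v x))\<^sup>2 - (norm2 x)\<^sup>2\<bar>
                \<le> \<epsilon> * (norm2 x)\<^sup>2}
        \<ge> 1 - \<eta>)"
proof (rule exI[of _ 4000000], intro conjI allI impI)
  show "(0::real) < 4000000" by simp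
  fix d m :: nat and lam \<epsilon> \<eta> a :: real and C :: "real vec set" and A B :: "real mat" and I :: "nat set"
  assume lam: "1 \<le> lam" and C: "balanced_cone d C" and sec: "secant_generating d lam C"
    and \<epsilon>: "0 < \<epsilon>" "\<epsilon> < 1" and \<eta>: "0 < \<eta>" "\<eta> < 1 / 2"
    and a: "a = cone_complexity 4000000 lam d C \<eta>"
    and A: "A \<in> orthogonal_group d" and B: "B \<in> orthogonal_group d"
    and I: "I \<subseteq> {..<d}" and m: "card I = m"
    and m_ge: "real m \<ge> 2025 * (1 / \<epsilon>\<^sup>2) * a"
    and cond: "36 * kappa d I A * Theta d B (secant_set (cone_sphere d C)) * real m
        * (a + ln (real d)) * (a + ln (real m)) \<le> real d"
  let ?S = "cone_sphere d C"
  define w where "w = gaussian_width d ?S"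
  define \<delta> where "\<delta> = 1 / (20 * lam)"
  have d: "0 < d" using cone_sphere_nonempty(2)[OF C] .
  have \<delta>: "0 < \<delta>" "\<delta> \<le> 2" "lam * \<delta> \<le> 1 / 20"
    using lam by (auto simp: \<delta>_def field_simps)
  have w: "3 / 2 \<le> exp (64 * w\<^sup>2)"
    unfolding w_def by (rule cone_sphere_sudakov_net(1)[OF C \<delta>(1,2)])
  obtain N where N: "finite N" "N \<subseteq> ?S" "real (card N) \<le> exp (3840 * w\<^sup>2 / \<delta>\<^sup>2)"
    "\<And>x. x \<in> ?S \<Longrightarrow> \<exists>y\<in>N. norm2 (x - y) \<le> \<delta>"
    using cone_sphere_sudakov_net(2)[OF C \<delta>(1,2)] unfolding w_def[symmetric] by blast
  \<comment> \<open>Polarization uses sums of net points as well as differences; a sum is a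
    difference with a negated point.\<close>
  define N' where "N' = N \<union> (\<lambda>x. (- 1) \<cdot>\<^sub>v x) ` N"
  define F where "F = (\<lambda>(x, y). (1 / norm2 (x - y)) \<cdot>\<^sub>v (x - y)) ` {(x, y) \<in> N \<times> N'. x \<noteq> y}"
  have finN': "finite N'" using N(1) by (simp add: N'_def)
  then have finF: "finite F" unfolding F_def using N(1) by (auto intro: finite_subset[of _ "N \<times> N'"])
  have N'_S: "N' \<subseteq> ?S" using N(2) uminus_in_cone_sphere[OF C] by (auto simp: N'_def)
  have F_sec: "F \<subseteq> secant_set ?S" using N(2) N'_S by (auto simp: F_def secant_set_def)
  (* The exponent needed is 2 * 3840 * 20^2 for the two ends of a secant, plus 128 for the sign. *)
  have card_F: "real (card F) \<le> exp (4000000 * lam\<^sup>2 * w\<^sup>2)"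
  proof -
    have "card F \<le> card {(x, y) \<in> N \<times> N'. x \<noteq> y}"
      unfolding F_def using N(1) finN' by (intro card_image_le) (auto intro: finite_subset[of _ "N \<times> N'"])
    also have "\<dots> \<le> card (N \<times> N')" using N(1) finN' by (intro card_mono) auto
    also have "\<dots> \<le> card N * (2 * card N)"
    proof -
      have "card N' \<le> card N + card ((\<lambda>x. (- 1) \<cdot>\<^sub>v x) ` N)" unfolding N'_def by (rule card_Un_le)
      also have "\<dots> \<le> 2 * card N" using card_image_le[OF N(1)] by simp
      finally show ?thesis by (simp add: card_cartesian_product)
    qed
    finally have "real (card F) \<le> real (card N * (2 * card N))" by (simp only: of_nat_le_iff)
    also have "\<dots> = 2 * (real (card N) * real (card N))" by simp
    also have "\<dots> \<le> exp (128 * w\<^sup>2) * (exp (3840 * w\<^sup>2 / \<delta>\<^sup>2) * exp (3840 * w\<^sup>2 / \<delta>\<^sup>2))"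
    proof (intro mult_mono N(3))
      have "2 \<le> (3 / 2) * (3 / 2 :: real)" by simp
      also have "\<dots> \<le> exp (64 * w\<^sup>2) * exp (64 * w\<^sup>2)" using w by (intro mult_mono) auto
      finally show "2 \<le> exp (128 * w\<^sup>2)" by (simp flip: exp_add)
    qed auto
    also have "\<dots> = exp (128 * w\<^sup>2 + (3840 * w\<^sup>2 / \<delta>\<^sup>2 + 3840 * w\<^sup>2 / \<delta>\<^sup>2))"
      by (simp only: exp_add)
    also have "\<dots> \<le> exp (4000000 * lam\<^sup>2 * w\<^sup>2)"
    proof -
      have "3840 * w\<^sup>2 / \<delta>\<^sup>2 = 1536000 * (lam\<^sup>2 * w\<^sup>2)"
        using lam by (simp add: \<delta>_def power2_eq_square)
      moreover have "1 * w\<^sup>2 \<le> lam\<^sup>2 * w\<^sup>2" using lam by (intro mult_right_mono) auto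
      moreover have "0 \<le> lam\<^sup>2 * w\<^sup>2" by simp
      ultimately have "128 * w\<^sup>2 + (3840 * w\<^sup>2 / \<delta>\<^sup>2 + 3840 * w\<^sup>2 / \<delta>\<^sup>2) \<le> 4000000 * (lam\<^sup>2 * w\<^sup>2)"
        by linarith
      then show ?thesis by (simp only: exp_le_cancel_iff mult.assoc)
    qed
    finally show ?thesis .
  qed
  have a_eq: "a = 4000000 * lam\<^sup>2 * w\<^sup>2 + ln (16 / \<eta>)"
    by (simp add: a cone_complexity_def w_def)
  \<comment> \<open>Since \<eta> < 1/2, the argument of the logarithm exceeds 32, and exp 3 \<le>
    27.\<close>
  have a3: "3 \<le> a"
  proof -
    have "exp (3::real) = exp 1 * exp 1 * exp 1" by (simp flip: exp_add)
    also have "\<dots> \<le> 3 * 3 * 3" using exp_le by (intro mult_mono) auto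
    also have "\<dots> \<le> 16 / \<eta>" using \<eta> by (simp add: field_simps)
    finally have "3 \<le> ln (16 / \<eta>)" using \<eta> by (subst ln_ge_iff) auto
    moreover have "0 \<le> 4000000 * lam\<^sup>2 * w\<^sup>2" by simp
    ultimately show ?thesis unfolding a_eq by linarith
  qed
  \<comment> \<open>The width term of a cancels the cardinality of F; the logarithmic term leaves 8
    \<eta> / 16.\<close>
  have F_exp: "real (card F) * (8 * exp (- a)) \<le> \<eta>"
  proof -
    have "exp (- a) = exp (- (4000000 * lam\<^sup>2 * w\<^sup>2)) * exp (- ln (16 / \<eta>))"
      unfolding a_eq by (simp flip: exp_add)
    also have "exp (- ln (16 / \<eta>)) = \<eta> / 16" using \<eta> by (simp add: exp_minus)
    finally have "real (card F) * (8 * exp (- a)) = real (card F) * exp (- (4000000 * lam\<^sup>2 * w\<^sup>2)) * (\<eta> / 2)"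
      by simp
    also have "\<dots> \<le> exp (4000000 * lam\<^sup>2 * w\<^sup>2) * exp (- (4000000 * lam\<^sup>2 * w\<^sup>2)) * (\<eta> / 2)"
      using card_F \<eta> by (intro mult_right_mono) auto
    also have "\<dots> = \<eta> / 2" unfolding exp_minus_inverse by simp
    finally show ?thesis using \<eta> by simp
  qed
  \<comment> \<open>V bounds the variance of a single coordinate of a rotated secant under the
    random signs \<xi>'.\<close>
  define V where "V = Theta d B (secant_set ?S) / real d"
  note V = secant_theta_bounds[OF B C, folded V_def]
  have condV: "36 * kappa d I A * V * real m * (a + ln (real d)) * (a + ln (real m)) \<le> 1"
  proof -
    have "36 * kappa d I A * V * real m * (a + ln (real d)) * (a + ln (real m)) =
        36 * kappa d I A * Theta d B (secant_set ?S) * real m * (a + ln (real d)) * (a + ln (real m)) / real d"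
      by (simp add: V_def)
    also have "\<dots> \<le> 1" using cond d by simp
    finally show ?thesis .
  qed
  have m_ge': "2025 * a \<le> \<epsilon>\<^sup>2 * real m" using m_ge \<epsilon> by (simp add: field_simps)
  define bad where "bad s = {(\<xi>, p, \<xi>'). 9 / 10 * \<epsilon> < \<bar>(norm2 (random_map d I A B \<xi> p \<xi>' *\<^sub>v s))\<^sup>2 - 1\<bar>}" for s
  define good where "good = {(\<xi>, p, \<xi>'). \<forall>x\<in>C.
    \<bar>(norm2 (random_map d I A B \<xi> p \<xi>' *\<^sub>v x))\<^sup>2 - (norm2 x)\<^sup>2\<bar> \<le> \<epsilon> * (norm2 x)\<^sup>2}"
  have bad_prob: "measure_pmf.prob (randomness d) (bad s) \<le> 8 * exp (- a)" if "s \<in> F" for s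
  proof -
    have s: "s \<in> secant_set ?S" using that F_sec by blast
    show ?thesis
      unfolding prob_randomness bad_def mem_Collect_eq prod.case
      using V(1)[OF s] V(2)[OF s]
      by (intro avg_random_map_fixed_vector_le[OF d A B I m _ _ V(3) _ condV a3 \<epsilon> m_ge']) auto
  qed
  have "measure_pmf.prob (randomness d) (- good) \<le> measure_pmf.prob (randomness d) (\<Union>s\<in>F. bad s)"
  proof (rule prob_randomness_mono, rule ccontr)
    fix \<xi> p \<xi>' assume p: "p permutes {..<d}" and not_good: "(\<xi>, p, \<xi>') \<in> - good"
      and not_bad: "(\<xi>, p, \<xi>') \<notin> (\<Union>s\<in>F. bad s)"
    have "\<bar>(norm2 (random_map d I A B \<xi> p \<xi>' *\<^sub>v x))\<^sup>2 - (norm2 x)\<^sup>2\<bar> \<le> \<epsilon> * (norm2 x)\<^sup>2"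
      if x: "x \<in> C" for x
    proof (rule near_isometry_from_secants[OF orthogonal_group_carrier[OF A] orthogonal_group_carrier[OF B]
          I p C sec lam N(2,4) \<delta>(3) _ x])
      fix y y' assume "y \<in> N" "y' \<in> N \<union> (\<lambda>x. (- 1) \<cdot>\<^sub>v x) ` N" "y \<noteq> y'"
      then have "(y, y') \<in> {(x, y) \<in> N \<times> N'. x \<noteq> y}" by (simp add: N'_def)
      then have "(1 / norm2 (y - y')) \<cdot>\<^sub>v (y - y') \<in> F"
        unfolding F_def by (rule image_eqI[rotated]) simp
      then have "(\<xi>, p, \<xi>') \<notin> bad ((1 / norm2 (y - y')) \<cdot>\<^sub>v (y - y'))"
        using not_bad by blast
      then show "\<bar>(norm2 (random_map d I A B \<xi> p \<xi>' *\<^sub>v ((1 / norm2 (y - y')) \<cdot>\<^sub>v (y - y'))))\<^sup>2 - 1\<bar> \<le> 9 / 10 * \<epsilon>"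
        unfolding bad_def mem_Collect_eq prod.case not_less .
    qed
    then show False using not_good by (simp add: good_def)
  qed
  also have "\<dots> \<le> (\<Sum>s\<in>F. measure_pmf.prob (randomness d) (bad s))"
    using finF by (intro measure_pmf.finite_measure_subadditive_finite) auto
  also have "\<dots> \<le> (\<Sum>s\<in>F. 8 * exp (- a))" by (intro sum_mono bad_prob)
  also have "\<dots> = real (card F) * (8 * exp (- a))" by simp
  also note F_exp
  finally have "measure_pmf.prob (randomness d) (- good) \<le> \<eta>" .
  moreover have "measure_pmf.prob (randomness d) (- good) = 1 - measure_pmf.prob (randomness d) good"
    using measure_pmf.prob_compl[of good "randomness d"] by (simp add: Compl_eq_Diff_UNIV)
  ultimately show "measure_pmf.prob (randomness d)
      {(\<xi>, p, \<xi>'). \<forall>x\<in>C. \<bar>(norm2 (random_map d I A B \<xi> p \<xi>' *\<^sub>v x))\<^sup>2 - (norm2 x)\<^sup>2\<bar>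
        \<le> \<epsilon> * (norm2 x)\<^sup>2} \<ge> 1 - \<eta>"
    unfolding good_def by linarith
qed

end
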